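(* There is a triangle complex $X_1'$ homeomorphic to $X_1$ and such that the universal cover $\widetilde{X_1'}$ is systolic.
   Context: A triangle complex is a complex obtained by gluing unit equilateral triangles isometrically along edges (edges of the same triangle may be identified). Systolic complexes: in a simplicial complex $X$, a cycle is a subcomplex isomorphic to a triangulation of $S^1$, its length being its number of edges. A subcomplex $X'$ of $X$ is full if every collection of vertices of $X'$ contained in a common simplex of $X$ is contained in a common simplex of $X'$. The residue $\mathrm{Res}(\sigma,X)$ of a simplex $\sigma$ is the smallest subcomplex of $X$ containing all simplices $\tau\supseteq\sigma$. The link $X_\sigma$ of $\sigma$ is the subcomplex of simplices $\tau$ with $\tau\cap\sigma=\emptyset$ and $\tau\cup\sigma$ a simplex of $X$. The systole $\mathrm{sys}(X)$ is the minimal length of a full cycle in $X$ ($\infty$ if there is none). For $k\ge4$, $X$ is $k$-large if $\mathrm{sys}(X)\ge k$ and $\mathrm{sys}(X_\sigma)\ge k$ for each simplex $\sigma$; locally $k$-large if the residue of every simplex is $k$-large; $k$-systolic if it is connected, simply connected and locally $k$-large. Systolic means $6$-systolic. Gluing notation: $e: AB\sim YZ$ means that the oriented edge (or diagonal) $AB$ of a polygon is glued isometrically and preserving orientation to the oriented edge (or diagonal) $YZ$ of a (possibly the same) polygon; the resulting oriented edge is labelled $e$. The complex $X_1$ consists of three rhombi $K_1L_1M_1N_1$, $K_2L_2M_2N_2$, $ABCD$ with sides of unit length and $\angle N_1K_1L_1=\angle N_2K_2L_2=\angle ABC=\frac{\pi}{3}$, and three unit squares $P_1Q_1R_1S_1$,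 $P_2Q_2R_2S_2$, $P_3Q_3R_3S_3$, glued as follows: $e_1: M_1L_1\sim N_1K_1\sim P_1Q_1$; $e_2: K_1L_1\sim N_1M_1\sim P_2Q_2$; $e_3: L_1N_1\sim P_3Q_3$; $f_1: L_2K_2\sim M_2N_2\sim S_1R_1$; $f_2: L_2M_2\sim K_2N_2\sim S_2R_2$; $f_3: N_2L_2\sim S_3R_3$; $g: BA\sim CD\sim P_1S_1\sim Q_1R_1$; $h: CB\sim DA\sim P_2S_2\sim Q_2R_2$; $i: AC\sim P_3S_3\sim Q_3R_3$. Here $L_1N_1$, $N_2L_2$ and $AC$ are the short diagonals of the rhombi. *)

theory Defs
  imports "HOL-Analysis.Analysis"
begin

section \<open>Topological preliminaries\<close>

definition quotient_topology :: "'a topology \<Rightarrow> ('a \<Rightarrow> 'b) \<Rightarrow> 'b topology" where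
  "quotient_topology X f =
     topology (\<lambda>U. U \<subseteq> f ` topspace X \<and> openin X {x \<in> topspace X. f x \<in> U})"

lemma openin_quotient_topology:
  "openin (quotient_topology X f) U \<longleftrightarrow>
     U \<subseteq> f ` topspace X \<and> openin X {x \<in> topspace X. f x \<in> U}"
proof -
  have 1: "{x \<in> topspace X. f x \<in> S \<inter> T} =
      {x \<in> topspace X. f x \<in> S} \<inter> {x \<in> topspace X. f x \<in> T}" for S T by auto
  have 2: "{x \<in> topspace X. f x \<in> \<Union>\<K>} = (\<Union>K\<in>\<K>. {x \<in> topspace X. f x \<in> K})" for \<K> by auto
  have "istopology (\<lambda>U. U \<subseteq> f ` topspace X \<and> openin X {x \<in> topspace X. f x \<in> U})"
    unfolding istopology_def 1 2 by blast
  then show ?thesis by (simp add: quotient_topology_def)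
qed

lemma topspace_quotient_topology [simp]: "topspace (quotient_topology X f) = f ` topspace X"
proof -
  have "{x \<in> topspace X. f x \<in> f ` topspace X} = topspace X" by auto
  then have "openin (quotient_topology X f) (f ` topspace X)"
    by (simp add: openin_quotient_topology)
  then show ?thesis
    by (metis openin_quotient_topology openin_subset openin_topspace subset_antisym)
qed

lemma quotient_map_quotient_topology: "quotient_map X (quotient_topology X f) f"
  by (auto simp: quotient_map_def openin_quotient_topology)

text \<open>The next two notions transcribe the library's \<open>simply_connected\<close> and
  \<open>covering_space\<close>, which are confined to subsets of type-class topologies,
  to abstract topologies.\<close>

definition loop_in :: "'a topology \<Rightarrow> (real \<Rightarrow> 'a) \<Rightarrow> bool" where
  "loop_in X p \<longleftrightarrow> pathin X p \<and> p 1 = p 0"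

definition simply_connected_space :: "'a topology \<Rightarrow> bool" where
  "simply_connected_space X \<longleftrightarrow>
     (\<forall>p q. loop_in X p \<and> loop_in X q \<longrightarrow>
        homotopic_with (\<lambda>r. r 1 = r 0) (top_of_set {0..1}) X p q)"

definition covering_map :: "'a topology \<Rightarrow> 'b topology \<Rightarrow> ('a \<Rightarrow> 'b) \<Rightarrow> bool" where
  "covering_map E X p \<longleftrightarrow>
     continuous_map E X p \<and> p ` topspace E = topspace X \<and>
     (\<forall>x \<in> topspace X. \<exists>T. x \<in> T \<and> openin X T \<and>
        (\<exists>\<U>. \<Union>\<U> = {y \<in> topspace E. p y \<in> T} \<and>
             (\<forall>U\<in>\<U>. openin E U) \<and> pairwise disjnt \<U> \<and>
             (\<forall>U\<in>\<U>. homeomorphic_map (subtopology E U) (subtopology X T) p)))"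

definition universal_covering_map :: "'a topology \<Rightarrow> 'b topology \<Rightarrow> ('a \<Rightarrow> 'b) \<Rightarrow> bool" where
  "universal_covering_map E X p \<longleftrightarrow> covering_map E X p \<and> simply_connected_space E"


section \<open>Simplicial complexes\<close>

text \<open>The library's \<open>simplicial_complex\<close> only covers finite complexes embedded in a
  Euclidean space; universal covers require infinite ones.\<close>

definition abstract_complex :: "'v set set \<Rightarrow> bool" where
  "abstract_complex X \<longleftrightarrow>
     (\<forall>\<sigma>\<in>X. finite \<sigma> \<and> \<sigma> \<noteq> {}) \<and> (\<forall>\<sigma>\<in>X. \<forall>\<tau>. \<tau> \<subseteq> \<sigma> \<and> \<tau> \<noteq> {} \<longrightarrow> \<tau> \<in> X)"

definition support :: "('v \<Rightarrow> real) \<Rightarrow> 'v set" where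
  "support x = {v. x v \<noteq> 0}"

text \<open>Points are given by their barycentric coordinates.\<close>

definition closed_simplex :: "'v set \<Rightarrow> ('v \<Rightarrow> real) set" where
  "closed_simplex \<sigma> = {x. support x \<subseteq> \<sigma> \<and> (\<forall>v\<in>\<sigma>. 0 \<le> x v) \<and> (\<Sum>v\<in>\<sigma>. x v) = 1}"

text \<open>The geometric realization carries the weak topology. On a closed simplex, the product
  topology of \<^typ>\<open>'v \<Rightarrow> real\<close> is the Euclidean one, as the simplex is finite.\<close>

definition realization :: "'v set set \<Rightarrow> ('v \<Rightarrow> real) topology" where
  "realization X =
     topology (\<lambda>U. U \<subseteq> (\<Union>\<sigma>\<in>X. closed_simplex \<sigma>) \<and>
       (\<forall>\<sigma>\<in>X. openin (top_of_set (closed_simplex \<sigma>)) (U \<inter> closed_simplex \<sigma>)))"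

lemma openin_realization:
  "openin (realization X) U \<longleftrightarrow>
     U \<subseteq> (\<Union>\<sigma>\<in>X. closed_simplex \<sigma>) \<and>
     (\<forall>\<sigma>\<in>X. openin (top_of_set (closed_simplex \<sigma>)) (U \<inter> closed_simplex \<sigma>))"
proof -
  have 1: "S \<inter> T \<inter> A = (S \<inter> A) \<inter> (T \<inter> A)" for S T A :: "('v \<Rightarrow> real) set" by auto
  have 2: "\<Union>\<K> \<inter> A = (\<Union>K\<in>\<K>. K \<inter> A)" for \<K> and A :: "('v \<Rightarrow> real) set" by auto
  have "istopology (\<lambda>U. U \<subseteq> (\<Union>\<sigma>\<in>X. closed_simplex \<sigma>) \<and>
       (\<forall>\<sigma>\<in>X. openin (top_of_set (closed_simplex \<sigma>)) (U \<inter> closed_simplex \<sigma>)))"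
    unfolding istopology_def 2
  proof (intro conjI allI impI ballI, goal_cases)
    case (2 S T \<sigma>)
    then show ?case unfolding 1[of S T] by blast
  qed blast+
  then show ?thesis by (simp add: realization_def)
qed

lemma topspace_realization [simp]: "topspace (realization X) = (\<Union>\<sigma>\<in>X. closed_simplex \<sigma>)"
proof -
  have "openin (realization X) (\<Union>\<sigma>\<in>X. closed_simplex \<sigma>)"
    unfolding openin_realization
  proof (intro conjI ballI)
    fix \<sigma> assume "\<sigma> \<in> X"
    then have "(\<Union>\<sigma>\<in>X. closed_simplex \<sigma>) \<inter> closed_simplex \<sigma> = closed_simplex \<sigma>" by blast
    then show "openin (top_of_set (closed_simplex \<sigma>))
        ((\<Union>\<sigma>\<in>X. closed_simplex \<sigma>) \<inter> closed_simplex \<sigma>)" by simp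
  qed simp
  then show ?thesis
    by (metis openin_realization openin_subset openin_topspace subset_antisym)
qed


section \<open>Systolic complexes\<close>

definition subcomplex :: "'v set set \<Rightarrow> 'v set set \<Rightarrow> bool" where
  "subcomplex Y X \<longleftrightarrow> abstract_complex Y \<and> Y \<subseteq> X"

definition full_subcomplex :: "'v set set \<Rightarrow> 'v set set \<Rightarrow> bool" where
  "full_subcomplex Y X \<longleftrightarrow> subcomplex Y X \<and>
     (\<forall>S. S \<noteq> {} \<and> S \<subseteq> \<Union>Y \<and> (\<exists>\<sigma>\<in>X. S \<subseteq> \<sigma>) \<longrightarrow> (\<exists>\<sigma>\<in>Y. S \<subseteq> \<sigma>))"

definition cycle_in :: "'v set set \<Rightarrow> 'v set set \<Rightarrow> bool" where
  "cycle_in C X \<longleftrightarrow> subcomplex C X \<and>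
     realization C homeomorphic_space top_of_set (sphere (0::complex) 1)"

text \<open>A cycle is compact, so it has finitely many edges and \<open>card\<close> is meaningful.\<close>

definition cycle_length :: "'v set set \<Rightarrow> nat" where
  "cycle_length C = card {e \<in> C. card e = 2}"

text \<open>The infimum in \<^typ>\<open>enat\<close> of the empty set is \<open>\<infinity>\<close>.\<close>

definition systole :: "'v set set \<Rightarrow> enat" where
  "systole X = Inf {enat (cycle_length C) | C. cycle_in C X \<and> full_subcomplex C X}"

definition residue_of :: "'v set \<Rightarrow> 'v set set \<Rightarrow> 'v set set" where
  "residue_of \<sigma> X = \<Inter>{Y. subcomplex Y X \<and> (\<forall>\<tau>\<in>X. \<sigma> \<subseteq> \<tau> \<longrightarrow> \<tau> \<in> Y)}"

definition link_of :: "'v set \<Rightarrow> 'v set set \<Rightarrow> 'v set set" where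
  "link_of \<sigma> X = {\<tau> \<in> X. \<tau> \<inter> \<sigma> = {} \<and> \<tau> \<union> \<sigma> \<in> X}"

text \<open>The following three notions are meant for \<open>k \<ge> 4\<close>.\<close>

definition large :: "nat \<Rightarrow> 'v set set \<Rightarrow> bool" where
  "large k X \<longleftrightarrow> enat k \<le> systole X \<and> (\<forall>\<sigma>\<in>X. enat k \<le> systole (link_of \<sigma> X))"

definition locally_large :: "nat \<Rightarrow> 'v set set \<Rightarrow> bool" where
  "locally_large k X \<longleftrightarrow> (\<forall>\<sigma>\<in>X. large k (residue_of \<sigma> X))"

definition k_systolic :: "nat \<Rightarrow> 'v set set \<Rightarrow> bool" where
  "k_systolic k X \<longleftrightarrow> abstract_complex X \<and>
     connected_space (realization X) \<and> simply_connected_space (realization X) \<and>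
     locally_large k X"

definition systolic :: "'v set set \<Rightarrow> bool" where
  "systolic X \<longleftrightarrow> k_systolic 6 X"


section \<open>Gluing polygons\<close>

text \<open>An oriented segment \<open>(i, a, b)\<close> runs from \<open>a\<close> to \<open>b\<close> in the \<open>i\<close>-th polygon. A gluing is
  a set of classes of oriented segments (one class per label); all segments in a class are
  identified by the affine maps preserving orientation, which are isometries when the segments
  have equal length.\<close>

type_synonym 'i gluing = "('i \<times> complex \<times> complex) set set"

definition glue_step :: "'i gluing \<Rightarrow> (('i \<times> complex) \<times> ('i \<times> complex)) set" where
  "glue_step G =
     {((i, linepath a b t), (j, linepath c d t)) | i a b j c d t.
        t \<in> {0..1} \<and> (\<exists>c'\<in>G. (i, a, b) \<in> c' \<and> (j, c, d) \<in> c')}"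

text \<open>The relation \<open>glue_step G\<close> is symmetric, so its reflexive transitive closure is the
  equivalence relation it generates.\<close>

definition glue_class ::
    "'i set \<Rightarrow> ('i \<Rightarrow> complex set) \<Rightarrow> 'i gluing \<Rightarrow> 'i \<times> complex \<Rightarrow> ('i \<times> complex) set" where
  "glue_class I P G x = (glue_step G)\<^sup>* `` {x} \<inter> Sigma I P"

definition glued_space ::
    "'i set \<Rightarrow> ('i \<Rightarrow> complex set) \<Rightarrow> 'i gluing \<Rightarrow> ('i \<times> complex) set topology" where
  "glued_space I P G =
     quotient_topology (sum_topology (\<lambda>i. top_of_set (P i)) I) (glue_class I P G)"

lemma sym_glue_step: "sym (glue_step G)"
  unfolding sym_def glue_step_def by blast


section \<open>Triangle complexes\<close>

definition triangle_corners :: "complex set" where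
  "triangle_corners = {0, 1, cis (pi/3)}"

definition unit_triangle :: "complex set" where
  "unit_triangle = convex hull triangle_corners"

text \<open>The last clause says that every open edge embeds, i.e. that no edge is folded by being
  glued to itself with the opposite orientation; distinct edges of one triangle may be
  identified.\<close>

definition triangle_complex :: "'i set \<Rightarrow> 'i gluing \<Rightarrow> bool" where
  "triangle_complex I G \<longleftrightarrow>
     (\<forall>c\<in>G. \<forall>(i, a, b)\<in>c. i \<in> I \<and> a \<in> triangle_corners \<and> b \<in> triangle_corners \<and> a \<noteq> b) \<and>
     (\<forall>i\<in>I. \<forall>a\<in>triangle_corners. \<forall>b\<in>triangle_corners. a \<noteq> b \<longrightarrow>
        inj_on (\<lambda>t. glue_class I (\<lambda>_. unit_triangle) G (i, linepath a b t)) {0<..<1})"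

definition triangle_class :: "'i set \<Rightarrow> 'i gluing \<Rightarrow> 'i \<times> complex \<Rightarrow> ('i \<times> complex) set" where
  "triangle_class I G = glue_class I (\<lambda>_. unit_triangle) G"

definition triangle_space :: "'i set \<Rightarrow> 'i gluing \<Rightarrow> ('i \<times> complex) set topology" where
  "triangle_space I G = glued_space I (\<lambda>_. unit_triangle) G"

text \<open>The universal cover of a triangle complex, with the triangle structure lifted from the base,
  is the simplicial complex \<open>K\<close>: the realization of \<open>K\<close> is a universal covering space of the base,
  \<open>K\<close> is a union of closed 2-simplices, and the covering map takes each of them affinely,
  corners to corners, to a triangle of the base. As the interiors of the triangles are embedded
  disjointly in the base, the 2-simplices of \<open>K\<close> are then exactly the lifts of the triangles.\<close>

definition universal_cover_complex ::
    "'i set \<Rightarrow> 'i gluing \<Rightarrow> 'v set set \<Rightarrow> (('v \<Rightarrow> real) \<Rightarrow> ('i \<times> complex) set) \<Rightarrow> bool" where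
  "universal_cover_complex I G K p \<longleftrightarrow>
     abstract_complex K \<and>
     universal_covering_map (realization K) (triangle_space I G) p \<and>
     (\<forall>\<sigma>\<in>K. \<exists>\<tau>\<in>K. \<sigma> \<subseteq> \<tau> \<and> card \<tau> = 3) \<and>
     (\<forall>\<tau>\<in>K. card \<tau> = 3 \<longrightarrow>
        (\<exists>i\<in>I. \<exists>\<phi>. bij_betw \<phi> \<tau> triangle_corners \<and>
           (\<forall>x\<in>closed_simplex \<tau>. p x = triangle_class I G (i, \<Sum>v\<in>\<tau>. x v *\<^sub>R \<phi> v))))"


section \<open>The complex \<open>X\<^sub>1\<close>\<close>

datatype piece = Rh1 | Rh2 | RhABCD | Sq1 | Sq2 | Sq3

text \<open>Corners of the rhombi \<open>KLMN\<close> (with angle \<open>\<pi>/3\<close> at \<open>K\<close>), of the rhombus \<open>ABCD\<close>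
  (with angle \<open>\<pi>/3\<close> at \<open>B\<close>) and of the squares \<open>PQRS\<close>.\<close>

definition cK :: complex where "cK = 0"
definition cL :: complex where "cL = 1"
definition cM :: complex where "cM = 1 + cis (pi/3)"
definition cN :: complex where "cN = cis (pi/3)"

definition cA :: complex where "cA = 1"
definition cB :: complex where "cB = 0"
definition cC :: complex where "cC = cis (pi/3)"
definition cD :: complex where "cD = 1 + cis (pi/3)"

definition cP :: complex where "cP = 0"
definition cQ :: complex where "cQ = 1"
definition cR :: complex where "cR = 1 + \<i>"
definition cS :: complex where "cS = \<i>"

fun X1_polygon :: "piece \<Rightarrow> complex set" where
  "X1_polygon Rh1 = convex hull {cK, cL, cM, cN}"
| "X1_polygon Rh2 = convex hull {cK, cL, cM, cN}"
| "X1_polygon RhABCD = convex hull {cA, cB, cC, cD}"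
| "X1_polygon Sq1 = convex hull {cP, cQ, cR, cS}"
| "X1_polygon Sq2 = convex hull {cP, cQ, cR, cS}"
| "X1_polygon Sq3 = convex hull {cP, cQ, cR, cS}"

text \<open>The classes are \<open>e\<^sub>1, e\<^sub>2, e\<^sub>3, f\<^sub>1, f\<^sub>2, f\<^sub>3, g, h, i\<close>, in this order.\<close>

definition X1_gluing :: "piece gluing" where
  "X1_gluing =
    {{(Rh1, cM, cL), (Rh1, cN, cK), (Sq1, cP, cQ)},
     {(Rh1, cK, cL), (Rh1, cN, cM), (Sq2, cP, cQ)},
     {(Rh1, cL, cN), (Sq3, cP, cQ)},
     {(Rh2, cL, cK), (Rh2, cM, cN), (Sq1, cS, cR)},
     {(Rh2, cL, cM), (Rh2, cK, cN), (Sq2, cS, cR)},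
     {(Rh2, cN, cL), (Sq3, cS, cR)},
     {(RhABCD, cB, cA), (RhABCD, cC, cD), (Sq1, cP, cS), (Sq1, cQ, cR)},
     {(RhABCD, cC, cB), (RhABCD, cD, cA), (Sq2, cP, cS), (Sq2, cQ, cR)},
     {(RhABCD, cA, cC), (Sq3, cP, cS), (Sq3, cQ, cR)}}"

definition X1 :: "(piece \<times> complex) set topology" where
  "X1 = glued_space UNIV X1_polygon X1_gluing"

end

theory Submission
  imports Defs
begin

text \<open>Replacing the unit squares of \<open>X\<^sub>1\<close> by rhombi, cut along their diagonals \<open>PR\<close>, turns \<open>X\<^sub>1\<close> into
  a complex of twelve triangles with a single vertex. If \<open>e\<^sub>3, f\<^sub>3, i\<close> are reversed, the triangles
  are positive relations \<open>x y = z\<close>. The universal cover is the Cayley complex of the group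
  presented by these relations, with a simplex \<open>{v, v x, v z}\<close> for each vertex \<open>v\<close> and each relation.

  A homomorphism to the integers taking positive values on the generators orders the vertices of
  each simplex, so that the group acts freely and the orbit map is a covering. Edge loops
  contract since words representing \<open>1\<close> are trivial modulo the relations. The generators are
  distinct, as seen in a nilpotent quotient, so every vertex link is the graph on the 24 edge ends
  spanned by the 36 triangle corners; this graph is bipartite and has no 4-cycle, so
  its girth is at least 6.\<close>


section \<open>Realizations of locally finite complexes\<close>

text \<open>The two halves of each square express a conjugacy: \<open>E1 G1 = D1 = G1 F1\<close>,
  \<open>E2 G2 = D2 = G2 F2\<close> and \<open>G3 E3 = D3 = F3 G3\<close>. So every F is conjugate
  to the corresponding E, and no abelian quotient tells them apart. Yet if two generators coincided,
  two edge ends at a vertex would merge and the link would no longer be the graph read off from the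
  triangle corners. This forces a nonabelian quotient. In class 2, let moving \<open>Gi\<close> to
  the right past \<open>Ej\<close> produce a central factor with exponent c_ij. Then
  \<open>F1\<close>, \<open>F2\<close>, \<open>F3\<close> differ from \<open>E1\<close>,
  \<open>E2\<close>, \<open>E3\<close> by the central exponents -c_11, -c_22 and c_11 + c_12 + c_21
  + c_22, and \<open>F1 F2 = F3\<close> demands 2 (c_11 + c_22) + c_12 + c_21 = 0. Diagonal entries
  1 and off-diagonal entries -2 solve this with all three exponents nonzero; they are the
  coefficients in \<open>nilpotent_act\<close>.\<close>

definition points_of :: "'v set set \<Rightarrow> ('v \<Rightarrow> real) set" where
  "points_of K = (\<Union>\<sigma>\<in>K. closed_simplex \<sigma>)"

definition vertex_point :: "'v \<Rightarrow> 'v \<Rightarrow> real" where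
  "vertex_point v = (\<lambda>u. if u = v then 1 else 0)"

text \<open>Membership depends on the simplex only through the support, so every point lies in the
  simplex spanned by its own support.\<close>

lemma closed_simplex_iff:
  assumes "finite \<sigma>"
  shows "x \<in> closed_simplex \<sigma> \<longleftrightarrow>
    support x \<subseteq> \<sigma> \<and> (\<forall>v. 0 \<le> x v) \<and> (\<Sum>v\<in>support x. x v) = 1"
proof -
  have "(\<Sum>v\<in>\<sigma>. x v) = (\<Sum>v\<in>support x. x v)" if "support x \<subseteq> \<sigma>"
    using that assms by (intro sum.mono_neutral_right) (auto simp: support_def)
  moreover have "(\<forall>v\<in>\<sigma>. 0 \<le> x v) \<longleftrightarrow> (\<forall>v. 0 \<le> x v)" if "support x \<subseteq> \<sigma>"
  proof -
    have "x v = 0" if "v \<notin> \<sigma>" for v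
      using that \<open>support x \<subseteq> \<sigma>\<close> by (auto simp: support_def)
    then have "0 \<le> x v" if "v \<notin> \<sigma>" for v
      using that by simp
    then show ?thesis by blast
  qed
  ultimately show ?thesis by (auto simp: closed_simplex_def)
qed

lemma closed_simplex_mono:
  assumes "finite \<tau>" "\<sigma> \<subseteq> \<tau>"
  shows "closed_simplex \<sigma> \<subseteq> closed_simplex \<tau>"
  using assms finite_subset[OF assms(2,1)] by (simp add: closed_simplex_iff subset_eq)

lemma abstract_complex_face:
  "\<lbrakk>abstract_complex K; \<sigma> \<in> K; \<tau> \<subseteq> \<sigma>; \<tau> \<noteq> {}\<rbrakk> \<Longrightarrow> \<tau> \<in> K"
  unfolding abstract_complex_def by blast

lemma abstract_complex_pair:
  "\<lbrakk>abstract_complex K; \<sigma> \<in> K; a \<in> \<sigma>; b \<in> \<sigma>\<rbrakk> \<Longrightarrow> {a, b} \<in> K"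
  by (erule abstract_complex_face) auto

lemma abstract_complex_finite: "\<lbrakk>abstract_complex K; \<sigma> \<in> K\<rbrakk> \<Longrightarrow> finite \<sigma>"
  unfolding abstract_complex_def by blast

lemma support_nonempty:
  assumes "x \<in> closed_simplex \<sigma>" "finite \<sigma>"
  shows "support x \<noteq> {}"
  using assms by (auto simp: closed_simplex_iff)

lemma points_of_iff:
  assumes "abstract_complex K"
  shows "x \<in> points_of K \<longleftrightarrow>
    support x \<in> K \<and> (\<forall>v. 0 \<le> x v) \<and> (\<Sum>v\<in>support x. x v) = 1"
proof
  assume "x \<in> points_of K"
  then obtain \<sigma> where \<sigma>: "\<sigma> \<in> K" "x \<in> closed_simplex \<sigma>" by (auto simp: points_of_def)
  then have "finite \<sigma>" using abstract_complex_finite[OF assms] by blast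
  moreover have "support x \<in> K"
    using \<sigma> \<open>finite \<sigma>\<close> support_nonempty[OF \<sigma>(2)]
    by (intro abstract_complex_face[OF assms \<sigma>(1)]) (auto simp: closed_simplex_iff)
  ultimately show "support x \<in> K \<and> (\<forall>v. 0 \<le> x v) \<and> (\<Sum>v\<in>support x. x v) = 1"
    using \<sigma> by (auto simp: closed_simplex_iff)
next
  assume R: "support x \<in> K \<and> (\<forall>v. 0 \<le> x v) \<and> (\<Sum>v\<in>support x. x v) = 1"
  then have "finite (support x)" using abstract_complex_finite[OF assms] by blast
  then have "x \<in> closed_simplex (support x)" using R by (simp add: closed_simplex_iff)
  then show "x \<in> points_of K" using R by (auto simp: points_of_def)
qed

lemma support_vertex_point [simp]: "support (vertex_point v) = {v}"
  by (auto simp: support_def vertex_point_def)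

lemma vertex_point_in_closed_simplex:
  "\<lbrakk>finite \<sigma>; v \<in> \<sigma>\<rbrakk> \<Longrightarrow> vertex_point v \<in> closed_simplex \<sigma>"
  by (auto simp: closed_simplex_iff) (auto simp: vertex_point_def)

lemma vertex_point_in_points_of:
  assumes "abstract_complex K" "v \<in> \<Union>K"
  shows "vertex_point v \<in> points_of K"
proof -
  obtain \<sigma> where "\<sigma> \<in> K" "v \<in> \<sigma>" using assms by blast
  then show ?thesis
    using vertex_point_in_closed_simplex[OF abstract_complex_finite[OF assms(1)]]
    by (auto simp: points_of_def)
qed

lemma coordinate_continuous: "continuous_on UNIV (\<lambda>x :: 'v \<Rightarrow> real. x v)"
  by (rule continuous_on_product_coordinates)

text \<open>For a locally finite complex the weak topology is the topology of pointwise convergence of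
  barycentric coordinates: near a point only finitely many closed simplices matter.\<close>

lemma realization_eq_top_of_set:
  assumes K: "abstract_complex K" and fin: "\<And>v. finite {\<sigma> \<in> K. v \<in> \<sigma>}"
  shows "realization K = top_of_set (points_of K)"
proof (rule topology_eq[THEN iffD2, rule_format])
  fix U :: "('a \<Rightarrow> real) set"
  have "openin (top_of_set (points_of K)) U"
    if U: "U \<subseteq> points_of K"
      and op: "\<And>\<sigma>. \<sigma> \<in> K \<Longrightarrow> openin (top_of_set (closed_simplex \<sigma>)) (U \<inter> closed_simplex \<sigma>)"
  proof (subst openin_subopen, rule ballI)
    fix x assume x: "x \<in> U"
    then have sx: "support x \<in> K" using U points_of_iff[OF K] by blast
    define F where "F = {\<sigma> \<in> K. support x \<subseteq> \<sigma>}"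
    have "support x \<noteq> {}" using sx K unfolding abstract_complex_def by blast
    then obtain v where "v \<in> support x" by blast
    then have "F \<subseteq> {\<sigma> \<in> K. v \<in> \<sigma>}" by (auto simp: F_def)
    then have finF: "finite F" using fin finite_subset by blast
    have "\<exists>W. open W \<and> U \<inter> closed_simplex \<sigma> = closed_simplex \<sigma> \<inter> W" if "\<sigma> \<in> K" for \<sigma>
      using op[OF that] by (auto simp: openin_open)
    then obtain W where W: "\<And>\<sigma>. \<sigma> \<in> K \<Longrightarrow> open (W \<sigma>) \<and> U \<inter> closed_simplex \<sigma> = closed_simplex \<sigma> \<inter> W \<sigma>"
      by metis
    define N where "N = {y :: 'a \<Rightarrow> real. \<forall>v\<in>support x. 0 < y v}"
    have "N = (\<Inter>v\<in>support x. {y. 0 < y v})" by (auto simp: N_def)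
    moreover have "open {y :: 'a \<Rightarrow> real. 0 < y v}" for v
      by (intro open_Collect_less continuous_intros coordinate_continuous)
    ultimately have oN: "open N"
      using abstract_complex_finite[OF K sx] by (auto intro: open_INT)
    have oW: "open (\<Inter>\<sigma>\<in>F. W \<sigma>)" using finF W by (auto simp: F_def intro: open_INT)
    have xp: "x \<in> points_of K" using x U by blast
    have "0 < x v" if "v \<in> support x" for v
      using that points_of_iff[OF K, of x] xp by (auto simp: support_def less_le)
    then have xN: "x \<in> N" by (auto simp: N_def)
    have xW: "x \<in> W \<sigma>" if "\<sigma> \<in> F" for \<sigma>
    proof -
      have "\<sigma> \<in> K" "support x \<subseteq> \<sigma>" using that by (auto simp: F_def)
      then have "x \<in> closed_simplex \<sigma>"
        using xp points_of_iff[OF K, of x] closed_simplex_iff[OF abstract_complex_finite[OF K]] by blast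
      then show ?thesis using W[OF \<open>\<sigma> \<in> K\<close>] x by blast
    qed
    have "points_of K \<inter> (N \<inter> (\<Inter>\<sigma>\<in>F. W \<sigma>)) \<subseteq> U"
    proof
      fix y assume y: "y \<in> points_of K \<inter> (N \<inter> (\<Inter>\<sigma>\<in>F. W \<sigma>))"
      then have sy: "support y \<in> K" and "support x \<subseteq> support y"
        using points_of_iff[OF K] by (auto simp: N_def support_def)
      then have "y \<in> W (support y)" using y by (auto simp: F_def)
      moreover have "y \<in> closed_simplex (support y)"
        using y points_of_iff[OF K, of y] closed_simplex_iff[OF abstract_complex_finite[OF K sy]] by blast
      ultimately show "y \<in> U" using W[OF sy] by blast
    qed
    moreover have "openin (top_of_set (points_of K)) (points_of K \<inter> (N \<inter> (\<Inter>\<sigma>\<in>F. W \<sigma>)))"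
      using oN oW by (intro openin_open_Int open_Int)
    ultimately show "\<exists>T. openin (top_of_set (points_of K)) T \<and> x \<in> T \<and> T \<subseteq> U"
      using xp xN xW by blast
  qed
  moreover have "openin (top_of_set (closed_simplex \<sigma>)) (U \<inter> closed_simplex \<sigma>)"
    if U: "openin (top_of_set (points_of K)) U" and \<sigma>: "\<sigma> \<in> K" for \<sigma>
  proof -
    have "closed_simplex \<sigma> \<subseteq> points_of K" using \<sigma> by (auto simp: points_of_def)
    moreover obtain W where "open W" "U = points_of K \<inter> W"
      using U by (auto simp: openin_open)
    ultimately show ?thesis by (auto simp: openin_open)
  qed
  moreover have "U \<subseteq> points_of K" if "openin (top_of_set (points_of K)) U"
    using that openin_imp_subset by blast
  ultimately show "openin (realization K) U = openin (top_of_set (points_of K)) U"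
    unfolding openin_realization points_of_def[symmetric] by blast
qed


section \<open>Cycles and links\<close>

locale circle_complex =
  fixes C :: "'v set set"
  assumes complex: "abstract_complex C"
    and locally_finite: "finite {\<sigma> \<in> C. v \<in> \<sigma>}"
    and circle: "realization C homeomorphic_space top_of_set (sphere (0::complex) 1)"
begin

lemma homeomorphic_circle:
  obtains f g where "homeomorphism (points_of C) (sphere (0::complex) 1) f g"
proof -
  have "top_of_set (points_of C) homeomorphic_space top_of_set (sphere (0::complex) 1)"
    using circle realization_eq_top_of_set[OF complex locally_finite] by simp
  then obtain f g where
    "homeomorphic_maps (top_of_set (points_of C)) (top_of_set (sphere (0::complex) 1)) f g"
    unfolding homeomorphic_space_def by blast
  then have "homeomorphism (points_of C) (sphere (0::complex) 1) f g"
    by (intro homeomorphismI) (auto simp: homeomorphic_maps_def)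
  then show ?thesis by (rule that)
qed

text \<open>Stereographic projection makes the punctured circle a line, which is connected; the
  homeomorphism carries this back.\<close>

lemma connected_punctured:
  assumes "m \<in> points_of C"
  shows "connected (points_of C - {m})"
proof -
  obtain f g where fg: "homeomorphism (points_of C) (sphere (0::complex) 1) f g"
    by (rule homeomorphic_circle)
  have fm: "f m \<in> sphere 0 1" using fg assms by (auto simp: homeomorphism_def)
  then have "(sphere (0::complex) 1 - {f m}) homeomorphic {x. f m \<bullet> x = 0}"
    by (intro homeomorphic_punctured_sphere_hyperplane) auto
  then have "connected (sphere (0::complex) 1 - {f m})"
    using homeomorphic_connectedness convex_connected convex_hyperplane by blast
  moreover have "g ` (sphere (0::complex) 1 - {f m}) = points_of C - {m}"
  proof -
    have "g ` sphere 0 1 = points_of C" "g (f m) = m"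
      using fg assms by (auto simp: homeomorphism_def)
    moreover have "inj_on g (sphere 0 1)"
      by (rule inj_on_inverseI[where g = f]) (use fg in \<open>auto simp: homeomorphism_def\<close>)
    ultimately show ?thesis using fm by (auto simp: inj_on_def)
  qed
  moreover have "continuous_on (sphere (0::complex) 1 - {f m}) g"
    using fg by (auto simp: homeomorphism_def intro: continuous_on_subset)
  ultimately show ?thesis using connected_continuous_image by metis
qed

lemma connected_points_of: "connected (points_of C)"
proof -
  obtain f g where fg: "homeomorphism (points_of C) (sphere (0::complex) 1) f g"
    by (rule homeomorphic_circle)
  then have "points_of C homeomorphic sphere (0::complex) 1"
    unfolding homeomorphic_def by blast
  then show ?thesis using homeomorphic_connectedness connected_sphere[of "0::complex" 1] by auto
qed

lemma points_of_not_singleton: "\<not> points_of C \<subseteq> {m}"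
proof
  assume "points_of C \<subseteq> {m}"
  moreover obtain f g where "homeomorphism (points_of C) (sphere (0::complex) 1) f g"
    by (rule homeomorphic_circle)
  ultimately have "sphere (0::complex) 1 \<subseteq> {f m}" by (auto simp: homeomorphism_def)
  moreover have "1 \<in> sphere (0::complex) 1" "-1 \<in> sphere (0::complex) 1" by auto
  ultimately have "(1::complex) = -1" by (metis singletonD subsetD)
  then show False by simp
qed

text \<open>Otherwise the points with \<open>x a > 1/2\<close> would be separated from the rest
  by the midpoint of the edge.\<close>

lemma second_edge:
  assumes ab: "{a, b} \<in> C" "a \<noteq> b"
  shows "\<exists>c. {a, c} \<in> C \<and> c \<noteq> a \<and> c \<noteq> b"
proof (rule ccontr)
  assume neg: "\<not> (\<exists>c. {a, c} \<in> C \<and> c \<noteq> a \<and> c \<noteq> b)"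
  define m where "m = (\<lambda>u. if u = a \<or> u = b then 1/2 else (0::real))"
  have "support m = {a, b}" by (auto simp: m_def support_def)
  then have m: "m \<in> points_of C"
    using ab by (auto simp: points_of_iff[OF complex] m_def)
  have only: "support x \<subseteq> {a, b}" if x: "x \<in> points_of C" "x a \<noteq> 0" for x
  proof
    fix c assume "c \<in> support x"
    moreover have "support x \<in> C" using x(1) points_of_iff[OF complex] by blast
    moreover have "a \<in> support x" using x(2) by (simp add: support_def)
    ultimately have "{a, c} \<in> C" by (blast intro: abstract_complex_pair[OF complex])
    then show "c \<in> {a, b}" using neg by blast
  qed
  have mid: "x = m" if x: "x \<in> points_of C" "x a = 1/2" for x
  proof -
    have s: "support x \<subseteq> {a, b}" using only x by simp
    then have "x \<in> closed_simplex {a, b}"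
      using x(1) closed_simplex_iff[of "{a, b}" x] points_of_iff[OF complex, of x] by blast
    then have "x b = 1/2" using ab(2) x(2) by (simp add: closed_simplex_def)
    moreover have "x u = 0" if "u \<noteq> a" "u \<noteq> b" for u
      using s that unfolding support_def by blast
    ultimately show ?thesis using x(2) unfolding m_def by auto
  qed
  have oa: "open {x :: 'v \<Rightarrow> real. x a > 1/2}" and ob: "open {x :: 'v \<Rightarrow> real. x a < 1/2}"
    by (intro open_Collect_less continuous_intros coordinate_continuous)+
  have "vertex_point a \<in> points_of C" "vertex_point b \<in> points_of C"
    by (rule vertex_point_in_points_of[OF complex]; use ab in blast)+
  then have "vertex_point a \<in> {x. x a > 1/2} \<inter> (points_of C - {m})"
    "vertex_point b \<in> {x. x a < 1/2} \<inter> (points_of C - {m})"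
    using ab(2) by (auto simp: vertex_point_def m_def fun_eq_iff)
  moreover have "points_of C - {m} \<subseteq> {x. x a > 1/2} \<union> {x. x a < 1/2}"
    using mid by force
  moreover have "{x. x a > 1/2} \<inter> {x. x a < 1/2} \<inter> (points_of C - {m}) = {}" by auto
  ultimately show False
    using connectedD[OF connected_punctured[OF m] oa ob] by blast
qed

text \<open>Otherwise the coordinate \<open>x a\<close> takes only the values 0 and 1, and
  \<open>a\<close> would be an isolated point of a connected set with more than one point.\<close>

lemma vertex_in_edge:
  assumes "a \<in> \<Union>C"
  shows "\<exists>b. {a, b} \<in> C \<and> b \<noteq> a"
proof (rule ccontr)
  assume neg: "\<not> (\<exists>b. {a, b} \<in> C \<and> b \<noteq> a)"
  have a: "vertex_point a \<in> points_of C"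
    using assms by (rule vertex_point_in_points_of[OF complex])
  have only: "x = vertex_point a" if x: "x \<in> points_of C" "x a \<noteq> 0" for x
  proof -
    have "c = a" if "c \<in> support x" for c
    proof -
      have "support x \<in> C" using x(1) points_of_iff[OF complex] by blast
      moreover have "a \<in> support x" using x(2) by (simp add: support_def)
      ultimately have "{a, c} \<in> C"
        using that by (blast intro: abstract_complex_pair[OF complex])
      then show ?thesis using neg by blast
    qed
    moreover have "a \<in> support x" using x by (simp add: support_def)
    ultimately have "support x = {a}" by blast
    moreover have "(\<Sum>v\<in>support x. x v) = 1" using x points_of_iff[OF complex] by blast
    ultimately have "x a = 1" by simp
    moreover have "x u = 0" if "u \<noteq> a" for u
      using that \<open>support x = {a}\<close> unfolding support_def by blast
    ultimately show ?thesis unfolding vertex_point_def fun_eq_iff by metis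
  qed
  have oa: "open {x :: 'v \<Rightarrow> real. x a > 1/2}" and ob: "open {x :: 'v \<Rightarrow> real. x a < 1/2}"
    by (intro open_Collect_less continuous_intros coordinate_continuous)+
  obtain y where y: "y \<in> points_of C" "y \<noteq> vertex_point a"
    using points_of_not_singleton[of "vertex_point a"] by blast
  then have "y a = 0" using only by blast
  then have "y \<in> {x. x a < 1/2} \<inter> points_of C" using y by auto
  moreover have "vertex_point a \<in> {x. x a > 1/2} \<inter> points_of C"
    using a by (auto simp: vertex_point_def)
  moreover have "points_of C \<subseteq> {x. x a > 1/2} \<union> {x. x a < 1/2}"
  proof
    fix x assume "x \<in> points_of C"
    then show "x \<in> {x. x a > 1/2} \<union> {x. x a < 1/2}"
      using only[of x] by (cases "x a = 0") (auto simp: vertex_point_def)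
  qed
  moreover have "{x. x a > 1/2} \<inter> {x. x a < 1/2} \<inter> points_of C = {}" by auto
  ultimately show False
    using connectedD[OF connected_points_of oa ob] by blast
qed

text \<open>A triangle would embed an open subset of the plane into the circle, contradicting
  invariance of domain.\<close>

lemma no_triangle:
  assumes abc: "{a, b, c} \<in> C" and d: "a \<noteq> b" "a \<noteq> c" "b \<noteq> c"
  shows False
proof -
  \<comment> \<open>The open standard triangle: real and imaginary part of \<open>z\<close> become
    the barycentric coordinates at \<open>a\<close> and \<open>b\<close>.\<close>
  define T where "T = {z :: complex. 0 < Re z \<and> 0 < Im z \<and> Re z + Im z < 1}"
  define \<psi> where "\<psi> = (\<lambda>z u. if u = a then Re z else if u = b then Im z
    else if u = c then 1 - Re z - Im z else 0)"
  have "T = {z. 0 < Re z} \<inter> {z. 0 < Im z} \<inter> {z. Re z + Im z < 1}" by (auto simp: T_def)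
  moreover have "open {z::complex. 0 < Re z}" "open {z::complex. 0 < Im z}"
    "open {z::complex. Re z + Im z < 1}"
    by (intro open_Collect_less continuous_intros)+
  ultimately have oT: "open T" by auto
  obtain f g where fg: "homeomorphism (points_of C) (sphere (0::complex) 1) f g"
    by (rule homeomorphic_circle)
  have \<psi>: "\<psi> z \<in> points_of C" if "z \<in> T" for z
  proof -
    have "\<psi> z \<in> closed_simplex {a, b, c}"
      using that d by (auto simp: closed_simplex_def T_def \<psi>_def support_def split: if_splits)
    then show ?thesis using abc by (auto simp: points_of_def)
  qed
  have "continuous_on T \<psi>"
  proof (rule continuous_on_coordinatewise_then_product)
    fix u show "continuous_on T (\<lambda>z. \<psi> z u)"
      unfolding \<psi>_def
      by (cases "u = a"; cases "u = b"; cases "u = c"; simp; intro continuous_intros)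
  qed
  then have "continuous_on T (f \<circ> \<psi>)"
    using fg \<psi> continuous_on_subset[of "points_of C" f "\<psi> ` T"]
    by (intro continuous_on_compose) (auto simp: homeomorphism_def)
  moreover have "inj_on (f \<circ> \<psi>) T"
  proof (rule comp_inj_on)
    show "inj_on \<psi> T"
    proof (rule inj_onI)
      fix z w assume "\<psi> z = \<psi> w"
      from fun_cong[OF this, of a] fun_cong[OF this, of b] show "z = w"
        using d by (auto simp: \<psi>_def complex_eq_iff)
    qed
    have "inj_on f (points_of C)" using fg by (metis homeomorphism_def inj_on_inverseI)
    then show "inj_on f (\<psi> ` T)" using \<psi> by (auto simp: inj_on_def)
  qed
  ultimately have "open ((f \<circ> \<psi>) ` T)" using oT by (intro invariance_of_domain)
  moreover have "(f \<circ> \<psi>) ` T \<subseteq> sphere 0 1" using fg \<psi> by (auto simp: homeomorphism_def)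
  ultimately have "(f \<circ> \<psi>) ` T \<subseteq> interior (sphere 0 1)" by (rule interior_maximal[rotated])
  moreover have "interior (sphere (0::complex) 1) = {}"
    by (metis interior_open open_interior open_not_negligible negligible_subset interior_subset negligible_sphere)
  ultimately have "T = {}" by auto
  moreover have "Complex (1/3) (1/3) \<in> T" by (simp add: T_def)
  ultimately show False by blast
qed

end

section \<open>From the girth of vertex links to 6-largeness of residues\<close>

definition link_adjacent :: "'v set set \<Rightarrow> 'v \<Rightarrow> 'v \<Rightarrow> 'v \<Rightarrow> bool" where
  "link_adjacent K v a b \<longleftrightarrow> {v, a, b} \<in> K \<and> a \<noteq> v \<and> b \<noteq> v \<and> a \<noteq> b"

text \<open>The right-hand side is closed under faces and contains all simplices above
  \<open>\<sigma>\<close>; conversely each such \<open>\<tau>\<close> is a face of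
  \<open>\<tau> \<union> \<sigma>\<close>.\<close>

lemma residue_of_eq:
  assumes K: "abstract_complex K" and "\<sigma> \<in> K"
  shows "residue_of \<sigma> K = {\<tau> \<in> K. \<tau> \<union> \<sigma> \<in> K}"
proof (rule antisym)
  have "\<rho> \<in> K \<and> \<rho> \<union> \<sigma> \<in> K" if "\<tau> \<in> K" "\<tau> \<union> \<sigma> \<in> K" "\<rho> \<subseteq> \<tau>" "\<rho> \<noteq> {}" for \<rho> \<tau>
    using abstract_complex_face[OF K that(1), of \<rho>]
      abstract_complex_face[OF K that(2), of "\<rho> \<union> \<sigma>"] that by blast
  then have "abstract_complex {\<tau> \<in> K. \<tau> \<union> \<sigma> \<in> K}"
    using K unfolding abstract_complex_def by blast
  then have "subcomplex {\<tau> \<in> K. \<tau> \<union> \<sigma> \<in> K} K" by (auto simp: subcomplex_def)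
  moreover have "\<forall>\<tau>\<in>K. \<sigma> \<subseteq> \<tau> \<longrightarrow> \<tau> \<in> {\<tau> \<in> K. \<tau> \<union> \<sigma> \<in> K}"
    by (auto simp: Un_absorb2)
  ultimately show "residue_of \<sigma> K \<subseteq> {\<tau> \<in> K. \<tau> \<union> \<sigma> \<in> K}"
    unfolding residue_of_def by blast
next
  show "{\<tau> \<in> K. \<tau> \<union> \<sigma> \<in> K} \<subseteq> residue_of \<sigma> K"
    unfolding residue_of_def
  proof (intro subsetI InterI)
    fix \<tau> Y
    assume \<tau>: "\<tau> \<in> {\<tau> \<in> K. \<tau> \<union> \<sigma> \<in> K}"
      and Y: "Y \<in> {Y. subcomplex Y K \<and> (\<forall>\<tau>\<in>K. \<sigma> \<subseteq> \<tau> \<longrightarrow> \<tau> \<in> Y)}"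
    then have "\<tau> \<union> \<sigma> \<in> Y" "abstract_complex Y" by (auto simp: subcomplex_def)
    moreover have "\<tau> \<noteq> {}" using \<tau> K unfolding abstract_complex_def by blast
    ultimately show "\<tau> \<in> Y" using abstract_complex_face by blast
  qed
qed

text \<open>The colouring may vary with \<open>v\<close>. It excludes closed walks of odd length in
  a link, while \<open>no_square\<close> excludes those of length 4 without backtracking.\<close>

locale bipartite_links =
  fixes K :: "'v set set" and colour :: "'v \<Rightarrow> 'v \<Rightarrow> bool"
  assumes complex: "abstract_complex K"
    and locally_finite: "finite {\<sigma> \<in> K. v \<in> \<sigma>}"
    and colour: "link_adjacent K v a b \<Longrightarrow> colour v a \<noteq> colour v b"
    and no_square: "\<lbrakk>link_adjacent K v a b; link_adjacent K v b c; link_adjacent K v c d;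
      link_adjacent K v d a\<rbrakk> \<Longrightarrow> a = c \<or> b = d"
begin

lemma circle_subcomplex:
  assumes "cycle_in C X" "X \<subseteq> K"
  shows "circle_complex C"
proof (rule circle_complex.intro)
  have C: "abstract_complex C" "C \<subseteq> K"
    "realization C homeomorphic_space top_of_set (sphere (0::complex) 1)"
    using assms unfolding cycle_in_def subcomplex_def by blast+
  show "abstract_complex C" by fact
  show "realization C homeomorphic_space top_of_set (sphere (0::complex) 1)" by fact
  show "finite {\<sigma> \<in> C. v \<in> \<sigma>}" for v
    by (rule finite_subset[OF _ locally_finite[of v]]) (use C(2) in blast)
qed

text \<open>A walk without backtracking has six distinct edges before it can close up.\<close>

lemma cycle_in_link_long:
  assumes C: "cycle_in C X" and X: "X \<subseteq> link_of {v} K"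
  shows "6 \<le> cycle_length C"
proof -
  have CL: "C \<subseteq> link_of {v} K" using C X by (auto simp: cycle_in_def subcomplex_def)
  interpret circle_complex C
    by (rule circle_subcomplex[OF C]) (use X in \<open>auto simp: link_of_def\<close>)
  have adj: "link_adjacent K v a b" if "{a, b} \<in> C" "a \<noteq> b" for a b
    using that CL by (fastforce simp: link_of_def link_adjacent_def insert_commute)
  have next_vertex: "\<exists>c. {b, c} \<in> C \<and> c \<noteq> b \<and> c \<noteq> a" if "{a, b} \<in> C" "a \<noteq> b" for a b
    using second_edge[of b a] that by (auto simp: insert_commute)
  have "points_of C \<noteq> {}" using points_of_not_singleton by blast
  then have "\<exists>\<sigma>. \<sigma> \<in> C" by (auto simp: points_of_def)
  then have "\<exists>x. x \<in> \<Union>C" using circle_complex.complex[OF circle_complex_axioms]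
    unfolding abstract_complex_def by blast
  then obtain x0 x1 where e0: "{x0, x1} \<in> C" "x0 \<noteq> x1" using vertex_in_edge by metis
  obtain x2 where e1: "{x1, x2} \<in> C" "x2 \<noteq> x1" "x2 \<noteq> x0" using next_vertex[OF e0] by blast
  obtain x3 where e2: "{x2, x3} \<in> C" "x3 \<noteq> x2" "x3 \<noteq> x1"
    using next_vertex[OF e1(1) e1(2)[symmetric]] by blast
  obtain x4 where e3: "{x3, x4} \<in> C" "x4 \<noteq> x3" "x4 \<noteq> x2"
    using next_vertex[OF e2(1) e2(2)[symmetric]] by blast
  obtain x5 where e4: "{x4, x5} \<in> C" "x5 \<noteq> x4" "x5 \<noteq> x3"
    using next_vertex[OF e3(1) e3(2)[symmetric]] by blast
  obtain x6 where e5: "{x5, x6} \<in> C" "x6 \<noteq> x5" "x6 \<noteq> x4"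
    using next_vertex[OF e4(1) e4(2)[symmetric]] by blast
  note a = adj[OF e0] adj[OF e1(1) e1(2)[symmetric]] adj[OF e2(1) e2(2)[symmetric]]
    adj[OF e3(1) e3(2)[symmetric]] adj[OF e4(1) e4(2)[symmetric]] adj[OF e5(1) e5(2)[symmetric]]
  \<comment> \<open>Colours alternate along the walk, so vertices at an odd distance along it
    differ.\<close>
  have "colour v x1 \<noteq> colour v x0" "colour v x2 = colour v x0" "colour v x3 \<noteq> colour v x0"
    "colour v x4 = colour v x0" "colour v x5 \<noteq> colour v x0" "colour v x6 = colour v x0"
    using a[THEN colour] by auto
  then have d1: "x0 \<noteq> x3" "x0 \<noteq> x5" "x1 \<noteq> x4" "x1 \<noteq> x6" "x2 \<noteq> x5" "x3 \<noteq> x6" by auto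
  \<comment> \<open>A return after four steps would be a square; \<open>no_square\<close> then
    yields a backtracking, which the choice of the walk rules out. The vertices \<open>x6\<close>
    and \<open>x0\<close> may coincide.\<close>
  have d2: "x0 \<noteq> x4" using no_square[OF a(1-3)] a(4) e1 e2 by auto
  have d3: "x1 \<noteq> x5" using no_square[OF a(2-4)] a(5) e2 e3 by auto
  have d4: "x2 \<noteq> x6" using no_square[OF a(3-5)] a(6) e3 e4 by auto
  have "card {{x0, x1}, {x1, x2}, {x2, x3}, {x3, x4}, {x4, x5}, {x5, x6}} = 6"
    using d1 d2 d3 d4 e0(2) e1(2,3) e2(2,3) e3(2,3) e4(2,3) e5(2,3)
    by (simp add: doubleton_eq_iff eq_commute)
  moreover have "{{x0, x1}, {x1, x2}, {x2, x3}, {x3, x4}, {x4, x5}, {x5, x6}} \<subseteq> {e \<in> C. card e = 2}"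
    using e0 e1 e2 e3 e4 e5 by auto
  \<comment> \<open>Needed because \<open>card\<close> of an infinite set is 0: removing
    \<open>v\<close> maps the finitely many simplices at \<open>v\<close> onto a set containing all
    these edges.\<close>
  moreover have "finite {e \<in> C. card e = 2}"
  proof (rule finite_subset)
    show "{e \<in> C. card e = 2} \<subseteq> (\<lambda>\<sigma>. \<sigma> - {v}) ` {\<sigma> \<in> K. v \<in> \<sigma>}"
    proof
      fix e assume "e \<in> {e \<in> C. card e = 2}"
      then have "e \<union> {v} \<in> {\<sigma> \<in> K. v \<in> \<sigma>}" "e = (e \<union> {v}) - {v}"
        using CL by (auto simp: link_of_def)
      then show "e \<in> (\<lambda>\<sigma>. \<sigma> - {v}) ` {\<sigma> \<in> K. v \<in> \<sigma>}" by blast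
    qed
  qed (intro finite_imageI bipartite_links.locally_finite[OF bipartite_links_axioms])
  ultimately have "6 \<le> card {e \<in> C. card e = 2}"
    using card_mono[of "{e \<in> C. card e = 2}"
        "{{x0, x1}, {x1, x2}, {x2, x3}, {x3, x4}, {x4, x5}, {x5, x6}}"] by presburger
  then show ?thesis by (simp add: cycle_length_def)
qed

text \<open>The link of a simplex lies in the link of any of its vertices, and there all cycles are
  long, full or not.\<close>

lemma systole_link:
  assumes "R \<subseteq> K" "\<rho> \<in> R"
  shows "enat 6 \<le> systole (link_of \<rho> R)"
proof -
  have "\<rho> \<noteq> {}" using assms complex unfolding abstract_complex_def by blast
  then obtain v where v: "v \<in> \<rho>" by blast
  have "link_of \<rho> R \<subseteq> link_of {v} K"
  proof
    fix \<tau> assume \<tau>: "\<tau> \<in> link_of \<rho> R"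
    then have "\<tau> \<union> \<rho> \<in> K" "\<tau> \<in> K" using assms by (auto simp: link_of_def)
    then have "\<tau> \<union> {v} \<in> K" using abstract_complex_face[OF complex, of "\<tau> \<union> \<rho>" "\<tau> \<union> {v}"] v by blast
    then show "\<tau> \<in> link_of {v} K" using \<tau> v \<open>\<tau> \<in> K\<close> by (auto simp: link_of_def)
  qed
  then show ?thesis
    using cycle_in_link_long by (auto simp: systole_def le_Inf_iff)
qed

text \<open>Fix a vertex \<open>v\<close> of \<open>\<sigma>\<close>. A cycle avoiding
  \<open>v\<close> lies in the link of \<open>v\<close>. If a full cycle passes through
  \<open>v\<close>, then \<open>v\<close> and the next two vertices span a simplex of the residue,
  so fullness puts a triangle into the cycle.\<close>

lemma systole_residue:
  assumes \<sigma>: "\<sigma> \<in> K"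
  shows "enat 6 \<le> systole (residue_of \<sigma> K)"
proof -
  let ?R = "residue_of \<sigma> K"
  have R: "?R = {\<tau> \<in> K. \<tau> \<union> \<sigma> \<in> K}" by (rule residue_of_eq[OF complex \<sigma>])
  have "\<sigma> \<noteq> {}" using \<sigma> complex unfolding abstract_complex_def by blast
  then obtain v where v: "v \<in> \<sigma>" by blast
  have "6 \<le> cycle_length C" if C: "cycle_in C ?R" and full: "full_subcomplex C ?R" for C
  proof (cases "v \<in> \<Union>C")
    case False
    have sub: "C \<subseteq> ?R" using C by (auto simp: cycle_in_def subcomplex_def)
    have "C \<subseteq> link_of {v} K"
    proof
      fix \<tau> assume \<tau>: "\<tau> \<in> C"
      then have *: "\<tau> \<in> K" "\<tau> \<union> \<sigma> \<in> K" using sub R by auto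
      then have "\<tau> \<union> {v} \<in> K"
        using abstract_complex_face[OF complex, of "\<tau> \<union> \<sigma>" "\<tau> \<union> {v}"] v by blast
      then show "\<tau> \<in> link_of {v} K" using \<tau> False * by (auto simp: link_of_def)
    qed
    moreover have "cycle_in C C" using C by (auto simp: cycle_in_def subcomplex_def)
    ultimately show ?thesis by (intro cycle_in_link_long)
  next
    case True
    interpret C: circle_complex C
      by (rule circle_subcomplex[OF C]) (use R in auto)
    obtain a where a: "{v, a} \<in> C" "a \<noteq> v" using C.vertex_in_edge[OF True] by blast
    then obtain d where d: "{a, d} \<in> C" "d \<noteq> a" "d \<noteq> v"
      using C.second_edge[of a v] by (auto simp: insert_commute)
    then have "{a, d} \<in> ?R" using C by (auto simp: cycle_in_def subcomplex_def)
    then have "{a, d} \<union> \<sigma> \<in> K" using R by blast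
    then have "{a, d} \<union> \<sigma> \<in> ?R" using R by (simp add: Un_assoc)
    moreover have "{v, a, d} \<subseteq> {a, d} \<union> \<sigma>" "{v, a, d} \<subseteq> \<Union>C" using v a d by auto
    ultimately obtain \<tau> where "\<tau> \<in> C" "{v, a, d} \<subseteq> \<tau>"
      using full unfolding full_subcomplex_def by (meson insert_not_empty)
    then have "{v, a, d} \<in> C" using abstract_complex_face[OF C.complex] by blast
    then show ?thesis using C.no_triangle[of v a d] a d by blast
  qed
  then show ?thesis by (auto simp: systole_def le_Inf_iff)
qed

lemma locally_large_6: "locally_large 6 K"
  unfolding locally_large_def large_def
  using systole_residue systole_link residue_of_eq[OF complex] by (metis (no_types, lifting) mem_Collect_eq subsetI)

end


section \<open>Edge loops\<close>

definition hat :: "real \<Rightarrow> real" where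
  "hat x = max 0 (1 - \<bar>x\<bar>)"

text \<open>Piecewise linear interpolation through the vertices at integer times. As a sum of hat
  functions it is continuous without any gluing of pieces.\<close>

definition polygonal :: "'v list \<Rightarrow> real \<Rightarrow> 'v \<Rightarrow> real" where
  "polygonal vs x u = (\<Sum>k<length vs. hat (x - real k) * (if vs ! k = u then 1 else 0))"

definition edge_loop :: "'v list \<Rightarrow> real \<Rightarrow> 'v \<Rightarrow> real" where
  "edge_loop vs t = polygonal vs (real (length vs - 1) * t)"

text \<open>Since \<open>{a, a} = {a}\<close>, consecutive vertices may be equal. These pauses are
  what keep lengths equal in \<open>edge_loop_contiguous\<close>.\<close>

definition edge_path :: "'v set set \<Rightarrow> 'v list \<Rightarrow> bool" where
  "edge_path K vs \<longleftrightarrow> vs \<noteq> [] \<and> set vs \<subseteq> \<Union>K \<and> successively (\<lambda>a b. {a, b} \<in> K) vs"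

lemma continuous_on_polygonal: "continuous_on S (polygonal vs)"
  unfolding polygonal_def hat_def
  by (intro continuous_on_coordinatewise_then_product continuous_intros)

lemma polygonal_between:
  assumes "Suc k < length vs" "real k \<le> x" "x \<le> real k + 1"
  shows "polygonal vs x =
    (\<lambda>u. (real k + 1 - x) * (if vs ! k = u then 1 else 0) + (x - real k) * (if vs ! Suc k = u then 1 else 0))"
proof
  fix u
  have "polygonal vs x u = (\<Sum>j\<in>{k, Suc k}. hat (x - real j) * (if vs ! j = u then 1 else 0))"
    unfolding polygonal_def
  proof (rule sum.mono_neutral_right)
    show "\<forall>j\<in>{..<length vs} - {k, Suc k}. hat (x - real j) * (if vs ! j = u then 1 else 0) = 0"
    proof
      fix j assume "j \<in> {..<length vs} - {k, Suc k}"
      then have "j < k \<or> j > Suc k" by auto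
      then have "real j + 1 \<le> real k \<or> real j \<ge> real k + 2" by linarith
      then have "hat (x - real j) = 0" using assms by (auto simp: hat_def)
      then show "hat (x - real j) * (if vs ! j = u then 1 else 0) = 0" by simp
    qed
  qed (use assms in auto)
  also have "\<dots> = (real k + 1 - x) * (if vs ! k = u then 1 else 0) + (x - real k) * (if vs ! Suc k = u then 1 else 0)"
    using assms by (simp add: hat_def)
  finally show "polygonal vs x u = \<dots>" .
qed

lemma polygonal_at:
  assumes "k < length vs"
  shows "polygonal vs (real k) = vertex_point (vs ! k)"
proof
  fix u
  have "hat (real k - real j) * (if vs ! j = u then 1 else 0) = (if j = k then if vs ! k = u then 1 else 0 else 0)"
    for j
  proof (cases "j = k")
    case False
    then have "\<bar>real k - real j\<bar> \<ge> 1" by linarith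
    then show ?thesis using False by (simp add: hat_def)
  qed (simp add: hat_def)
  then show "polygonal vs (real k) u = vertex_point (vs ! k) u"
    using assms by (simp add: polygonal_def vertex_point_def)
qed

lemma polygonal_in_closed_simplex:
  assumes "Suc k < length vs" "real k \<le> x" "x \<le> real k + 1" "finite \<sigma>" "vs ! k \<in> \<sigma>" "vs ! Suc k \<in> \<sigma>"
  shows "polygonal vs x \<in> closed_simplex \<sigma>"
  unfolding polygonal_between[OF assms(1-3)] closed_simplex_def
  using assms by (auto simp: support_def sum.distrib sum_distrib_left[symmetric])

lemma closed_simplex_convex:
  assumes "x \<in> closed_simplex \<sigma>" "y \<in> closed_simplex \<sigma>" "0 \<le> s" "s \<le> 1"
  shows "(\<lambda>u. (1 - s) * x u + s * y u) \<in> closed_simplex \<sigma>"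
proof -
  have "support (\<lambda>u. (1 - s) * x u + s * y u) \<subseteq> support x \<union> support y"
    by (auto simp: support_def)
  then show ?thesis
    using assms by (auto simp: closed_simplex_def sum.distrib sum_distrib_left[symmetric])
qed

lemma unit_segment_index:
  assumes "0 \<le> x" "x \<le> real n" "0 < n"
  obtains k where "k < n" "real k \<le> x" "x \<le> real k + 1"
proof (cases "x = real n")
  case True
  then show ?thesis using assms by (intro that[of "n - 1"]) (auto simp: of_nat_diff)
next
  case False
  then have "nat \<lfloor>x\<rfloor> < n" "real (nat \<lfloor>x\<rfloor>) \<le> x" "x \<le> real (nat \<lfloor>x\<rfloor>) + 1"
    using assms by linarith+
  then show ?thesis by (rule that)
qed

text \<open>The straight-line homotopy stays in the common simplex, which is convex.\<close>

lemma contiguous_loops_homotopic: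
  assumes "path p" "path q" "p 1 = p 0" "q 1 = q 0"
    and contig: "\<And>t. \<lbrakk>0 \<le> t; t \<le> 1\<rbrakk> \<Longrightarrow> \<exists>\<sigma>\<in>K. p t \<in> closed_simplex \<sigma> \<and> q t \<in> closed_simplex \<sigma>"
  shows "homotopic_loops (points_of K) p q"
  unfolding homotopic_loops
proof (intro exI conjI)
  define h where "h = (\<lambda>(s, t) u. (1 - s) * p t u + s * q t u)"
  have pq: "continuous_on {0..1} p" "continuous_on {0..1} q" using assms by (auto simp: path_def)
  show "continuous_on ({0..1} \<times> {0..1}) h"
  proof -
    have "continuous_on ({0..1} \<times> {0..1::real}) (\<lambda>st. p (snd st))"
      "continuous_on ({0..1} \<times> {0..1::real}) (\<lambda>st. q (snd st))"
      by (rule continuous_on_compose2[OF pq(1)] continuous_on_compose2[OF pq(2)],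
          intro continuous_on_snd continuous_on_id, force)+
    from this[THEN continuous_on_product_then_coordinatewise] show ?thesis
      unfolding h_def split_def
      by (intro continuous_on_coordinatewise_then_product continuous_on_add continuous_on_mult
          continuous_on_diff continuous_on_const continuous_on_fst continuous_on_id)
  qed
  show "h \<in> {0..1} \<times> {0..1} \<rightarrow> points_of K"
  proof
    fix st :: "real \<times> real" assume "st \<in> {0..1} \<times> {0..1}"
    then obtain s t where st: "st = (s, t)" "0 \<le> s" "s \<le> 1" "0 \<le> t" "t \<le> 1" by auto
    then obtain \<sigma> where "\<sigma> \<in> K" "p t \<in> closed_simplex \<sigma>" "q t \<in> closed_simplex \<sigma>"
      using contig by blast
    then show "h st \<in> points_of K"
      using closed_simplex_convex[of "p t" \<sigma> "q t" s] st by (auto simp: h_def points_of_def)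
  qed
  show "\<forall>x\<in>{0..1}. h (0, x) = p x" "\<forall>x\<in>{0..1}. h (1, x) = q x"
    by (auto simp: h_def)
  show "\<forall>t\<in>{0..1}. pathfinish (h \<circ> Pair t) = pathstart (h \<circ> Pair t)"
    using assms by (auto simp: h_def pathfinish_def pathstart_def)
qed

text \<open>Interpolate linearly between the parameter changes inside the interval, then apply
  \<open>P\<close>.\<close>

lemma reparametrized_loops_homotopic:
  assumes P: "continuous_on {0..c} P" "P ` {0..c} \<subseteq> S" "P 0 = P c"
    and f: "continuous_on {0..1} f" "f ` {0..1} \<subseteq> {0..c}" "f 0 = 0" "f 1 = c"
    and g: "continuous_on {0..1} g" "g ` {0..1} \<subseteq> {0..c}" "g 0 = 0" "g 1 = (c::real)"
  shows "homotopic_loops S (\<lambda>t. P (f t)) (\<lambda>t. P (g t))"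
  unfolding homotopic_loops
proof (intro exI conjI)
  define h where "h = (\<lambda>(s, t). P ((1 - s) * f t + s * g t))"
  have mem: "(1 - s) * f t + s * g t \<in> {0..c}" if "0 \<le> s" "s \<le> 1" "0 \<le> t" "t \<le> 1" for s t
  proof -
    have "f t \<in> {0..c}" "g t \<in> {0..c}"
      using f(2) g(2) that by (simp_all add: image_subset_iff)
    then show ?thesis
      using convexD_alt[of "{0..c}" "f t" "g t" s] that by (simp add: algebra_simps)
  qed
  show "continuous_on ({0..1} \<times> {0..1}) h"
  proof -
    have "continuous_on ({0..1} \<times> {0..1::real}) (\<lambda>st. f (snd st))"
      "continuous_on ({0..1} \<times> {0..1::real}) (\<lambda>st. g (snd st))"
      by (rule continuous_on_compose2[OF f(1)] continuous_on_compose2[OF g(1)],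
          intro continuous_on_snd continuous_on_id, force)+
    then have "continuous_on ({0..1} \<times> {0..1}) (\<lambda>st. (1 - fst st) * f (snd st) + fst st * g (snd st))"
      by (intro continuous_on_add continuous_on_mult
          continuous_on_diff continuous_on_const continuous_on_fst continuous_on_id)
    moreover have "(\<lambda>st. (1 - fst st) * f (snd st) + fst st * g (snd st)) ` ({0..1} \<times> {0..1}) \<subseteq> {0..c}"
      using mem by auto
    ultimately show ?thesis
      unfolding h_def split_def by (rule continuous_on_compose2[OF P(1)])
  qed
  show "h \<in> {0..1} \<times> {0..1} \<rightarrow> S"
  proof
    fix st :: "real \<times> real" assume "st \<in> {0..1} \<times> {0..1}"
    then obtain s t where st: "st = (s, t)" "0 \<le> s" "s \<le> 1" "0 \<le> t" "t \<le> 1" by auto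
    then show "h st \<in> S" using subsetD[OF P(2) imageI[OF mem[OF st(2-5)]]] by (simp add: h_def)
  qed
  show "\<forall>x\<in>{0..1}. h (0, x) = P (f x)" "\<forall>x\<in>{0..1}. h (1, x) = P (g x)"
    by (auto simp: h_def)
  show "\<forall>t\<in>{0..1}. pathfinish (h \<circ> Pair t) = pathstart (h \<circ> Pair t)"
    using f g P(3) by (auto simp: h_def pathfinish_def pathstart_def algebra_simps)
qed

section \<open>Elementary homotopies of edge loops and simplicial approximation\<close>

locale locally_finite_complex =
  fixes K :: "'v set set"
  assumes complex: "abstract_complex K"
    and locally_finite: "finite {\<sigma> \<in> K. v \<in> \<sigma>}"
begin

lemma closed_simplex_support: "x \<in> points_of K \<Longrightarrow> x \<in> closed_simplex (support x)"
  using points_of_iff[OF complex, of x]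
    closed_simplex_iff[OF abstract_complex_finite[OF complex], of "support x" x] by blast

lemma edge_path_consecutive: "\<lbrakk>edge_path K vs; Suc k < length vs\<rbrakk> \<Longrightarrow> {vs ! k, vs ! Suc k} \<in> K"
  by (simp add: edge_path_def successively_conv_nth)

lemma polygonal_in_points_of:
  assumes vs: "edge_path K vs" and x: "0 \<le> x" "x \<le> real (length vs - 1)"
  shows "polygonal vs x \<in> points_of K"
proof (cases "length vs = 1")
  case True
  then have "x = 0" "vs ! 0 \<in> \<Union>K" using x vs by (cases vs; force simp: edge_path_def)+
  then show ?thesis
    using polygonal_at[of 0 vs] vertex_point_in_points_of[OF complex] True by simp
next
  case False
  then have "0 < length vs - 1" using vs by (cases vs) (auto simp: edge_path_def)
  then obtain k where k: "k < length vs - 1" "real k \<le> x" "x \<le> real k + 1"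
    using unit_segment_index[OF x] by blast
  then have e: "{vs ! k, vs ! Suc k} \<in> K" using vs by (intro edge_path_consecutive) auto
  then have "polygonal vs x \<in> closed_simplex {vs ! k, vs ! Suc k}"
    using k by (intro polygonal_in_closed_simplex) auto
  then show ?thesis using e by (auto simp: points_of_def)
qed

lemma path_edge_loop: "path (edge_loop vs)"
  unfolding path_def edge_loop_def
  by (intro continuous_on_compose2[OF continuous_on_polygonal[of UNIV]] continuous_intros) auto

lemma edge_loop_ends:
  assumes "vs \<noteq> []"
  shows "edge_loop vs 0 = vertex_point (hd vs)" "edge_loop vs 1 = vertex_point (last vs)"
  using assms polygonal_at[of 0 vs] polygonal_at[of "length vs - 1" vs]
  by (auto simp: edge_loop_def hd_conv_nth last_conv_nth)

lemma edge_loop_closed: "\<lbrakk>edge_path K vs; hd vs = last vs\<rbrakk> \<Longrightarrow> edge_loop vs 1 = edge_loop vs 0"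
  using edge_loop_ends[of vs] by (simp add: edge_path_def)

lemma edge_loop_single: "edge_loop [v] = (\<lambda>t. vertex_point v)"
  using polygonal_at[of 0 "[v]"] by (simp add: edge_loop_def fun_eq_iff)

lemma edge_path_append:
  "edge_path K (as @ p # bs) \<longleftrightarrow>
    edge_path K (as @ [p]) \<and> edge_path K (p # bs)"
  by (auto simp: edge_path_def successively_append_iff)

lemma edge_loop_stutter:
  assumes vs: "edge_path K (as @ v # bs)" and closed: "hd (as @ v # bs) = last (as @ v # bs)"
  shows "homotopic_loops (points_of K) (edge_loop (as @ v # v # bs)) (edge_loop (as @ v # bs))"
proof -
  let ?vs = "as @ v # bs" and ?ws = "as @ v # v # bs"
  define m where "m = length as + length bs"
  \<comment> \<open>The time change that waits at the repeated vertex for one unit, from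
    \<open>length as\<close> to \<open>length as + 1\<close>, and runs with delay 1
    afterwards.\<close>
  define \<phi> where "\<phi> = (\<lambda>x. min x (max (real (length as)) (x - 1)))"
  have eq: "polygonal ?ws x = polygonal ?vs (\<phi> x)" if x: "0 \<le> x" "x \<le> real (Suc m)" for x
  proof -
    obtain k where k: "k < Suc m" "real k \<le> x" "x \<le> real k + 1"
      using unit_segment_index[OF x] by blast
    consider "k < length as" | "k = length as" | "k > length as" by linarith
    then show ?thesis
    proof cases
      case 1
      then have "\<phi> x = x" using k by (auto simp: \<phi>_def)
      moreover have "?ws ! k = ?vs ! k" "?ws ! Suc k = ?vs ! Suc k"
        using 1 by (auto simp: nth_append nth_Cons split: nat.splits)
      ultimately show ?thesis
        using k 1 by (subst (1 2) polygonal_between[where k = k]) auto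
    next
      case 2
      then have "\<phi> x = real (length as)" using k by (auto simp: \<phi>_def)
      moreover have "?ws ! k = v" "?ws ! Suc k = v" "?vs ! k = v" using 2 by (auto simp: nth_append)
      ultimately show ?thesis
        using k 2 polygonal_at[of "length as" ?vs]
        by (subst polygonal_between[where k = k]) (auto simp: vertex_point_def fun_eq_iff)
    next
      case 3
      then have "\<phi> x = x - 1" using k by (auto simp: \<phi>_def)
      moreover obtain i where i: "k = Suc (length as + i)"
        using 3 less_imp_Suc_add by blast
      define j where "j = length as + i"
      have j: "k = Suc j" using i by (simp add: j_def)
      moreover have "?ws ! k = ?vs ! j" "?ws ! Suc k = ?vs ! Suc j"
        using nth_append_length_plus[of as "v # v # bs" "Suc i"]
          nth_append_length_plus[of as "v # v # bs" "Suc (Suc i)"]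
          nth_append_length_plus[of as "v # bs" "i"]
          nth_append_length_plus[of as "v # bs" "Suc i"]
        by (simp_all add: j j_def)
      moreover have "polygonal ?vs (x - 1) =
        (\<lambda>u. (real j + 1 - (x - 1)) * (if ?vs ! j = u then 1 else 0)
           + (x - 1 - real j) * (if ?vs ! Suc j = u then 1 else 0))"
        using k j by (intro polygonal_between) (auto simp: m_def)
      moreover have "polygonal ?ws x =
        (\<lambda>u. (real k + 1 - x) * (if ?ws ! k = u then 1 else 0)
           + (x - real k) * (if ?ws ! Suc k = u then 1 else 0))"
        using k by (intro polygonal_between) (auto simp: m_def)
      moreover have "real k + 1 - x = real j + 1 - (x - 1)" "x - real k = x - 1 - real j"
        using j by simp_all
      ultimately show ?thesis by presburger
    qed
  qed
  have "homotopic_loops (points_of K) (\<lambda>t. polygonal ?vs (\<phi> (real (Suc m) * t)))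
      (\<lambda>t. polygonal ?vs (real m * t))"
  proof (rule reparametrized_loops_homotopic)
    show "continuous_on {0..real m} (polygonal ?vs)" by (rule continuous_on_polygonal)
    show "polygonal ?vs ` {0..real m} \<subseteq> points_of K"
      using polygonal_in_points_of[OF vs] by (auto simp: m_def)
    have "edge_loop ?vs 0 = edge_loop ?vs 1"
      using edge_loop_ends[of ?vs] closed by simp
    then show "polygonal ?vs 0 = polygonal ?vs (real m)" by (simp add: edge_loop_def m_def)
    show "continuous_on {0..1} (\<lambda>t. \<phi> (real (Suc m) * t))"
      unfolding \<phi>_def by (intro continuous_intros)
    show "(\<lambda>t. \<phi> (real (Suc m) * t)) ` {0..1} \<subseteq> {0..real m}"
    proof clarify
      fix t :: real assume t: "t \<in> {0..1}"
      then have "real (Suc m) * t \<le> real (Suc m)" "0 \<le> real (Suc m) * t"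
        using mult_left_le[of t "real (Suc m)"] by auto
      moreover have "\<phi> y \<in> {0..real m}" if "0 \<le> y" "y \<le> real (Suc m)" for y
        using that by (auto simp: \<phi>_def m_def)
      ultimately show "\<phi> (real (Suc m) * t) \<in> {0..real m}" by blast
    qed
    show "(\<lambda>t. real m * t) ` {0..1} \<subseteq> {0..real m}" by (auto simp: mult_left_le)
  qed (auto simp: \<phi>_def m_def intro!: continuous_intros)
  moreover have "polygonal ?vs (\<phi> (real (Suc m) * t)) = edge_loop ?ws t" if "t \<in> {0..1}" for t
  proof -
    have "real (Suc m) * t \<le> real (Suc m)" "0 \<le> real (Suc m) * t"
      using mult_left_le[of t "real (Suc m)"] that by auto
    then show ?thesis using eq[of "real (Suc m) * t"] by (simp add: edge_loop_def m_def)
  qed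
  moreover have "polygonal ?vs (real m * t) = edge_loop ?vs t" for t
    by (simp add: edge_loop_def m_def)
  moreover have "path (edge_loop ?ws)" by (rule path_edge_loop)
  moreover have "homotopic_loops (points_of K) (edge_loop ?ws) (\<lambda>t. polygonal ?vs (\<phi> (real (Suc m) * t)))"
  proof (rule homotopic_loops_eq)
    show "path_image (edge_loop ?ws) \<subseteq> points_of K"
      using calculation(1,2) homotopic_loops_imp_subset[OF calculation(1)]
      by (auto simp: path_image_def image_subset_iff)
    show "pathfinish (edge_loop ?ws) = pathstart (edge_loop ?ws)"
      using edge_loop_ends[of ?ws] closed
      by (cases as) (auto simp: pathfinish_def pathstart_def split: if_splits)
  qed (use calculation in auto)
  ultimately show ?thesis using homotopic_loops_trans by simp
qed

lemma edge_loop_contiguous: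
  assumes vs: "edge_path K vs" "hd vs = last vs" and ws: "edge_path K ws" "hd ws = last ws"
    and len: "length vs = length ws" "1 < length vs"
    and contig: "\<And>k. Suc k < length vs \<Longrightarrow> \<exists>\<sigma>\<in>K. {vs ! k, vs ! Suc k, ws ! k, ws ! Suc k} \<subseteq> \<sigma>"
  shows "homotopic_loops (points_of K) (edge_loop vs) (edge_loop ws)"
proof (rule contiguous_loops_homotopic)
  fix t :: real assume t: "0 \<le> t" "t \<le> 1"
  then have "0 \<le> real (length vs - 1) * t" "real (length vs - 1) * t \<le> real (length vs - 1)"
    by (auto simp: mult_left_le)
  moreover have "0 < length vs - 1" using len by simp
  ultimately obtain k where k: "k < length vs - 1" "real k \<le> real (length vs - 1) * t"
    "real (length vs - 1) * t \<le> real k + 1"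
    using unit_segment_index by blast
  then have "Suc k < length vs" by linarith
  then obtain \<sigma> where \<sigma>: "\<sigma> \<in> K" "{vs ! k, vs ! Suc k, ws ! k, ws ! Suc k} \<subseteq> \<sigma>"
    using contig by blast
  then have "edge_loop vs t \<in> closed_simplex \<sigma>" "edge_loop ws t \<in> closed_simplex \<sigma>"
    unfolding edge_loop_def len(1)[symmetric]
    using k len abstract_complex_finite[OF complex \<sigma>(1)]
    by (auto intro!: polygonal_in_closed_simplex[where k = k])
  then show "\<exists>\<sigma>\<in>K. edge_loop vs t \<in> closed_simplex \<sigma> \<and> edge_loop ws t \<in> closed_simplex \<sigma>"
    using \<sigma>(1) by blast
qed (intro path_edge_loop edge_loop_closed vs ws)+

text \<open>Replacing \<open>q\<close> by a pause at \<open>p\<close> gives a contiguous loop of the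
  same length, all changes taking place in the simplex \<open>{p, q, r}\<close>; the pause is then
  removed.\<close>

lemma edge_loop_triangle:
  assumes vs: "edge_path K (as @ p # q # r # bs)" "hd (as @ p # q # r # bs) = last (as @ p # q # r # bs)"
    and pqr: "{p, q, r} \<in> K"
  shows "homotopic_loops (points_of K) (edge_loop (as @ p # q # r # bs)) (edge_loop (as @ p # r # bs))"
proof -
  have pr: "{p, r} \<in> K" "{p} \<in> K" by (rule abstract_complex_face[OF complex pqr]; simp)+
  have vs': "edge_path K (as @ [p])" "edge_path K (r # bs)"
    using vs(1) edge_path_append[of as p "q # r # bs"] edge_path_append[of "[p, q]" r bs] by auto
  have "edge_path K (p # r # bs)" "edge_path K (p # p # r # bs)"
    using vs'(2) pr by (auto simp: edge_path_def)
  then have ws: "edge_path K (as @ p # p # r # bs)" "edge_path K (as @ p # r # bs)"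
    using vs'(1) edge_path_append[of as p "p # r # bs"] edge_path_append[of as p "r # bs"] by auto
  have closed: "hd (as @ p # p # r # bs) = last (as @ p # p # r # bs)"
    "hd (as @ p # r # bs) = last (as @ p # r # bs)"
    using vs(2) by (auto simp: hd_append)
  have "homotopic_loops (points_of K) (edge_loop (as @ p # q # r # bs)) (edge_loop (as @ p # p # r # bs))"
  proof (rule edge_loop_contiguous[OF vs ws(1) closed(1)])
    fix k assume k: "Suc k < length (as @ p # q # r # bs)"
    let ?vs = "as @ p # q # r # bs" and ?ws = "as @ p # p # r # bs"
    consider "k = length as" | "k = Suc (length as)" | "k < length as" | "Suc (length as) < k" by linarith
    then show "\<exists>\<sigma>\<in>K. {?vs ! k, ?vs ! Suc k, ?ws ! k, ?ws ! Suc k} \<subseteq> \<sigma>"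
    proof cases
      case 1
      then show ?thesis using pqr by (intro bexI[OF _ pqr]) (auto simp: nth_append)
    next
      case 2
      then show ?thesis using pqr by (intro bexI[OF _ pqr]) (auto simp: nth_append)
    next
      case 3
      then have eq: "?ws ! k = ?vs ! k" "?ws ! Suc k = ?vs ! Suc k"
        by (auto simp: nth_append nth_Cons split: nat.splits)
      show ?thesis
        unfolding eq by (rule bexI[OF _ edge_path_consecutive[OF vs(1) k]]) blast
    next
      case 4
      then obtain i where i: "k = Suc (Suc (length as + i))"
        by (metis Suc_lessE add.commute less_imp_Suc_add)
      have eq: "?ws ! k = ?vs ! k" "?ws ! Suc k = ?vs ! Suc k"
        using nth_append_length_plus[of as "p # q # r # bs" "Suc (Suc i)"]
          nth_append_length_plus[of as "p # q # r # bs" "Suc (Suc (Suc i))"]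
          nth_append_length_plus[of as "p # p # r # bs" "Suc (Suc i)"]
          nth_append_length_plus[of as "p # p # r # bs" "Suc (Suc (Suc i))"]
        by (simp_all add: i)
      show ?thesis
        unfolding eq by (rule bexI[OF _ edge_path_consecutive[OF vs(1) k]]) blast
    qed
  qed auto
  also have "homotopic_loops (points_of K) (edge_loop (as @ p # p # r # bs)) (edge_loop (as @ p # r # bs))"
    by (rule edge_loop_stutter[OF ws(2) closed(2)])
  finally (homotopic_loops_trans) show ?thesis .
qed

lemma edge_loop_backtrack:
  assumes vs: "edge_path K (as @ p # q # p # bs)" "hd (as @ p # q # p # bs) = last (as @ p # q # p # bs)"
  shows "homotopic_loops (points_of K) (edge_loop (as @ p # q # p # bs)) (edge_loop (as @ p # bs))"
proof -
  have e: "edge_path K (as @ [p])" "edge_path K (p # bs)" "{p, q} \<in> K"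
    using vs(1) edge_path_append[of as p "q # p # bs"] edge_path_append[of "[p, q]" p bs]
    by (auto simp: edge_path_def)
  then have "homotopic_loops (points_of K) (edge_loop (as @ p # q # p # bs)) (edge_loop (as @ p # p # bs))"
    by (intro edge_loop_triangle vs) (simp add: insert_commute)
  also have "homotopic_loops (points_of K) (edge_loop (as @ p # p # bs)) (edge_loop (as @ p # bs))"
    by (rule edge_loop_stutter)
      (use e edge_path_append[of as p bs] vs(2) in \<open>auto simp: hd_append\<close>)
  finally (homotopic_loops_trans) show ?thesis .
qed

lemma edge_loop_refl:
  assumes "edge_path K vs" "hd vs = last vs"
  shows "homotopic_loops (points_of K) (edge_loop vs) (edge_loop vs)"
proof -
  have "path_image (edge_loop vs) \<subseteq> points_of K"
    using polygonal_in_points_of[OF assms(1)]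
    by (auto simp: path_image_def edge_loop_def mult_left_le)
  then show ?thesis
    using edge_loop_closed[OF assms] path_edge_loop
    by (simp add: homotopic_loops_refl pathstart_def pathfinish_def)
qed

text \<open>Prepares the translation into words: no letter of a Cayley complex stands for a
  pause.\<close>

lemma edge_loop_destutter:
  assumes "edge_path K vs" "hd vs = last vs"
  shows "\<exists>ws. edge_path K ws \<and> hd ws = last ws \<and> distinct_adj ws \<and>
    homotopic_loops (points_of K) (edge_loop vs) (edge_loop ws)"
  using assms
proof (induction "length vs" arbitrary: vs rule: less_induct)
  case less
  show ?case
  proof (cases "distinct_adj vs")
    case True
    then show ?thesis using less edge_loop_refl by blast
  next
    case False
    then obtain k where k: "Suc k < length vs" "vs ! k = vs ! Suc k"
      by (auto simp: distinct_adj_def successively_conv_nth)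
    define as where "as = take k vs"
    define bs where "bs = drop (Suc (Suc k)) vs"
    define v where "v = vs ! k"
    have vs: "vs = as @ v # v # bs"
      using k by (simp add: as_def bs_def v_def id_take_nth_drop[symmetric] Cons_nth_drop_Suc)
        (metis Cons_nth_drop_Suc Suc_lessD append_take_drop_id)
    have e: "edge_path K (as @ v # bs)"
      using less.prems(1) edge_path_append[of as v "v # bs"] edge_path_append[of as v bs]
        edge_path_append[of "[v]" v bs] vs by auto
    have c: "hd (as @ v # bs) = last (as @ v # bs)" using less.prems(2) vs by (auto simp: hd_append)
    obtain ws where "edge_path K ws" "hd ws = last ws" "distinct_adj ws"
      "homotopic_loops (points_of K) (edge_loop (as @ v # bs)) (edge_loop ws)"
      using less.hyps[OF _ e c] vs by auto
    then show ?thesis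
      using homotopic_loops_trans[OF edge_loop_stutter[OF e c]] vs by blast
  qed
qed

text \<open>Simplicial approximation. The sets \<open>W v\<close> of times spent in the open star of
  \<open>v\<close> cover the interval; with a mesh below a Lebesgue number, a vertex is chosen at
  each subdivision point whose star contains the neighbouring pieces.\<close>

lemma loop_homotopic_edge_loop:
  assumes p: "path p" "path_image p \<subseteq> points_of K" "p 1 = p 0"
  obtains vs where "edge_path K vs" "hd vs = last vs" "homotopic_loops (points_of K) p (edge_loop vs)"
proof -
  have sup: "support (p t) \<in> K" "\<And>v. 0 \<le> p t v" if "0 \<le> t" "t \<le> 1" for t
  proof -
    have "p t \<in> points_of K" using p(2) that by (auto simp: path_image_def)
    then show "support (p t) \<in> K" "\<And>v. 0 \<le> p t v" using points_of_iff[OF complex, of "p t"] by auto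
  qed
  have cp: "continuous_on {0..1} p" using p(1) by (simp add: path_def)
  have "\<exists>W. open W \<and> {t \<in> {0..1}. 0 < p t v} = {0..1} \<inter> W" for v
  proof -
    have "openin (top_of_set {0..1}) ({0..1} \<inter> (\<lambda>t. p t v) -` {0<..})"
      by (rule continuous_openin_preimage_gen[OF
          continuous_on_product_then_coordinatewise[OF cp] open_greaterThan])
    moreover have "{0..1} \<inter> (\<lambda>t. p t v) -` {0<..} = {t \<in> {0..1}. 0 < p t v}" by auto
    ultimately show ?thesis by (auto simp: openin_open)
  qed
  then obtain W where W: "\<And>v. open (W v)" "\<And>v. {t \<in> {0..1}. 0 < p t v} = {0..1} \<inter> W v" by metis
  have Wp: "0 < p t v \<longleftrightarrow> t \<in> W v" if "0 \<le> t" "t \<le> 1" for t v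
    using W(2)[of v] that by (auto simp: set_eq_iff)
  have pos: "\<exists>v. 0 < p t v" if "0 \<le> t" "t \<le> 1" for t
  proof -
    have "support (p t) \<noteq> {}" using sup(1)[OF that] complex unfolding abstract_complex_def by blast
    then obtain v where "p t v \<noteq> 0" by (auto simp: support_def)
    then show ?thesis using sup(2)[OF that, of v] by (intro exI[of _ v]) simp
  qed
  obtain \<epsilon> where \<epsilon>: "0 < \<epsilon>" "\<And>x. x \<in> {0..1} \<Longrightarrow> \<exists>G \<in> range W. ball x \<epsilon> \<subseteq> G"
  proof (rule Heine_Borel_lemma[of "{0..1::real}" "range W"])
    show "{0..1} \<subseteq> \<Union>(range W)" using pos Wp by auto
  qed (use W(1) in auto)
  have "\<exists>v. ball x \<epsilon> \<subseteq> W v" if "0 \<le> x" "x \<le> 1" for x using \<epsilon>(2)[of x] that by auto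
  then obtain V where V: "\<And>x. \<lbrakk>0 \<le> x; x \<le> 1\<rbrakk> \<Longrightarrow> ball x \<epsilon> \<subseteq> W (V x)" by metis
  \<comment> \<open>The edge loop has to close up, so one vertex serves both ends, and its star must
    contain neighbourhoods of both 0 and 1.\<close>
  obtain u where u: "0 < p 0 u" using pos[of 0] by auto
  then have "0 \<in> W u" "1 \<in> W u" using Wp[of 0 u] Wp[of 1 u] p(3) by auto
  then obtain \<delta>0 \<delta>1 where \<delta>: "0 < \<delta>0" "ball 0 \<delta>0 \<subseteq> W u" "0 < \<delta>1" "ball 1 \<delta>1 \<subseteq> W u"
    using W(1) open_contains_ball by metis
  define \<eta> where "\<eta> = min \<epsilon> (min \<delta>0 \<delta>1)"
  have "0 < \<eta>" using \<epsilon>(1) \<delta> by (simp add: \<eta>_def)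
  then obtain n where n: "0 < n" "1 / real n < \<eta>"
    by (metis nat_approx_posE zero_less_Suc)
  define f where "f = (\<lambda>k. if k = 0 \<or> k = n then u else V (real k / real n))"
  have f: "0 < p t (f k)" if t: "0 \<le> t" "t \<le> 1" and k: "k \<le> n" "\<bar>real n * t - real k\<bar> \<le> 1" for t k
  proof -
    have "t - real k / real n = (real n * t - real k) / real n"
      using n(1) by (simp add: field_simps)
    then have "\<bar>t - real k / real n\<bar> = \<bar>real n * t - real k\<bar> / real n" by simp
    also have "\<dots> \<le> 1 / real n" using k n(1) by (simp add: divide_right_mono)
    finally have "dist (real k / real n) t < \<eta>" using n(2) by (simp add: dist_real_def abs_minus_commute)
    then have "t \<in> W (f k)"
      using \<delta> V[of "real k / real n"] k n(1)
      by (cases "k = 0"; cases "k = n") (auto simp: f_def \<eta>_def subset_eq)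
    then show ?thesis using Wp[OF t] by simp
  qed
  define vs where "vs = map f [0..<Suc n]"
  have len: "length vs = Suc n" by (simp add: vs_def)
  have nth: "vs ! k = f k" if "k \<le> n" for k using that by (simp add: vs_def del: upt_Suc)
  \<comment> \<open>On the k-th piece both chosen vertices lie in the support of \<open>p t\<close>,
    so that simplex contains \<open>p t\<close> and the point of the edge loop.\<close>
  have common: "f k \<in> support (p t) \<and> f (Suc k) \<in> support (p t)"
    if "k < n" "real k \<le> real n * t" "real n * t \<le> real k + 1" "0 \<le> t" "t \<le> 1" for k t
    using f[of t k] f[of t "Suc k"] that by (auto simp: support_def)
  show ?thesis
  proof
    show closed: "hd vs = last vs"
      using nth[of 0] nth[of n] len n(1) hd_conv_nth[of vs] last_conv_nth[of vs] by (cases "vs = []") (auto simp: f_def)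
    have edge: "{f k, f (Suc k)} \<in> K" if "k < n" for k
    proof -
      have "real k / real n \<le> 1" using that by simp
      moreover have "real n * (real k / real n) = real k" using n(1) by simp
      ultimately show ?thesis
        using common[of k "real k / real n"] that sup(1)[of "real k / real n"]
          abstract_complex_pair[OF complex] by simp
    qed
    have mem: "f k \<in> \<Union>K" if "k \<le> n" for k
    proof (cases "k = n")
      case True
      then have "f k \<in> {f (n - 1), f (Suc (n - 1))}" using n(1) by auto
      moreover have "{f (n - 1), f (Suc (n - 1))} \<in> K" using n(1) by (intro edge) simp
      ultimately show ?thesis by (rule UnionI[rotated])
    next
      case False
      then have "{f k, f (Suc k)} \<in> K" using that by (intro edge) simp
      then show ?thesis by blast
    qed
    show e: "edge_path K vs"
      unfolding edge_path_def successively_conv_nth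
    proof (intro conjI allI impI)
      show "vs \<noteq> []" using len by auto
      show "set vs \<subseteq> \<Union>K" using mem by (auto simp: vs_def)
      show "{vs ! i, vs ! Suc i} \<in> K" if "Suc i < length vs" for i
        using that edge[of i] nth[of i] nth[of "Suc i"] len by simp
    qed
    show "homotopic_loops (points_of K) p (edge_loop vs)"
    proof (rule contiguous_loops_homotopic)
      show "edge_loop vs 1 = edge_loop vs 0"
        by (rule edge_loop_closed[OF e closed])
      fix t :: real assume t: "0 \<le> t" "t \<le> 1"
      then have "0 \<le> real n * t" "real n * t \<le> real n" by (auto simp: mult_left_le)
      then obtain k where k: "k < n" "real k \<le> real n * t" "real n * t \<le> real k + 1"
        using unit_segment_index n(1) by blast
      have s: "support (p t) \<in> K" using sup(1) t by blast
      have "edge_loop vs t \<in> closed_simplex (support (p t))"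
        unfolding edge_loop_def
        using k common[OF k t] nth[of k] nth[of "Suc k"] len abstract_complex_finite[OF complex s]
        by (intro polygonal_in_closed_simplex[where k = k]) auto
      moreover have "p t \<in> closed_simplex (support (p t))"
      proof (rule closed_simplex_support)
        show "p t \<in> points_of K" using p(2) t by (auto simp: path_image_def)
      qed
      ultimately show "\<exists>\<sigma>\<in>K. p t \<in> closed_simplex \<sigma> \<and> edge_loop vs t \<in> closed_simplex \<sigma>"
        using s by blast
    qed (use p path_edge_loop in auto)
  qed
qed

text \<open>The vertex \<open>v\<close> is the same for all \<open>vs\<close>. As
  \<open>simply_connected_space\<close> compares any two loops by free homotopy, all loops must
  shrink to one and the same constant loop.\<close>

lemma simply_connected_spaceI:
  assumes "\<And>vs. \<lbrakk>edge_path K vs; hd vs = last vs; distinct_adj vs\<rbrakk> \<Longrightarrow>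
    homotopic_loops (points_of K) (edge_loop vs) (edge_loop [v])"
  shows "simply_connected_space (realization K)"
proof -
  have top: "realization K = top_of_set (points_of K)"
    by (rule realization_eq_top_of_set[OF complex locally_finite])
  have null: "homotopic_loops (points_of K) p (edge_loop [v])" if "loop_in (realization K) p" for p
  proof -
    have p: "path p" "path_image p \<subseteq> points_of K" "p 1 = p 0"
      using that by (auto simp: loop_in_def pathin_def top path_def path_image_def)
    obtain vs where "edge_path K vs" "hd vs = last vs" "homotopic_loops (points_of K) p (edge_loop vs)"
      by (rule loop_homotopic_edge_loop[OF p])
    moreover then obtain ws where "edge_path K ws" "hd ws = last ws" "distinct_adj ws"
      "homotopic_loops (points_of K) (edge_loop vs) (edge_loop ws)"
      using edge_loop_destutter by blast
    ultimately show ?thesis using assms homotopic_loops_trans by metis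
  qed
  have "homotopic_loops (points_of K) p q" if "loop_in (realization K) p" "loop_in (realization K) q" for p q
    using homotopic_loops_trans[OF null[OF that(1)] homotopic_loops_sym[OF null[OF that(2)]]] .
  then show ?thesis
    by (simp add: simply_connected_space_def homotopic_loops_def pathfinish_def pathstart_def top)
qed

end


section \<open>Barycentric coordinates in the unit triangle\<close>

abbreviation apex :: complex where "apex \<equiv> cis (pi/3)"

text \<open>\<open>bary0\<close>, \<open>bary1\<close>, \<open>bary2\<close> are the barycentric
  coordinates at the corners 0, 1 and \<open>apex\<close>: a point is
  \<open>bary1 + bary2 * apex\<close>.\<close>

definition bary1 :: "complex \<Rightarrow> real" where "bary1 z = Re z - Im z / sqrt 3"
definition bary2 :: "complex \<Rightarrow> real" where "bary2 z = 2 * Im z / sqrt 3"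
definition bary0 :: "complex \<Rightarrow> real" where "bary0 z = 1 - bary1 z - bary2 z"

lemmas [simp] = cos_60 sin_60

lemma bary_unique:
  "bary1 (of_real s + of_real t * apex) = s" "bary2 (of_real s + of_real t * apex) = t"
  by (simp_all add: bary1_def bary2_def field_simps)

lemma bary_expand: "of_real (bary1 z) + of_real (bary2 z) * apex = z"
  by (simp add: complex_eq_iff bary1_def bary2_def field_simps)

lemma bary_inj: "\<lbrakk>bary1 z = bary1 w; bary2 z = bary2 w\<rbrakk> \<Longrightarrow> z = w"
  by (metis bary_expand)

lemma unit_triangle_iff: "z \<in> unit_triangle \<longleftrightarrow> 0 \<le> bary0 z \<and> 0 \<le> bary1 z \<and> 0 \<le> bary2 z"
proof
  assume "z \<in> unit_triangle"
  then obtain u v w where "0 \<le> u" "0 \<le> v" "0 \<le> w" "u + v + w = 1"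
    and "z = u *\<^sub>R 0 + v *\<^sub>R 1 + w *\<^sub>R apex"
    unfolding unit_triangle_def triangle_corners_def convex_hull_3 by blast
  moreover from this have z: "z = of_real v + of_real w * apex" by (simp add: scaleR_conv_of_real)
  ultimately show "0 \<le> bary0 z \<and> 0 \<le> bary1 z \<and> 0 \<le> bary2 z"
    unfolding z bary0_def bary_unique by simp
next
  assume R: "0 \<le> bary0 z \<and> 0 \<le> bary1 z \<and> 0 \<le> bary2 z"
  have "z = bary0 z *\<^sub>R 0 + bary1 z *\<^sub>R 1 + bary2 z *\<^sub>R apex"
    using bary_expand[of z] by (simp add: scaleR_conv_of_real)
  moreover have "bary0 z + bary1 z + bary2 z = 1" by (simp add: bary0_def)
  ultimately show "z \<in> unit_triangle"
    unfolding unit_triangle_def triangle_corners_def convex_hull_3 using R by blast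
qed

lemma continuous_on_bary [continuous_intros]:
  "continuous_on S bary0" "continuous_on S bary1" "continuous_on S bary2"
  unfolding bary0_def bary1_def bary2_def by (intro continuous_intros; simp)+

lemma apex_neq [simp]: "apex \<noteq> 0" "apex \<noteq> 1" "0 \<noteq> apex" "1 \<noteq> apex"
  by (auto simp: complex_eq_iff)

lemma bary_simps [simp]:
  "bary1 0 = 0" "bary2 0 = 0" "bary1 1 = 1" "bary2 1 = 0" "bary1 apex = 0" "bary2 apex = 1"
  by (simp_all add: bary1_def bary2_def)

lemma bary_scaleR [simp]: "bary1 (t *\<^sub>R z) = t * bary1 z" "bary2 (t *\<^sub>R z) = t * bary2 z"
  by (simp_all add: bary1_def bary2_def right_diff_distrib)

lemma bary_linepath:
  "bary1 (linepath a b t) = (1 - t) * bary1 a + t * bary1 b"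
  "bary2 (linepath a b t) = (1 - t) * bary2 a + t * bary2 b"
  "bary0 (linepath a b t) = (1 - t) * bary0 a + t * bary0 b"
  by (simp_all add: bary0_def bary1_def bary2_def linepath_def diff_divide_distrib add_divide_distrib algebra_simps)

text \<open>The sides are run through in the directions that \<open>edge_class\<close> uses.\<close>

lemma unit_triangle_cases:
  assumes "z \<in> unit_triangle"
  obtains "z \<in> triangle_corners"
  | t where "0 < t" "t < 1" "z = linepath 0 1 t"
  | t where "0 < t" "t < 1" "z = linepath 1 apex t"
  | t where "0 < t" "t < 1" "z = linepath 0 apex t"
  | "0 < bary0 z" "0 < bary1 z" "0 < bary2 z"
proof -
  have pos: "0 \<le> bary0 z" "0 \<le> bary1 z" "0 \<le> bary2 z" and sum: "bary0 z + bary1 z + bary2 z = 1"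
    using assms by (auto simp: unit_triangle_iff bary0_def)
  have eq: "z = w" if "bary1 z = bary1 w" "bary2 z = bary2 w" for w using that by (rule bary_inj)
  consider "bary1 z = 0 \<and> bary2 z = 0" | "bary1 z = 1 \<and> bary2 z = 0" | "bary1 z = 0 \<and> bary2 z = 1"
    | "0 < bary1 z \<and> bary1 z < 1 \<and> bary2 z = 0"
    | "0 < bary2 z \<and> bary2 z < 1 \<and> bary1 z = 1 - bary2 z"
    | "0 < bary2 z \<and> bary2 z < 1 \<and> bary1 z = 0"
    | "0 < bary0 z \<and> 0 < bary1 z \<and> 0 < bary2 z"
    using pos sum by argo
  then show thesis
  proof cases
    case 1 then show ?thesis using that(1) eq[of 0] by (simp add: triangle_corners_def)
  next
    case 2 then show ?thesis using that(1) eq[of 1] by (simp add: triangle_corners_def)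
  next
    case 3 then show ?thesis using that(1) eq[of apex] by (simp add: triangle_corners_def)
  next
    case 4
    then have "z = linepath 0 1 (bary1 z)"
      by (intro eq; unfold bary_linepath; simp)
    then show ?thesis using that(2) 4 by blast
  next
    case 5
    then have "z = linepath 1 apex (bary2 z)"
      by (intro eq; unfold bary_linepath; simp)
    then show ?thesis using that(3) 5 by blast
  next
    case 6
    then have "z = linepath 0 apex (bary2 z)"
      by (intro eq; unfold bary_linepath; simp)
    then show ?thesis using that(4) 6 by blast
  next
    case 7 then show ?thesis using that(5) by blast
  qed
qed


section \<open>Triangular presentations\<close>

text \<open>The triangle \<open>i\<close> stands for the relation \<open>X i \<cdot> Y i = Z i\<close>: its sides from \<open>0\<close> to \<open>1\<close>,
  from \<open>1\<close> to \<open>cis (pi/3)\<close> and from \<open>0\<close> to \<open>cis (pi/3)\<close> carry the labels \<open>X i\<close>, \<open>Y i\<close>, \<open>Z i\<close>.\<close>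

definition edge_class :: "nat set \<Rightarrow> (nat \<Rightarrow> 's) \<Rightarrow> (nat \<Rightarrow> 's) \<Rightarrow> (nat \<Rightarrow> 's) \<Rightarrow> 's
    \<Rightarrow> (nat \<times> complex \<times> complex) set" where
  "edge_class I X Y Z s = {(i, 0, 1) | i. i \<in> I \<and> X i = s} \<union> {(i, 1, apex) | i. i \<in> I \<and> Y i = s}
     \<union> {(i, 0, apex) | i. i \<in> I \<and> Z i = s}"

definition presentation_gluing :: "nat set \<Rightarrow> (nat \<Rightarrow> 's) \<Rightarrow> (nat \<Rightarrow> 's) \<Rightarrow> (nat \<Rightarrow> 's) \<Rightarrow> nat gluing" where
  "presentation_gluing I X Y Z = range (edge_class I X Y Z)"

lemma edge_class_cases:
  assumes "(i, a, b) \<in> edge_class I X Y Z s"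
  obtains "i \<in> I" "a = 0" "b = 1" "X i = s" | "i \<in> I" "a = 1" "b = apex" "Y i = s"
    | "i \<in> I" "a = 0" "b = apex" "Z i = s"
  using assms by (auto simp: edge_class_def)

lemma linepath_in_unit_triangle:
  assumes "(i, a, b) \<in> edge_class I X Y Z s" "t \<in> {0..1}"
  shows "linepath a b t \<in> unit_triangle"
  using assms by (elim edge_class_cases) (auto simp: unit_triangle_iff bary_linepath bary0_def)

lemma glue_stepI:
  "\<lbrakk>k \<in> G; (i, a, b) \<in> k; (j, c, d) \<in> k; t \<in> {0..1}\<rbrakk>
     \<Longrightarrow> ((i, linepath a b t), (j, linepath c d t)) \<in> glue_step G"
  unfolding glue_step_def by blast

lemma glue_class_eq_iff:
  assumes "x \<in> Sigma I P" "y \<in> Sigma I P"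
  shows "glue_class I P G x = glue_class I P G y \<longleftrightarrow> (x, y) \<in> (glue_step G)\<^sup>*"
proof
  assume "glue_class I P G x = glue_class I P G y"
  then have "y \<in> glue_class I P G x" using assms(2) by (simp add: glue_class_def)
  then show "(x, y) \<in> (glue_step G)\<^sup>*" by (simp add: glue_class_def)
next
  assume xy: "(x, y) \<in> (glue_step G)\<^sup>*"
  then have "(y, x) \<in> (glue_step G)\<^sup>*"
    using sym_rtrancl[OF sym_glue_step] by (auto dest: symD)
  then show "glue_class I P G x = glue_class I P G y"
    using xy by (auto simp: glue_class_def intro: rtrancl_trans)
qed

text \<open>Equality of words in the presented group, \<open>(s, False)\<close> being the inverse
  letter. As \<open>b\<close> is arbitrary, one rule cancels both \<open>s\<close> before its
  inverse and after it.\<close>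

inductive word_eq :: "nat set \<Rightarrow> (nat \<Rightarrow> 's) \<Rightarrow> (nat \<Rightarrow> 's) \<Rightarrow> (nat \<Rightarrow> 's)
    \<Rightarrow> ('s \<times> bool) list \<Rightarrow> ('s \<times> bool) list \<Rightarrow> bool"
  for I X Y Z where
  word_refl: "word_eq I X Y Z w w"
| word_sym: "word_eq I X Y Z u w \<Longrightarrow> word_eq I X Y Z w u"
| word_trans: "word_eq I X Y Z u v \<Longrightarrow> word_eq I X Y Z v w \<Longrightarrow> word_eq I X Y Z u w"
| word_cancel: "word_eq I X Y Z (u @ (s, b) # (s, \<not> b) # w) (u @ w)"
| word_relator: "i \<in> I \<Longrightarrow> word_eq I X Y Z (u @ (X i, True) # (Y i, True) # w) (u @ (Z i, True) # w)"

text \<open>Any group in which the relations hold, not necessarily the presented one.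
  \<open>height\<close> orders each simplex; \<open>inj_gen\<close> and
  \<open>triangles_distinct\<close> let a simplex determine its labels and its triangle;
  \<open>one_vertex\<close> matches the transitivity of the group on vertices.\<close>

locale triangle_group = group mul one inv
  for mul :: "'v \<Rightarrow> 'v \<Rightarrow> 'v" (infixl "\<odot>" 70) and one :: 'v and inv :: "'v \<Rightarrow> 'v" +
  fixes I :: "nat set" and X Y Z :: "nat \<Rightarrow> 's" and gen :: "'s \<Rightarrow> 'v" and height :: "'v \<Rightarrow> int"
  assumes finite_I: "finite I"
    and relation: "i \<in> I \<Longrightarrow> gen (X i) \<odot> gen (Y i) = gen (Z i)"
    and height_mul: "height (u \<odot> v) = height u + height v"
    and height_gen: "0 < height (gen s)"
    and inj_gen: "inj gen"
    and triangles_distinct: "\<lbrakk>i \<in> I; j \<in> I; X i = X j; Z i = Z j\<rbrakk> \<Longrightarrow> i = j"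
    and label_used: "\<exists>i\<in>I. s = X i \<or> s = Y i \<or> s = Z i"
    and one_vertex: "\<lbrakk>i \<in> I; j \<in> I; a \<in> triangle_corners; b \<in> triangle_corners\<rbrakk> \<Longrightarrow>
      ((i, a), (j, b)) \<in> (glue_step (presentation_gluing I X Y Z))\<^sup>*"
begin

abbreviation G where "G \<equiv> presentation_gluing I X Y Z"

definition cell :: "'v \<Rightarrow> nat \<Rightarrow> 'v set" where
  "cell v i = {v, v \<odot> gen (X i), v \<odot> gen (Z i)}"

definition cayley :: "'v set set" where
  "cayley = {\<sigma>. \<sigma> \<noteq> {} \<and> (\<exists>v. \<exists>i\<in>I. \<sigma> \<subseteq> cell v i)}"

definition chart :: "'v \<Rightarrow> nat \<Rightarrow> complex \<Rightarrow> 'v \<Rightarrow> real" where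
  "chart v i z u = bary0 z * (if u = v then 1 else 0) + bary1 z * (if u = v \<odot> gen (X i) then 1 else 0)
     + bary2 z * (if u = v \<odot> gen (Z i) then 1 else 0)"

definition edge_point :: "'v \<Rightarrow> 's \<Rightarrow> real \<Rightarrow> 'v \<Rightarrow> real" where
  "edge_point v s t u = (1 - t) * (if u = v then 1 else 0) + t * (if u = v \<odot> gen s then 1 else 0)"

definition shift :: "'v \<Rightarrow> ('v \<Rightarrow> real) \<Rightarrow> 'v \<Rightarrow> real" where
  "shift g x u = x (inv g \<odot> u)"

text \<open>Heights increase in the order of the corners 0, 1, \<open>apex\<close>. Hence the bare
  vertex set of a cell remembers which vertex is which corner.\<close>

lemma height_cell:
  assumes "i \<in> I"
  shows "height v < height (v \<odot> gen (X i))" "height (v \<odot> gen (X i)) < height (v \<odot> gen (Z i))"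
  using height_gen[of "X i"] height_gen[of "Y i"] relation[OF assms, symmetric]
  by (simp_all add: height_mul)

lemma cell_distinct:
  assumes "i \<in> I"
  shows "v \<noteq> v \<odot> gen (X i)" "v \<odot> gen (X i) \<noteq> v \<odot> gen (Z i)" "v \<noteq> v \<odot> gen (Z i)"
  using height_cell[OF assms, of v] by auto

lemma card_cell: "i \<in> I \<Longrightarrow> card (cell v i) = 3"
  using cell_distinct[of i v] by (simp add: cell_def)

lemma finite_cell [simp]: "finite (cell v i)"
  by (simp add: cell_def)

lemma height_inj_cell: "i \<in> I \<Longrightarrow> inj_on height (cell v i)"
  using height_cell[of i v] by (auto simp: inj_on_def cell_def)

lemma height_inj_cayley: "\<sigma> \<in> cayley \<Longrightarrow> inj_on height \<sigma>"
  unfolding cayley_def using height_inj_cell inj_on_subset by blast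

lemma complex_cayley: "abstract_complex cayley"
  unfolding abstract_complex_def
proof (intro conjI ballI allI impI)
  fix \<sigma> assume \<sigma>: "\<sigma> \<in> cayley"
  then obtain v i where vi: "i \<in> I" "\<sigma> \<subseteq> cell v i" "\<sigma> \<noteq> {}" by (auto simp: cayley_def)
  then show "finite \<sigma>" "\<sigma> \<noteq> {}" using finite_subset[OF vi(2)] by auto
  show "\<tau> \<in> cayley" if "\<tau> \<subseteq> \<sigma> \<and> \<tau> \<noteq> {}" for \<tau>
    using that vi unfolding cayley_def by blast
qed

lemma cell_in_cayley: "i \<in> I \<Longrightarrow> cell v i \<in> cayley"
  unfolding cayley_def by (auto simp: cell_def)

lemma cancel_eq [simp]: "v \<odot> a = v \<odot> b \<longleftrightarrow> a = b" "a \<odot> v = b \<odot> v \<longleftrightarrow> a = b"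
  by (simp_all add: left_cancel right_cancel)

lemma inv_mul_cancel [simp]: "inv g \<odot> (g \<odot> u) = u" "g \<odot> (inv g \<odot> u) = u"
  by (simp_all flip: assoc)

lemma inv_mul_eq: "inv g \<odot> u = v \<longleftrightarrow> u = g \<odot> v"
  by (metis assoc left_inverse left_neutral right_inverse)

lemma shift_chart: "shift g (chart v i z) = chart (g \<odot> v) i z"
  by (auto simp: shift_def chart_def fun_eq_iff inv_mul_eq assoc)

lemma shift_shift: "shift g (shift h x) = shift (g \<odot> h) x"
  by (simp add: shift_def fun_eq_iff inverse_distrib_swap assoc)

lemma shift_one [simp]: "shift one x = x"
  by (simp add: shift_def fun_eq_iff)

lemma shift_inv [simp]: "shift (inv g) (shift g x) = x" "shift g (shift (inv g) x) = x"
  by (simp_all add: shift_shift)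

lemma cell_shift: "(\<odot>) g ` cell v i = cell (g \<odot> v) i"
  by (simp add: cell_def assoc)

text \<open>\<open>g\<close> is the position of the tail of the edge relative to \<open>v\<close>:
  \<open>gen (X i)\<close> on the side labelled \<open>Y i\<close>, and \<open>one\<close> on the
  other two.\<close>

lemma chart_on_edge:
  assumes "(i, a, b) \<in> edge_class I X Y Z s"
  shows "\<exists>g. \<forall>v t. chart v i (linepath a b t) = edge_point (v \<odot> g) s t"
  using assms
proof (cases rule: edge_class_cases)
  case 1
  then show ?thesis
    by (intro exI[of _ one]) (auto simp: chart_def edge_point_def bary_linepath fun_eq_iff bary0_def)
next
  case 2
  then show ?thesis
    by (intro exI[of _ "gen (X i)"])
      (auto simp: chart_def edge_point_def bary_linepath fun_eq_iff bary0_def assoc relation)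
next
  case 3
  then show ?thesis
    by (intro exI[of _ one]) (auto simp: chart_def edge_point_def bary_linepath fun_eq_iff bary0_def)
qed

lemma chart_in_closed_simplex:
  assumes "i \<in> I" "z \<in> unit_triangle"
  shows "chart v i z \<in> closed_simplex (cell v i)"
  using assms cell_distinct[of i v]
  by (auto simp: closed_simplex_def support_def chart_def cell_def unit_triangle_iff bary0_def)

lemma chart_in_points_of: "\<lbrakk>i \<in> I; z \<in> unit_triangle\<rbrakk> \<Longrightarrow> chart v i z \<in> points_of cayley"
  unfolding points_of_def using chart_in_closed_simplex cell_in_cayley by blast

lemma chart_inverse:
  assumes "i \<in> I" "x \<in> closed_simplex (cell v i)"
  defines "z \<equiv> of_real (x (v \<odot> gen (X i))) + of_real (x (v \<odot> gen (Z i))) * apex"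
  shows "z \<in> unit_triangle" "chart v i z = x"
proof -
  have b: "bary1 z = x (v \<odot> gen (X i))" "bary2 z = x (v \<odot> gen (Z i))"
    by (simp_all add: z_def bary_unique)
  have "x v + x (v \<odot> gen (X i)) + x (v \<odot> gen (Z i)) = 1"
    using assms(2) cell_distinct[OF assms(1), of v] by (simp add: closed_simplex_def cell_def)
  then have b0: "bary0 z = x v" by (simp add: bary0_def b)
  show "z \<in> unit_triangle"
    using assms(2) by (simp add: unit_triangle_iff b b0 closed_simplex_def cell_def)
  have "x u = 0" if "u \<notin> cell v i" for u
    using assms(2) that by (auto simp: closed_simplex_def support_def)
  then show "chart v i z = x"
    using cell_distinct[OF assms(1), of v]
    by (auto simp: chart_def fun_eq_iff b b0 cell_def)
qed

lemma points_of_cayleyE: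
  assumes "x \<in> points_of cayley"
  obtains v i z where "i \<in> I" "z \<in> unit_triangle" "chart v i z = x"
proof -
  obtain \<sigma> where \<sigma>: "\<sigma> \<in> cayley" "x \<in> closed_simplex \<sigma>" using assms by (auto simp: points_of_def)
  then obtain v i where "i \<in> I" "\<sigma> \<subseteq> cell v i" by (auto simp: cayley_def)
  then have "x \<in> closed_simplex (cell v i)"
    using \<sigma>(2) closed_simplex_mono[OF finite_cell] by blast
  then show ?thesis using chart_inverse[OF \<open>i \<in> I\<close>] that \<open>i \<in> I\<close> by blast
qed

lemma gen_moves: "u \<noteq> u \<odot> gen s" "u \<odot> gen s \<noteq> u"
  using height_gen[of s] height_mul[of u "gen s"] by auto

lemma support_edge_point:
  assumes "0 < t" "t < 1"
  shows "support (edge_point u s t) = {u, u \<odot> gen s}"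
  using assms gen_moves[of u s] by (auto simp: support_def edge_point_def)

text \<open>The endpoints of an edge are told apart by height, which recovers the direction;
  injectivity of \<open>gen\<close> recovers the label.\<close>

lemma edge_point_eqD:
  assumes "edge_point u s t = edge_point u' s' t'" "0 < t" "t < 1" "0 < t'" "t' < 1"
  shows "u = u'" "s = s'" "t = t'"
proof -
  have lt: "height u < height (u \<odot> gen s)" "height u' < height (u' \<odot> gen s')"
    using height_gen by (simp_all add: height_mul)
  have e: "edge_point u s t w = edge_point u' s' t' w" for w using assms(1) by simp
  have "{u, u \<odot> gen s} = {u', u' \<odot> gen s'}"
    using support_edge_point[of t u s] support_edge_point[of t' u' s'] assms by simp
  then have "u = u' \<and> u \<odot> gen s = u' \<odot> gen s'" using lt by (auto simp: doubleton_eq_iff)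
  then show u: "u = u'" and "s = s'" using injD[OF inj_gen] by auto
  then show "t = t'" using e[of u] gen_moves by (simp add: edge_point_def)
qed

lemma chart_cases:
  assumes i: "i \<in> I" and z: "z \<in> unit_triangle"
  obtains "z \<in> triangle_corners" "card (support (chart v i z)) = 1"
  | s a b t u where "(i, a, b) \<in> edge_class I X Y Z s" "0 < t" "t < 1" "z = linepath a b t"
      "chart v i z = edge_point u s t" "card (support (chart v i z)) = 2"
  | "0 < bary0 z" "0 < bary1 z" "0 < bary2 z" "support (chart v i z) = cell v i"
proof -
  note d = cell_distinct[OF i, of v] and edge_case = that(2)
  have edge: ?thesis if e: "(i, a, b) \<in> edge_class I X Y Z s" and t: "0 < t" "t < 1" "z = linepath a b t"
    for a b s t
  proof -
    obtain u where u: "chart v i z = edge_point u s t" using chart_on_edge[OF e] t by blast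
    then have "card (support (chart v i z)) = 2"
      using support_edge_point[OF t(1,2)] gen_moves by simp
    then show ?thesis by (rule edge_case[OF e t u])
  qed
  from z show ?thesis
  proof (cases rule: unit_triangle_cases)
    case 1
    then consider "z = 0" | "z = 1" | "z = apex" by (auto simp: triangle_corners_def)
    then have "\<exists>u. support (chart v i z) = {u}"
    proof cases
      case 1 show ?thesis using d unfolding 1
        by (intro exI[of _ v]) (auto simp: support_def chart_def bary0_def)
    next
      case 2 show ?thesis using d unfolding 2
        by (intro exI[of _ "v \<odot> gen (X i)"]) (auto simp: support_def chart_def bary0_def)
    next
      case 3 show ?thesis using d unfolding 3
        by (intro exI[of _ "v \<odot> gen (Z i)"]) (auto simp: support_def chart_def bary0_def)
    qed
    then show ?thesis using that(1) 1 by auto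
  next
    case (2 t) then show ?thesis using i by (intro edge[of 0 1 "X i" t]) (auto simp: edge_class_def)
  next
    case (3 t) then show ?thesis using i by (intro edge[of 1 apex "Y i" t]) (auto simp: edge_class_def)
  next
    case (4 t) then show ?thesis using i by (intro edge[of 0 apex "Z i" t]) (auto simp: edge_class_def)
  next
    case 5
    then have "support (chart v i z) = cell v i"
      using d by (auto simp: support_def chart_def cell_def)
    then show ?thesis using that(3) 5 by blast
  qed
qed

text \<open>All copies of a point of a triangle in the Cayley complex: the future fibre over its
  class.\<close>

definition orbit :: "nat \<times> complex \<Rightarrow> ('v \<Rightarrow> real) set" where
  "orbit x = range (\<lambda>v. chart v (fst x) (snd x))"

lemma orbit_on_edge:
  assumes "(i, a, b) \<in> edge_class I X Y Z s"
  shows "orbit (i, linepath a b t) = range (\<lambda>v. edge_point v s t)"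
proof -
  obtain g where g: "\<And>v t. chart v i (linepath a b t) = edge_point (v \<odot> g) s t"
    using chart_on_edge[OF assms] by blast
  have "v = (v \<odot> inv g) \<odot> g" for v by (simp add: assoc)
  then show ?thesis unfolding orbit_def by (auto simp: g image_iff) metis
qed

lemma glue_step_orbit:
  assumes "(x, y) \<in> glue_step G"
  shows "orbit x = orbit y" "x \<in> Sigma I (\<lambda>_. unit_triangle)" "y \<in> Sigma I (\<lambda>_. unit_triangle)"
proof -
  obtain i a b j c d t s where x: "x = (i, linepath a b t)" and y: "y = (j, linepath c d t)"
    and t: "t \<in> {0..1}" and e: "(i, a, b) \<in> edge_class I X Y Z s" "(j, c, d) \<in> edge_class I X Y Z s"
    using assms by (auto simp: glue_step_def presentation_gluing_def)
  show "orbit x = orbit y" unfolding x y orbit_on_edge[OF e(1)] orbit_on_edge[OF e(2)] ..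
  have "i \<in> I" "j \<in> I" using e by (auto elim: edge_class_cases)
  then show "x \<in> Sigma I (\<lambda>_. unit_triangle)" "y \<in> Sigma I (\<lambda>_. unit_triangle)"
    unfolding x y using linepath_in_unit_triangle[OF e(1) t] linepath_in_unit_triangle[OF e(2) t] by auto
qed

lemma glued_orbit: "(x, y) \<in> (glue_step G)\<^sup>* \<Longrightarrow> orbit x = orbit y"
  by (induction rule: rtrancl_induct) (use glue_step_orbit in auto)

text \<open>The size 1, 2 or 3 of the support tells corners, open sides and interiors apart. Corners
  are all glued, points on sides share label and parameter, and interior points share the
  triangle.\<close>

lemma chart_eq_glued:
  assumes i: "i \<in> I" "z \<in> unit_triangle" and j: "j \<in> I" "z' \<in> unit_triangle"
    and eq: "chart v i z = chart v' j z'"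
  shows "((i, z), (j, z')) \<in> (glue_step G)\<^sup>*"
proof (cases rule: chart_cases[OF i, where v = v])
  case 1
  have "card (support (chart v' j z')) = 1" using 1 eq by simp
  then have "z' \<in> triangle_corners"
    by (cases rule: chart_cases[OF j, where v = v']) (simp_all add: card_cell j)
  then show ?thesis using 1 one_vertex i j by blast
next
  case (2 s a b t u)
  then have c: "card (support (chart v' j z')) = 2" using eq by simp
  then show ?thesis
  proof (cases rule: chart_cases[OF j, where v = v'])
    case (2 s' a' b' t' u')
    have "edge_point u s t = edge_point u' s' t'" using eq 2 \<open>chart v i z = edge_point u s t\<close> by simp
    then have "s = s'" "t = t'" using edge_point_eqD 2 \<open>0 < t\<close> \<open>t < 1\<close> by blast+
    then have "((i, z), (j, z')) \<in> glue_step G"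
      unfolding glue_step_def presentation_gluing_def
      using \<open>(i, a, b) \<in> edge_class I X Y Z s\<close> 2 \<open>z = linepath a b t\<close> \<open>0 < t\<close> \<open>t < 1\<close> by fastforce
    then show ?thesis by blast
  qed (simp_all add: card_cell j)
next
  case 3
  then have "card (support (chart v' j z')) = 3" using eq by (metis card_cell i(1))
  then have "support (chart v' j z') = cell v' j"
    by (cases rule: chart_cases[OF j, where v = v']) simp_all
  then have "cell v i = cell v' j" using 3 eq by simp
  \<comment> \<open>Equal cells, listed by increasing height, agree vertex by vertex.\<close>
  then have "v = v' \<and> v \<odot> gen (X i) = v' \<odot> gen (X j) \<and> v \<odot> gen (Z i) = v' \<odot> gen (Z j)"
    using height_cell[OF i(1), of v] height_cell[OF j(1), of v']
    unfolding cell_def by (smt (verit) insertE insertI1 insertI2 singletonD)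
  then have v: "v = v'" and ij: "i = j"
    using triangles_distinct[OF i(1) j(1)] injD[OF inj_gen] by auto
  have "bary1 z = bary1 z'" "bary2 z = bary2 z'"
    using fun_cong[OF eq, of "v \<odot> gen (X i)"] fun_cong[OF eq, of "v \<odot> gen (Z i)"]
      cell_distinct[OF i(1), of v] by (auto simp: v ij chart_def)
  then show ?thesis using bary_inj ij by blast
qed

text \<open>The gluing generates no more and no fewer identifications than the group action, so the
  glued space is the orbit space.\<close>

lemma triangle_class_eq_iff:
  assumes "x \<in> Sigma I (\<lambda>_. unit_triangle)" "y \<in> Sigma I (\<lambda>_. unit_triangle)"
  shows "triangle_class I G x = triangle_class I G y \<longleftrightarrow> orbit x = orbit y"
proof -
  have "triangle_class I G x = triangle_class I G y \<longleftrightarrow> (x, y) \<in> (glue_step G)\<^sup>*"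
    unfolding triangle_class_def by (rule glue_class_eq_iff[OF assms])
  moreover have "(x, y) \<in> (glue_step G)\<^sup>*" if o: "orbit x = orbit y"
  proof -
    obtain i z j z' where xy: "x = (i, z)" "y = (j, z')" by (metis surj_pair)
    have "chart one i z \<in> orbit y" using o by (auto simp: xy orbit_def)
    then obtain v where "chart one i z = chart v j z'" by (auto simp: xy orbit_def)
    then show ?thesis using chart_eq_glued assms by (auto simp: xy)
  qed
  ultimately show ?thesis using glued_orbit by blast
qed

text \<open>An open edge cannot be folded, since a translation taking one of its points to another
  would have to preserve the parameter. Sides run against their class direction reduce to the others
  by \<open>1 - t\<close>.\<close>

lemma triangle_complex_presentation: "triangle_complex I G"
  unfolding triangle_complex_def
proof (intro conjI ballI impI)
  fix c e assume "c \<in> G" "e \<in> c"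
  then show "case e of (i, a, b) \<Rightarrow> i \<in> I \<and> a \<in> triangle_corners \<and> b \<in> triangle_corners \<and> a \<noteq> b"
    by (auto simp: presentation_gluing_def edge_class_def triangle_corners_def)
next
  fix i a b assume i: "i \<in> I" and ab: "a \<in> triangle_corners" "b \<in> triangle_corners" "a \<noteq> b"
  have inj: "inj_on (\<lambda>t. triangle_class I G (i, linepath a b t)) {0<..<1}"
    if e: "(i, a, b) \<in> edge_class I X Y Z s" for a b s
  proof (rule inj_onI)
    fix t t' :: real assume t: "t \<in> {0<..<1}" "t' \<in> {0<..<1}"
      and eq: "triangle_class I G (i, linepath a b t) = triangle_class I G (i, linepath a b t')"
    have "orbit (i, linepath a b t) = orbit (i, linepath a b t')"
      using eq i linepath_in_unit_triangle[OF e] t by (subst (asm) triangle_class_eq_iff) auto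
    then have "edge_point one s t \<in> range (\<lambda>v. edge_point v s t')"
      unfolding orbit_on_edge[OF e] by blast
    then show "t = t'" using edge_point_eqD(3) t by auto
  qed
  have "(\<exists>s. (i, a, b) \<in> edge_class I X Y Z s) \<or> (\<exists>s. (i, b, a) \<in> edge_class I X Y Z s)"
    using ab i by (auto simp: triangle_corners_def edge_class_def)
  then show "inj_on (\<lambda>t. glue_class I (\<lambda>_. unit_triangle) G (i, linepath a b t)) {0<..<1}"
  proof
    assume "\<exists>s. (i, b, a) \<in> edge_class I X Y Z s"
    then have "inj_on (\<lambda>t. triangle_class I G (i, linepath b a t)) {0<..<1}" using inj by blast
    then have "1 - t = 1 - t'" if "t \<in> {0<..<1}" "t' \<in> {0<..<1}"
      "triangle_class I G (i, linepath b a (1 - t)) = triangle_class I G (i, linepath b a (1 - t'))" for t t'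
      using inj_onD[of _ "{0<..<1}" "1 - t" "1 - t'"] that by fastforce
    then have "inj_on (\<lambda>t. triangle_class I G (i, linepath b a (1 - t))) {0<..<1}"
      by (intro inj_onI) force
    moreover have "linepath b a (1 - t) = linepath a b t" for t by (simp add: linepath_def)
    ultimately show ?thesis by (simp add: triangle_class_def)
  qed (use inj in \<open>auto simp: triangle_class_def\<close>)
qed

end

section \<open>The orbit map from the Cayley complex is a covering\<close>

lemma openin_triangle_space:
  "openin (triangle_space I G) W \<longleftrightarrow> W \<subseteq> triangle_class I G ` Sigma I (\<lambda>_. unit_triangle) \<and>
     (\<forall>i\<in>I. openin (top_of_set unit_triangle) {z \<in> unit_triangle. triangle_class I G (i, z) \<in> W})"
proof -
  have "{z. (i, z) \<in> {x \<in> Sigma I (\<lambda>_. unit_triangle). triangle_class I G x \<in> W}} =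
      {z \<in> unit_triangle. triangle_class I G (i, z) \<in> W}" if "i \<in> I" for i
    using that by auto
  moreover have "Sigma I (topspace \<circ> (\<lambda>i. top_of_set unit_triangle)) = Sigma I (\<lambda>_. unit_triangle)"
    by (simp add: comp_def)
  ultimately show ?thesis
    unfolding triangle_space_def glued_space_def openin_quotient_topology openin_sum_topology
    by (simp add: triangle_class_def)
qed

lemma topspace_triangle_space:
  "topspace (triangle_space I G) = triangle_class I G ` Sigma I (\<lambda>_. unit_triangle)"
  by (simp add: triangle_space_def glued_space_def triangle_class_def comp_def)

context triangle_group
begin

lemma locally_finite_cayley: "finite {\<sigma> \<in> cayley. v \<in> \<sigma>}"
proof (rule finite_subset)
  show "{\<sigma> \<in> cayley. v \<in> \<sigma>} \<subseteq>
      (\<Union>i\<in>I. Pow (cell v i) \<union> Pow (cell (v \<odot> inv (gen (X i))) i) \<union> Pow (cell (v \<odot> inv (gen (Z i))) i))"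
  proof
    fix \<sigma> assume "\<sigma> \<in> {\<sigma> \<in> cayley. v \<in> \<sigma>}"
    then obtain u i where u: "i \<in> I" "\<sigma> \<subseteq> cell u i" "v \<in> cell u i" by (auto simp: cayley_def)
    then have "u = v \<or> u = v \<odot> inv (gen (X i)) \<or> u = v \<odot> inv (gen (Z i))"
      by (auto simp: cell_def assoc)
    then show "\<sigma> \<in> (\<Union>i\<in>I. Pow (cell v i) \<union> Pow (cell (v \<odot> inv (gen (X i))) i)
        \<union> Pow (cell (v \<odot> inv (gen (Z i))) i))"
      using u by blast
  qed
qed (use finite_I in auto)

lemma realization_cayley: "realization cayley = top_of_set (points_of cayley)"
  by (rule realization_eq_top_of_set[OF complex_cayley locally_finite_cayley])

text \<open>The choice does not matter: by \<open>projection_eq\<close> all admissible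
  \<open>y\<close> have the same class.\<close>

definition projection :: "('v \<Rightarrow> real) \<Rightarrow> (nat \<times> complex) set" where
  "projection x = triangle_class I G (SOME y. y \<in> Sigma I (\<lambda>_. unit_triangle) \<and> x \<in> orbit y)"

lemma orbit_shift: "x \<in> orbit y \<Longrightarrow> orbit y = range (\<lambda>g. shift g x)"
proof -
  assume "x \<in> orbit y"
  then obtain v where v: "x = chart v (fst y) (snd y)" by (auto simp: orbit_def)
  have "chart u (fst y) (snd y) = shift (u \<odot> inv v) x" for u by (simp add: v shift_chart assoc)
  then show ?thesis by (auto simp: orbit_def v shift_chart)
qed

lemma projection_eq:
  assumes "y \<in> Sigma I (\<lambda>_. unit_triangle)" "x \<in> orbit y"
  shows "projection x = triangle_class I G y"
proof -
  define y' where "y' = (SOME y. y \<in> Sigma I (\<lambda>_. unit_triangle) \<and> x \<in> orbit y)"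
  have y': "y' \<in> Sigma I (\<lambda>_. unit_triangle) \<and> x \<in> orbit y'"
    unfolding y'_def by (rule someI) (use assms in blast)
  then have "orbit y' = orbit y" using orbit_shift[of x y'] orbit_shift[OF assms(2)] by simp
  then show ?thesis
    unfolding projection_def y'_def[symmetric]
    using triangle_class_eq_iff[of y' y] y' assms(1) by blast
qed

lemma projection_chart:
  "\<lbrakk>i \<in> I; z \<in> unit_triangle\<rbrakk> \<Longrightarrow> projection (chart v i z) = triangle_class I G (i, z)"
  by (rule projection_eq) (auto simp: orbit_def)

lemma projection_eq_iff:
  assumes "x \<in> points_of cayley" "y \<in> points_of cayley"
  shows "projection x = projection y \<longleftrightarrow> (\<exists>g. y = shift g x)"
proof -
  obtain v i z where x: "i \<in> I" "z \<in> unit_triangle" "chart v i z = x"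
    using points_of_cayleyE[OF assms(1)] .
  obtain v' j z' where y: "j \<in> I" "z' \<in> unit_triangle" "chart v' j z' = y"
    using points_of_cayleyE[OF assms(2)] .
  have o: "x \<in> orbit (i, z)" "y \<in> orbit (j, z')" using x y by (auto simp: orbit_def)
  have "projection x = projection y \<longleftrightarrow> orbit (i, z) = orbit (j, z')"
    using projection_chart[OF x(1,2), of v] projection_chart[OF y(1,2), of v'] x y
      triangle_class_eq_iff[of "(i, z)" "(j, z')"] by simp
  also have "\<dots> \<longleftrightarrow> y \<in> range (\<lambda>g. shift g x)"
  proof
    assume "orbit (i, z) = orbit (j, z')"
    then show "y \<in> range (\<lambda>g. shift g x)" using o orbit_shift[OF o(1)] by simp
  next
    assume "y \<in> range (\<lambda>g. shift g x)"
    then have "y \<in> orbit (i, z)" using orbit_shift[OF o(1)] by simp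
    then show "orbit (i, z) = orbit (j, z')" using orbit_shift orbit_shift[OF o(2)] by metis
  qed
  finally show ?thesis by auto
qed

lemma shift_in_points_of: "x \<in> points_of cayley \<Longrightarrow> shift g x \<in> points_of cayley"
  by (elim points_of_cayleyE) (use shift_chart chart_in_points_of in metis)

lemma projection_surj: "projection ` points_of cayley = topspace (triangle_space I G)"
proof
  show "projection ` points_of cayley \<subseteq> topspace (triangle_space I G)"
    unfolding topspace_triangle_space
    using projection_chart by (auto elim!: points_of_cayleyE)
  show "topspace (triangle_space I G) \<subseteq> projection ` points_of cayley"
  proof
    fix c assume "c \<in> topspace (triangle_space I G)"
    then obtain i z where "i \<in> I" "z \<in> unit_triangle" "c = triangle_class I G (i, z)"
      by (auto simp: topspace_triangle_space)
    then show "c \<in> projection ` points_of cayley"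
      using projection_chart[of i z one] chart_in_points_of[of i z one] by (metis imageI)
  qed
qed

lemma continuous_map_projection: "continuous_map (realization cayley) (triangle_space I G) projection"
  unfolding continuous_map_def
proof (intro conjI allI impI)
  have top: "topspace (realization cayley) = points_of cayley" by (simp add: realization_cayley)
  show "projection \<in> topspace (realization cayley) \<rightarrow> topspace (triangle_space I G)"
    unfolding top using projection_surj by blast
  fix W assume W: "openin (triangle_space I G) W"
  show "openin (realization cayley) {x \<in> topspace (realization cayley). projection x \<in> W}"
    unfolding top openin_realization points_of_def[symmetric]
  proof (intro conjI ballI)
    fix \<sigma> assume \<sigma>: "\<sigma> \<in> cayley"
    then obtain v i where i: "i \<in> I" "\<sigma> \<subseteq> cell v i" by (auto simp: cayley_def)
    \<comment> \<open>The inverse of \<open>chart v i\<close>, read off from two barycentric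
      coordinates, hence continuous on the simplex.\<close>
    define \<zeta> where "\<zeta> = (\<lambda>x. of_real (x (v \<odot> gen (X i))) + of_real (x (v \<odot> gen (Z i))) * apex)"
    have \<zeta>: "\<zeta> x \<in> unit_triangle" "projection x = triangle_class I G (i, \<zeta> x)" if "x \<in> closed_simplex \<sigma>" for x
    proof -
      have "x \<in> closed_simplex (cell v i)" using that closed_simplex_mono[OF finite_cell i(2)] by blast
      from chart_inverse[OF i(1) this] projection_chart[OF i(1), of "\<zeta> x" v]
      show "\<zeta> x \<in> unit_triangle" "projection x = triangle_class I G (i, \<zeta> x)"
        unfolding \<zeta>_def by simp_all
    qed
    obtain V where V: "open V" "{z \<in> unit_triangle. triangle_class I G (i, z) \<in> W} = unit_triangle \<inter> V"
      using W i(1) by (auto simp: openin_triangle_space openin_open)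
    have "{x \<in> points_of cayley. projection x \<in> W} \<inter> closed_simplex \<sigma> = closed_simplex \<sigma> \<inter> \<zeta> -` V"
    proof -
      have "projection x \<in> W \<longleftrightarrow> \<zeta> x \<in> V" if "x \<in> closed_simplex \<sigma>" for x
        using \<zeta>[OF that] set_eq_iff[THEN iffD1, OF V(2), rule_format, of "\<zeta> x"] by simp
      moreover have "closed_simplex \<sigma> \<subseteq> points_of cayley" using \<sigma> by (auto simp: points_of_def)
      ultimately show ?thesis by auto
    qed
    moreover have "continuous_on (closed_simplex \<sigma>) \<zeta>"
      unfolding \<zeta>_def
      by (intro continuous_on_add continuous_on_mult continuous_on_of_real continuous_on_const
          continuous_on_subset[OF coordinate_continuous]) auto
    then have "openin (top_of_set (closed_simplex \<sigma>)) (closed_simplex \<sigma> \<inter> \<zeta> -` V)"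
      using V(1) by (rule continuous_openin_preimage_gen)
    ultimately show "openin (top_of_set (closed_simplex \<sigma>))
        ({x \<in> points_of cayley. projection x \<in> W} \<inter> closed_simplex \<sigma>)" by simp
  qed auto
qed

lemma continuous_on_chart: "continuous_on S (chart v i)"
  by (rule continuous_on_coordinatewise_then_product) (unfold chart_def,
      intro continuous_on_add continuous_on_mult continuous_on_bary continuous_on_const)

text \<open>The trace of the image of \<open>U\<close> on triangle \<open>i\<close> is the union,
  over all \<open>v\<close>, of the preimages of \<open>U\<close> under
  \<open>chart v i\<close>.\<close>

lemma open_map_projection: "open_map (realization cayley) (triangle_space I G) projection"
  unfolding open_map_def realization_cayley
proof (intro allI impI)
  fix U assume U: "openin (top_of_set (points_of cayley)) U"
  then have Usub: "U \<subseteq> points_of cayley" by (rule openin_imp_subset)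
  obtain U' where U': "open U'" "U = points_of cayley \<inter> U'" using U by (auto simp: openin_open)
  show "openin (triangle_space I G) (projection ` U)"
    unfolding openin_triangle_space
  proof (intro conjI ballI)
    show "projection ` U \<subseteq> triangle_class I G ` Sigma I (\<lambda>_. unit_triangle)"
      using image_mono[OF Usub, of projection]
      unfolding projection_surj topspace_triangle_space .
    fix i assume i: "i \<in> I"
    have "triangle_class I G (i, z) \<in> projection ` U \<longleftrightarrow> (\<exists>v. chart v i z \<in> U')"
      if z: "z \<in> unit_triangle" for z
    proof
      assume "triangle_class I G (i, z) \<in> projection ` U"
      then obtain x where x: "x \<in> U" "projection (chart one i z) = projection x"
        using projection_chart[OF i z] by auto
      then obtain g where "x = shift g (chart one i z)"
        using projection_eq_iff[OF chart_in_points_of[OF i z]] Usub by blast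
      then show "\<exists>v. chart v i z \<in> U'" using x(1) U' by (auto simp: shift_chart)
    next
      assume "\<exists>v. chart v i z \<in> U'"
      then obtain v where "chart v i z \<in> U" using chart_in_points_of[OF i z] U' by blast
      then show "triangle_class I G (i, z) \<in> projection ` U"
        using projection_chart[OF i z, of v] by (metis imageI)
    qed
    then have "{z \<in> unit_triangle. triangle_class I G (i, z) \<in> projection ` U} =
        {z \<in> unit_triangle. \<exists>v. chart v i z \<in> U'}"
      by (intro Collect_cong conj_cong HOL.refl)
    also have "\<dots> = (\<Union>v. unit_triangle \<inter> chart v i -` U')" by auto
    finally have "{z \<in> unit_triangle. triangle_class I G (i, z) \<in> projection ` U} =
        (\<Union>v. unit_triangle \<inter> chart v i -` U')" .
    moreover have "openin (top_of_set unit_triangle) (unit_triangle \<inter> chart v i -` U')" for v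
      by (rule continuous_openin_preimage_gen[OF continuous_on_chart U'(1)])
    ultimately show "openin (top_of_set unit_triangle)
        {z \<in> unit_triangle. triangle_class I G (i, z) \<in> projection ` U}"
      by (metis (no_types, lifting) openin_Union rangeE)
  qed
qed

text \<open>Each coordinate in \<open>A\<close> exceeds the total mass outside \<open>A\<close>; this determines \<open>A\<close> among the
  sets of its cardinality, which makes the translates of such neighbourhoods disjoint.\<close>

definition dominated :: "'v set \<Rightarrow> ('v \<Rightarrow> real) set" where
  "dominated A = {y \<in> points_of cayley. \<forall>v\<in>A. 1 - (\<Sum>u\<in>A. y u) < y v}"

text \<open>With \<open>a\<close> in \<open>A\<close> only and \<open>b\<close> in \<open>B\<close>
  only, \<open>y b\<close> is at most the mass outside \<open>A\<close>, hence below
  \<open>y a\<close>; by symmetry \<open>y a\<close> is below \<open>y b\<close>. Equal cardinality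
  provides both \<open>a\<close> and \<open>b\<close>.\<close>

lemma dominated_unique:
  assumes "y \<in> dominated A" "y \<in> dominated B" "finite A" "finite B" "card A = card B"
  shows "A = B"
proof (rule ccontr)
  assume "A \<noteq> B"
  have "\<not> A \<subseteq> B" "\<not> B \<subseteq> A"
    using assms \<open>A \<noteq> B\<close> card_subset_eq by metis+
  then obtain a b where a: "a \<in> A" "a \<notin> B" and b: "b \<in> B" "b \<notin> A" by blast
  have y: "support y \<in> cayley" "\<And>v. 0 \<le> y v" "(\<Sum>v\<in>support y. y v) = 1"
    using assms(1) points_of_iff[OF complex_cayley] by (auto simp: dominated_def)
  have fin: "finite (support y)" using abstract_complex_finite[OF complex_cayley y(1)] .
  have total: "(\<Sum>v\<in>C. y v) + y c \<le> 1" if "finite C" "c \<notin> C" for C c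
  proof -
    have "(\<Sum>v\<in>C. y v) + y c = (\<Sum>v\<in>insert c C. y v)" using that by simp
    also have "\<dots> \<le> (\<Sum>v\<in>insert c C \<union> support y. y v)"
      using that fin y(2) by (intro sum_mono2) auto
    also have "\<dots> = (\<Sum>v\<in>support y. y v)"
      using that fin by (intro sum.mono_neutral_right) (auto simp: support_def)
    finally show ?thesis using y(3) by simp
  qed
  have "y b < y a" using total[OF assms(3) b(2)] assms(1) a(1) by (force simp: dominated_def)
  moreover have "y a < y b" using total[OF assms(4) a(2)] assms(2) b(1) by (force simp: dominated_def)
  ultimately show False by simp
qed

lemma shift_dominated_subset:
  assumes "y \<in> dominated A"
  shows "shift g y \<in> dominated ((\<odot>) g ` A)"
proof -
  have "(\<Sum>u\<in>(\<odot>) g ` A. shift g y u) = (\<Sum>u\<in>A. y u)"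
    by (subst sum.reindex) (auto simp: inj_on_def shift_def)
  then show ?thesis
    using assms shift_in_points_of by (auto simp: dominated_def shift_def)
qed

lemma shift_dominated: "shift g ` dominated A = dominated ((\<odot>) g ` A)"
proof
  show "shift g ` dominated A \<subseteq> dominated ((\<odot>) g ` A)" using shift_dominated_subset by blast
  show "dominated ((\<odot>) g ` A) \<subseteq> shift g ` dominated A"
  proof
    fix y assume "y \<in> dominated ((\<odot>) g ` A)"
    from shift_dominated_subset[OF this, of "inv g"] have "shift (inv g) y \<in> dominated A"
      by (simp add: image_image)
    then show "y \<in> shift g ` dominated A" by (intro image_eqI[of _ _ "shift (inv g) y"]) auto
  qed
qed

lemma openin_dominated:
  assumes "finite A"
  shows "openin (realization cayley) (dominated A)"
proof -
  have cont: "continuous_on UNIV (\<lambda>y :: 'v \<Rightarrow> real. sum y A)"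
    using continuous_on_sum[of A UNIV "\<lambda>u y. y u"] coordinate_continuous by simp
  have "open {y :: 'v \<Rightarrow> real. 1 - (\<Sum>u\<in>A. y u) < y v}" for v
    by (intro open_Collect_less continuous_on_diff continuous_on_const coordinate_continuous cont)
  then have op: "open (\<Inter>v\<in>A. {y :: 'v \<Rightarrow> real. 1 - (\<Sum>u\<in>A. y u) < y v})" using assms by (intro open_INT) auto
  have eq: "dominated A = points_of cayley \<inter> (\<Inter>v\<in>A. {y. 1 - (\<Sum>u\<in>A. y u) < y v})"
    by (auto simp: dominated_def)
  show ?thesis unfolding realization_cayley eq using op by (rule openin_open_Int)
qed

text \<open>A translation permuting the vertices of a simplex preserves the sum of their heights,
  hence preserves heights, which distinguish the vertices.\<close>

lemma stabilizer_trivial: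
  assumes "\<sigma> \<in> cayley" "(\<odot>) g ` \<sigma> = \<sigma>"
  shows "g = one"
proof -
  have fin: "finite \<sigma>" "\<sigma> \<noteq> {}" using complex_cayley assms(1) unfolding abstract_complex_def by blast+
  have "(\<Sum>v\<in>\<sigma>. height v) = (\<Sum>v\<in>(\<odot>) g ` \<sigma>. height v)" using assms(2) by simp
  also have "\<dots> = (\<Sum>v\<in>\<sigma>. height (g \<odot> v))" by (subst sum.reindex) (auto simp: inj_on_def)
  also have "\<dots> = int (card \<sigma>) * height g + (\<Sum>v\<in>\<sigma>. height v)"
    by (simp add: height_mul sum.distrib)
  finally have "height g = 0" using fin by simp
  obtain v where v: "v \<in> \<sigma>" using fin by blast
  then have "g \<odot> v \<in> \<sigma>" using assms(2) by blast
  moreover have "height (g \<odot> v) = height v" using \<open>height g = 0\<close> by (simp add: height_mul)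
  ultimately have "g \<odot> v = one \<odot> v" using inj_onD[OF height_inj_cayley[OF assms(1)]] v by simp
  then show ?thesis by (simp only: cancel_eq)
qed

lemma shift_cayley: "\<sigma> \<in> cayley \<Longrightarrow> (\<odot>) g ` \<sigma> \<in> cayley"
  unfolding cayley_def using cell_shift by blast

text \<open>The evenly covered neighbourhood is the image of \<open>dominated (support x)\<close>;
  its sheets are the translates. \<open>dominated_unique\<close> makes distinct sheets disjoint, and
  \<open>stabilizer_trivial\<close> makes the map injective on each.\<close>

lemma covering_map_projection: "covering_map (realization cayley) (triangle_space I G) projection"
  unfolding covering_map_def
proof (intro conjI ballI)
  have top: "topspace (realization cayley) = points_of cayley" by (simp add: realization_cayley)
  show "continuous_map (realization cayley) (triangle_space I G) projection"
    by (rule continuous_map_projection)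
  show "projection ` topspace (realization cayley) = topspace (triangle_space I G)"
    unfolding top by (rule projection_surj)
  fix c assume "c \<in> topspace (triangle_space I G)"
  then obtain x where x: "x \<in> points_of cayley" "c = projection x"
    using projection_surj by blast
  define \<sigma> where "\<sigma> = support x"
  have \<sigma>: "\<sigma> \<in> cayley" "finite \<sigma>"
    using x(1) points_of_iff[OF complex_cayley] abstract_complex_finite[OF complex_cayley]
    by (auto simp: \<sigma>_def)
  have sub: "dominated A \<subseteq> points_of cayley" for A by (auto simp: dominated_def)
  let ?T = "projection ` dominated \<sigma>"
  let ?\<U> = "range (\<lambda>g. dominated ((\<odot>) g ` \<sigma>))"
  have image: "projection ` dominated ((\<odot>) g ` \<sigma>) = ?T" for g
  proof -
    have "projection (shift g y) = projection y" if "y \<in> dominated \<sigma>" for y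
      using projection_eq_iff[of y "shift g y"] shift_in_points_of that sub by blast
    then show ?thesis unfolding shift_dominated[symmetric] image_image by (rule image_cong[OF refl])
  qed
  have openT: "openin (triangle_space I G) ?T"
    using open_map_projection openin_dominated[OF \<sigma>(2)] unfolding open_map_def by blast
  have "x \<in> dominated \<sigma>"
    using x(1) points_of_iff[OF complex_cayley, of x]
    by (auto simp: dominated_def \<sigma>_def support_def less_le)
  show "\<exists>T. c \<in> T \<and> openin (triangle_space I G) T \<and>
      (\<exists>\<U>. \<Union>\<U> = {y \<in> topspace (realization cayley). projection y \<in> T} \<and>
        (\<forall>U\<in>\<U>. openin (realization cayley) U) \<and> pairwise disjnt \<U> \<and>
        (\<forall>U\<in>\<U>. homeomorphic_map (subtopology (realization cayley) U)
          (subtopology (triangle_space I G) T) projection))"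
  proof (intro exI conjI)
    show "c \<in> ?T" using x(2) \<open>x \<in> dominated \<sigma>\<close> by blast
    show "openin (triangle_space I G) ?T" by (rule openT)
    show "\<Union>?\<U> = {y \<in> topspace (realization cayley). projection y \<in> ?T}"
    proof
      show "\<Union>?\<U> \<subseteq> {y \<in> topspace (realization cayley). projection y \<in> ?T}"
        unfolding top using image sub by blast
      show "{y \<in> topspace (realization cayley). projection y \<in> ?T} \<subseteq> \<Union>?\<U>"
      proof
        fix y assume "y \<in> {y \<in> topspace (realization cayley). projection y \<in> ?T}"
        then obtain y' where y': "y \<in> points_of cayley" "y' \<in> dominated \<sigma>" "projection y' = projection y"
          unfolding top by force
        then obtain g where "y = shift g y'" using projection_eq_iff[of y' y] sub by blast
        then have "y \<in> dominated ((\<odot>) g ` \<sigma>)" using y'(2) shift_dominated_subset by simp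
        then show "y \<in> \<Union>?\<U>" by blast
      qed
    qed
    show "\<forall>U\<in>?\<U>. openin (realization cayley) U"
      using openin_dominated \<sigma>(2) by auto
    have card: "card ((\<odot>) g ` \<sigma>) = card \<sigma>" for g by (rule card_image) (auto simp: inj_on_def)
    show "pairwise disjnt ?\<U>"
    proof (rule pairwiseI)
      fix U V assume "U \<in> ?\<U>" "V \<in> ?\<U>" "U \<noteq> V"
      then obtain g h where "U = dominated ((\<odot>) g ` \<sigma>)" "V = dominated ((\<odot>) h ` \<sigma>)" by blast
      moreover from this have "(\<odot>) g ` \<sigma> \<noteq> (\<odot>) h ` \<sigma>" using \<open>U \<noteq> V\<close> by metis
      ultimately show "disjnt U V"
        using dominated_unique[of _ "(\<odot>) g ` \<sigma>" "(\<odot>) h ` \<sigma>"] card \<sigma>(2)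
        unfolding disjnt_iff by (metis finite_imageI)
    qed
    show "\<forall>U\<in>?\<U>. homeomorphic_map (subtopology (realization cayley) U)
          (subtopology (triangle_space I G) ?T) projection"
    proof
      fix U assume "U \<in> ?\<U>"
      then obtain g where U: "U = dominated ((\<odot>) g ` \<sigma>)" by blast
      have oU: "openin (realization cayley) U" unfolding U by (rule openin_dominated) (simp add: \<sigma>)
      have topU: "topspace (subtopology (realization cayley) U) = U"
        unfolding topspace_subtopology top U using sub by blast
      have topT: "topspace (subtopology (triangle_space I G) ?T) = ?T"
        using openin_subset[OF openT] by auto
      show "homeomorphic_map (subtopology (realization cayley) U)
          (subtopology (triangle_space I G) ?T) projection"
      proof (rule bijective_open_imp_homeomorphic_map)
        show "continuous_map (subtopology (realization cayley) U) (subtopology (triangle_space I G) ?T) projection"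
          using continuous_map_projection image[of g] topU
          by (auto simp: continuous_map_in_subtopology continuous_map_from_subtopology U)
        show "open_map (subtopology (realization cayley) U) (subtopology (triangle_space I G) ?T) projection"
          unfolding open_map_def
        proof (intro allI impI)
          fix V assume V: "openin (subtopology (realization cayley) U) V"
          then have "V \<subseteq> U" "openin (realization cayley) V"
            using oU openin_trans_full openin_imp_subset by blast+
          then have "openin (triangle_space I G) (projection ` V)" "projection ` V \<subseteq> ?T"
            using open_map_projection image[of g] U unfolding open_map_def by blast+
          then show "openin (subtopology (triangle_space I G) ?T) (projection ` V)"
            by (simp add: openin_subset_topspace_eq openT openin_open_subtopology)
        qed
        show "projection ` topspace (subtopology (realization cayley) U) =
            topspace (subtopology (triangle_space I G) ?T)"
          unfolding topU topT unfolding U by (rule image)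
        show "inj_on projection (topspace (subtopology (realization cayley) U))"
          unfolding topU
        proof (rule inj_onI)
          fix y y' assume y: "y \<in> U" "y' \<in> U" "projection y = projection y'"
          then obtain h where h: "y' = shift h y"
            using projection_eq_iff[of y y'] sub U by blast
          then have "y' \<in> dominated ((\<odot>) h ` (\<odot>) g ` \<sigma>)"
            using shift_dominated_subset y(1) U by simp
          then have "(\<odot>) h ` (\<odot>) g ` \<sigma> = (\<odot>) g ` \<sigma>"
            using y(2) unfolding U
            by (rule dominated_unique) (auto simp: \<sigma> card_image inj_on_def)
          then have "h = one" by (rule stabilizer_trivial[OF shift_cayley[OF \<sigma>(1)]])
          then show "y = y'" using h by simp
        qed
      qed
    qed
  qed
qed

end

text \<open>The corner graph on edge ends: \<open>(s, True)\<close> is the end leaving the vertex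
  along \<open>s\<close>, \<open>(s, False)\<close> the end arriving. The three pairs are the
  corners of triangle \<open>i\<close> at 0, 1 and \<open>apex\<close>.\<close>

definition link_edge :: "nat set \<Rightarrow> (nat \<Rightarrow> 's) \<Rightarrow> (nat \<Rightarrow> 's) \<Rightarrow> (nat \<Rightarrow> 's) \<Rightarrow> 's \<times> bool \<Rightarrow> 's \<times> bool \<Rightarrow> bool" where
  "link_edge I X Y Z a b \<longleftrightarrow> (\<exists>i\<in>I. {a, b} \<in> {{(X i, True), (Z i, True)},
     {(X i, False), (Y i, True)}, {(Z i, False), (Y i, False)}})"

context triangle_group
begin

section \<open>Words, vertex links and walks in the Cayley complex\<close>

definition letter :: "'s \<times> bool \<Rightarrow> 'v" where
  "letter l = (if snd l then gen (fst l) else inv (gen (fst l)))"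

lemma letter_simps [simp]: "letter (s, True) = gen s" "letter (s, False) = inv (gen s)"
  by (simp_all add: letter_def)

primrec eval :: "('s \<times> bool) list \<Rightarrow> 'v" where
  "eval [] = one"
| "eval (l # w) = letter l \<odot> eval w"

lemma eval_append: "eval (u @ w) = eval u \<odot> eval w"
  by (induction u) (simp_all add: assoc)

lemma letter_cancel: "letter (s, b) \<odot> letter (s, \<not> b) = one"
  by (cases b) simp_all

lemma eval_word_eq: "word_eq I X Y Z u w \<Longrightarrow> eval u = eval w"
proof (induction rule: word_eq.induct)
  case (word_cancel u s b w)
  then show ?case using letter_cancel[of s b] by (simp add: eval_append flip: assoc)
next
  case (word_relator i u w)
  then show ?case using relation[of i] by (simp add: eval_append flip: assoc)
qed simp_all

lemma height_inv: "height (inv u) = - height u"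
proof -
  have "height one = 0" using height_mul[of one one] by simp
  then show ?thesis using height_mul[of u "inv u"] by simp
qed

text \<open>The sign of the height separates generators from inverses; among generators
  \<open>inj_gen\<close> decides.\<close>

lemma inj_letter: "inj letter"
proof (rule injI)
  fix a b :: "'s \<times> bool" assume eq: "letter a = letter b"
  have h: "0 < height (letter l) \<longleftrightarrow> snd l" for l
    using height_gen[of "fst l"] by (simp add: letter_def height_inv)
  have "snd a = snd b" using h[of a] h[of b] eq by simp
  moreover from this have "gen (fst a) = gen (fst b)"
    using eq by (auto simp: letter_def split: if_splits) (metis inverse_inverse)
  then have "fst a = fst b" by (rule injD[OF inj_gen])
  ultimately show "a = b" by (simp add: prod_eq_iff)
qed

lemma relation_solved:
  assumes "i \<in> I"
  shows "gen (Z i) \<odot> inv (gen (Y i)) = gen (X i)" "inv (gen (X i)) \<odot> gen (Z i) = gen (Y i)"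
    "inv (gen (Z i)) \<odot> gen (X i) = inv (gen (Y i))"
  using relation[OF assms, symmetric] by (simp_all add: assoc inverse_distrib_swap)

lemma cell_edge:
  assumes "i \<in> I" "a \<in> cell v i" "b \<in> cell v i" "a \<noteq> b"
  obtains l where "b = a \<odot> letter l"
proof -
  have y: "v \<odot> gen (Z i) = v \<odot> gen (X i) \<odot> gen (Y i)" using relation[OF assms(1)] by (simp add: assoc)
  have "b = a \<odot> letter (X i, True) \<or> b = a \<odot> letter (X i, False) \<or> b = a \<odot> letter (Y i, True)
      \<or> b = a \<odot> letter (Y i, False) \<or> b = a \<odot> letter (Z i, True) \<or> b = a \<odot> letter (Z i, False)"
    using assms(2-4) y unfolding cell_def by (auto simp: assoc relation_solved[OF assms(1)])
  then show ?thesis using that by blast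
qed

lemma edge_letter:
  assumes "{a, b} \<in> cayley" "a \<noteq> b"
  obtains l where "b = a \<odot> letter l"
  using assms cell_edge unfolding cayley_def by blast

lemma letter_edge: "{a, a \<odot> letter l} \<in> cayley"
proof -
  obtain s b where l: "l = (s, b)" by (cases l)
  \<comment> \<open>\<open>v\<close> is the tail of the edge, so that both signs of the letter are
    treated at once.\<close>
  define v where "v = (if b then a else a \<odot> inv (gen s))"
  have v: "{a, a \<odot> letter l} = {v, v \<odot> gen s}" by (cases b) (auto simp: v_def l assoc)
  obtain i where i: "i \<in> I" "s = X i \<or> s = Y i \<or> s = Z i" using label_used by blast
  have "\<exists>u. {v, v \<odot> gen s} \<subseteq> cell u i"
  proof (cases "s = Y i")
    case True
    have "{v, v \<odot> gen s} \<subseteq> cell (v \<odot> inv (gen (X i))) i"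
      using relation_solved(2)[OF i(1)] True by (simp add: cell_def assoc)
    then show ?thesis ..
  next
    case False
    then show ?thesis using i(2) by (intro exI[of _ v]) (auto simp: cell_def)
  qed
  then show ?thesis using i(1) unfolding v cayley_def by blast
qed

text \<open>A triangle at \<open>v\<close> is a cell in which \<open>v\<close> is one of the three
  corners; these three cases give the three kinds of pairs in \<open>link_edge\<close>.\<close>

lemma link_adjacent_cayley:
  assumes "link_adjacent cayley v a b"
  obtains l m where "a = v \<odot> letter l" "b = v \<odot> letter m" "link_edge I X Y Z l m"
proof -
  have ne: "a \<noteq> v" "b \<noteq> v" "a \<noteq> b" using assms by (auto simp: link_adjacent_def)
  obtain u i where i: "i \<in> I" "{v, a, b} \<subseteq> cell u i"
    using assms by (auto simp: link_adjacent_def cayley_def)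
  have "card {v, a, b} = 3" using ne by auto
  then have eq: "{v, a, b} = cell u i" using i card_subset_eq[OF finite_cell] card_cell by metis
  then have "v \<in> cell u i" by blast
  then consider "u = v" | "u = v \<odot> inv (gen (X i))" | "u = v \<odot> inv (gen (Z i))"
    by (auto simp: cell_def assoc)
  then have "\<exists>l m. {a, b} = {v \<odot> letter l, v \<odot> letter m} \<and> link_edge I X Y Z l m"
  proof cases
    case 1
    then have "{a, b} = {v \<odot> letter (X i, True), v \<odot> letter (Z i, True)}"
      using eq ne cell_distinct[OF i(1), of v] by (auto simp: cell_def)
    then show ?thesis using i(1) unfolding link_edge_def by blast
  next
    case 2
    then have "cell u i = {v, v \<odot> inv (gen (X i)), v \<odot> gen (Y i)}"
      using relation_solved(2)[OF i(1)] by (auto simp: cell_def assoc)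
    then have "{a, b} = {v \<odot> letter (X i, False), v \<odot> letter (Y i, True)}"
      using eq ne \<open>card {v, a, b} = 3\<close> by (auto split: if_splits)
    then show ?thesis using i(1) unfolding link_edge_def by blast
  next
    case 3
    then have "cell u i = {v, v \<odot> inv (gen (Z i)), v \<odot> inv (gen (Y i))}"
      using relation_solved(3)[OF i(1)] by (auto simp: cell_def assoc)
    then have "{a, b} = {v \<odot> letter (Z i, False), v \<odot> letter (Y i, False)}"
      using eq ne \<open>card {v, a, b} = 3\<close> by (auto split: if_splits)
    then show ?thesis using i(1) unfolding link_edge_def by blast
  qed
  then obtain l m where lm: "{a, b} = {v \<odot> letter l, v \<odot> letter m}" "link_edge I X Y Z l m" by blast
  moreover have "link_edge I X Y Z m l" using lm(2) by (simp add: link_edge_def insert_commute)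
  ultimately show ?thesis using that by (metis doubleton_eq_iff)
qed

primrec walk :: "'v \<Rightarrow> ('s \<times> bool) list \<Rightarrow> 'v list" where
  "walk v [] = [v]"
| "walk v (l # w) = v # walk (v \<odot> letter l) w"

lemma walk_Cons: "\<exists>bs. walk v w = v # bs"
  by (cases w) simp_all

lemma hd_walk: "hd (walk v w) = v"
  by (cases w) simp_all

lemma last_walk: "last (walk v w) = v \<odot> eval w"
proof (induction w arbitrary: v)
  case (Cons l w)
  have "walk (v \<odot> letter l) w \<noteq> []" by (cases w) simp_all
  then show ?case using Cons by (simp add: assoc)
qed simp

lemma walk_append: "walk v (u @ w) = butlast (walk v u) @ walk (v \<odot> eval u) w"
proof (induction u arbitrary: v)
  case (Cons l u)
  have "walk (v \<odot> letter l) u \<noteq> []" by (cases u) simp_all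
  then show ?case using Cons by (simp add: assoc)
qed simp

lemma vertex_in_cayley: "{v} \<in> cayley"
proof -
  have "{v, v \<odot> letter l} \<in> cayley" for l by (rule letter_edge)
  then show ?thesis using abstract_complex_face[OF complex_cayley] by blast
qed

sublocale cayley: locally_finite_complex cayley
  by unfold_locales (rule complex_cayley, rule locally_finite_cayley)

lemma edge_path_walk: "edge_path cayley (walk v w)"
proof -
  have "successively (\<lambda>a b. {a, b} \<in> cayley) (walk v w)"
  proof (induction w arbitrary: v)
    case (Cons l w)
    then show ?case using letter_edge[of v l] by (cases w) simp_all
  qed simp
  moreover have "walk v w \<noteq> []" by (cases w) simp_all
  moreover have "v \<in> \<Union>cayley" for v using vertex_in_cayley by blast
  ultimately show ?thesis unfolding edge_path_def by blast
qed

lemma edge_path_is_walk: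
  assumes "edge_path cayley vs" "distinct_adj vs"
  shows "\<exists>w. vs = walk (hd vs) w"
  using assms
proof (induction vs)
  case (Cons a vs)
  show ?case
  proof (cases vs)
    case Nil
    then have "a # vs = walk (hd (a # vs)) []" by simp
    then show ?thesis ..
  next
    case (Cons b bs)
    then have e: "{a, b} \<in> cayley" "a \<noteq> b" "edge_path cayley vs" "distinct_adj vs"
      using Cons.prems by (auto simp: edge_path_def distinct_adj_def)
    obtain w where "vs = walk (hd vs) w" using Cons.IH e by blast
    moreover obtain l where "b = a \<odot> letter l" using edge_letter e by blast
    ultimately have "a # vs = walk (hd (a # vs)) (l # w)" using Cons by simp
    then show ?thesis ..
  qed
qed (simp add: edge_path_def)

text \<open>A cancellation removes a backtrack and a relator pushes the walk across one triangle.
  \<open>eval u = one\<close> makes the walk closed, and \<open>eval\<close> is invariant, so all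
  intermediate walks are closed too.\<close>

lemma walk_homotopic:
  assumes "word_eq I X Y Z u w" "eval u = one"
  shows "homotopic_loops (points_of cayley) (edge_loop (walk v u)) (edge_loop (walk v w))"
  using assms
proof (induction rule: word_eq.induct)
  case (word_refl w)
  then show ?case by (intro cayley.edge_loop_refl edge_path_walk) (simp add: hd_walk last_walk)
next
  case (word_sym u w)
  then show ?case using eval_word_eq homotopic_loops_sym by simp
next
  case (word_trans u w w')
  then show ?case using eval_word_eq homotopic_loops_trans by metis
next
  case (word_cancel u s b w)
  let ?p = "v \<odot> eval u" and ?as = "butlast (walk v u)"
  have bt: "?p \<odot> letter (s, b) \<odot> letter (s, \<not> b) = ?p" by (simp add: assoc letter_cancel)
  obtain bs where bs: "walk ?p w = ?p # bs" using walk_Cons by blast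
  have t1: "walk v (u @ (s, b) # (s, \<not> b) # w) = ?as @ ?p # (?p \<odot> letter (s, b)) # ?p # bs"
    by (simp add: walk_append bt bs)
  have t2: "walk v (u @ w) = ?as @ ?p # bs" by (simp add: walk_append bs)
  show ?case
    using cayley.edge_loop_backtrack[of ?as ?p "?p \<odot> letter (s, b)" bs]
      edge_path_walk[of v "u @ (s, b) # (s, \<not> b) # w"]
      hd_walk[of v "u @ (s, b) # (s, \<not> b) # w"] last_walk[of v "u @ (s, b) # (s, \<not> b) # w"]
      word_cancel
    unfolding t1 t2 by simp
next
  case (word_relator i u w)
  let ?p = "v \<odot> eval u" and ?as = "butlast (walk v u)"
  let ?q = "?p \<odot> gen (X i)" and ?r = "?p \<odot> gen (Z i)"
  have r: "?q \<odot> gen (Y i) = ?r" using relation[OF word_relator(1)] by (simp add: assoc)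
  obtain bs where bs: "walk ?r w = ?r # bs" using walk_Cons by blast
  have t1: "walk v (u @ (X i, True) # (Y i, True) # w) = ?as @ ?p # ?q # ?r # bs"
    using r bs by (simp add: walk_append)
  have t2: "walk v (u @ (Z i, True) # w) = ?as @ ?p # ?r # bs" by (simp add: walk_append bs)
  have "{?p, ?q, ?r} \<in> cayley" using cell_in_cayley[OF word_relator(1), of ?p] by (simp add: cell_def)
  then show ?case
    using cayley.edge_loop_triangle[of ?as ?p ?q ?r bs]
      edge_path_walk[of v "u @ (X i, True) # (Y i, True) # w"]
      hd_walk[of v "u @ (X i, True) # (Y i, True) # w"]
      last_walk[of v "u @ (X i, True) # (Y i, True) # w"] word_relator(2)
    unfolding t1 t2 by simp
qed

end

text \<open>These assumptions make the covering universal: the first says that the relations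
  suffice, the second that the generators generate.\<close>

locale presented_triangle_group = triangle_group +
  assumes presented: "eval w = one \<Longrightarrow> word_eq I X Y Z w []"
    and generated: "\<exists>w. eval w = v"
begin

text \<open>Links the constant loops at different vertices, one edge per letter, as free homotopy to
  a single constant loop requires.\<close>

lemma constant_loops_homotopic:
  "homotopic_loops (points_of cayley) (edge_loop [v]) (edge_loop [v \<odot> eval w])"
proof (induction w arbitrary: v)
  case Nil
  show ?case using cayley.edge_loop_refl[OF edge_path_walk[of v "[]"]] by simp
next
  case (Cons l w)
  have "homotopic_loops (points_of cayley) (edge_loop [v]) (edge_loop [v \<odot> letter l])"
  proof (rule contiguous_loops_homotopic)
    fix t :: real
    show "\<exists>\<sigma>\<in>cayley. edge_loop [v] t \<in> closed_simplex \<sigma> \<and> edge_loop [v \<odot> letter l] t \<in> closed_simplex \<sigma>"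
      by (rule bexI[OF _ letter_edge[of v l]])
        (auto simp: cayley.edge_loop_single intro!: vertex_point_in_closed_simplex)
  qed (rule cayley.path_edge_loop, rule cayley.path_edge_loop, simp_all add: cayley.edge_loop_single)
  then show ?case using homotopic_loops_trans[OF _ Cons[of "v \<odot> letter l"]] by (simp add: assoc)
qed

lemma simply_connected_cayley: "simply_connected_space (realization cayley)"
proof (rule cayley.simply_connected_spaceI)
  fix vs assume vs: "edge_path cayley vs" "hd vs = last vs" "distinct_adj vs"
  obtain w where w: "vs = walk (hd vs) w" using edge_path_is_walk vs by blast
  have "hd vs \<odot> eval w = hd vs \<odot> one"
    using last_walk[of "hd vs" w] vs(2) w by simp
  then have e: "eval w = one" by (simp only: cancel_eq)
  have "homotopic_loops (points_of cayley) (edge_loop (walk (hd vs) w)) (edge_loop (walk (hd vs) []))"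
    by (rule walk_homotopic[OF presented[OF e] e])
  moreover obtain u where "eval u = inv (hd vs)" using generated by blast
  then have "homotopic_loops (points_of cayley) (edge_loop [hd vs]) (edge_loop [one])"
    using constant_loops_homotopic[of "hd vs" u] by simp
  ultimately show "homotopic_loops (points_of cayley) (edge_loop vs) (edge_loop [one])"
    using w homotopic_loops_trans by simp
qed

text \<open>Constant loops at any two points are homotopic, and the track of the parameter 0 under
  the homotopy is a path between the points.\<close>

lemma connected_cayley: "connected_space (realization cayley)"
proof -
  have "path_connected_space (realization cayley)"
    unfolding path_connected_space_def
  proof (intro ballI)
    fix x y assume xy: "x \<in> topspace (realization cayley)" "y \<in> topspace (realization cayley)"
    then have "loop_in (realization cayley) (\<lambda>_. x)" "loop_in (realization cayley) (\<lambda>_. y)"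
      by (auto simp: loop_in_def pathin_def)
    then have "homotopic_with (\<lambda>r. r 1 = r 0) (top_of_set {0..1::real}) (realization cayley) (\<lambda>_. x) (\<lambda>_. y)"
      by (rule simply_connected_cayley[unfolded simply_connected_space_def, rule_format, OF conjI])
    then obtain h where h: "continuous_map (prod_topology (top_of_set {0..1::real}) (top_of_set {0..1::real}))
        (realization cayley) h" "\<And>t. h (0, t) = x" "\<And>t. h (1, t) = y"
      unfolding homotopic_with_def by blast
    have "continuous_map (top_of_set {0..1::real}) (prod_topology (top_of_set {0..1::real}) (top_of_set {0..1::real}))
        (\<lambda>t :: real. (t, 0 :: real))"
      by (simp add: continuous_on_Pair continuous_on_id)
    from continuous_map_compose[OF this h(1)]
    have "pathin (realization cayley) (h \<circ> (\<lambda>t. (t, 0)))" by (simp add: pathin_def)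
    then show "\<exists>g. pathin (realization cayley) g \<and> g 0 = x \<and> g 1 = y"
      using h(2,3) by (intro exI[of _ "h \<circ> (\<lambda>t. (t, 0))"]) simp
  qed
  then show ?thesis by (rule path_connected_imp_connected_space)
qed

lemma universal_cover_cayley: "universal_cover_complex I G cayley projection"
  unfolding universal_cover_complex_def universal_covering_map_def
proof (intro conjI ballI impI)
  show "abstract_complex cayley" by (rule complex_cayley)
  show "covering_map (realization cayley) (triangle_space I G) projection"
    by (rule covering_map_projection)
  show "simply_connected_space (realization cayley)" by (rule simply_connected_cayley)
next
  fix \<sigma> assume "\<sigma> \<in> cayley"
  then show "\<exists>\<tau>\<in>cayley. \<sigma> \<subseteq> \<tau> \<and> card \<tau> = 3"
    using cell_in_cayley card_cell unfolding cayley_def by blast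
next
  fix \<tau> assume \<tau>: "\<tau> \<in> cayley" "card \<tau> = 3"
  then obtain v i where i: "i \<in> I" "\<tau> \<subseteq> cell v i" by (auto simp: cayley_def)
  then have eq: "\<tau> = cell v i" using \<tau>(2) card_subset_eq[OF finite_cell] card_cell by metis
  note d = cell_distinct[OF i(1), of v]
  define \<phi> where "\<phi> = (\<lambda>u. if u = v then 0 else if u = v \<odot> gen (X i) then 1 else apex)"
  have "bij_betw \<phi> \<tau> triangle_corners"
    unfolding bij_betw_def inj_on_def eq cell_def \<phi>_def triangle_corners_def using d by auto
  moreover have "projection x = triangle_class I G (i, \<Sum>u\<in>\<tau>. x u *\<^sub>R \<phi> u)"
    if "x \<in> closed_simplex \<tau>" for x
  proof -
    have "(\<Sum>u\<in>\<tau>. x u *\<^sub>R \<phi> u) = of_real (x (v \<odot> gen (X i))) + of_real (x (v \<odot> gen (Z i))) * apex"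
      using d by (simp add: eq cell_def \<phi>_def scaleR_conv_of_real)
    then show ?thesis
      using chart_inverse[OF i(1), of x v] that projection_chart[OF i(1)] eq by metis
  qed
  ultimately show "\<exists>i\<in>I. \<exists>\<phi>. bij_betw \<phi> \<tau> triangle_corners \<and>
      (\<forall>x\<in>closed_simplex \<tau>. projection x = triangle_class I G (i, \<Sum>u\<in>\<tau>. x u *\<^sub>R \<phi> u))"
    using i(1) by blast
qed

lemma systolic_cayley:
  assumes colour: "\<And>a b. link_edge I X Y Z a b \<Longrightarrow> colour a \<noteq> (colour b :: bool)"
    and square: "\<And>a b c d. \<lbrakk>link_edge I X Y Z a b; link_edge I X Y Z b c; link_edge I X Y Z c d;
      link_edge I X Y Z d a\<rbrakk> \<Longrightarrow> a = c \<or> b = d"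
  shows "systolic cayley"
proof -
  \<comment> \<open>The letter leading from \<open>v\<close> to its neighbour \<open>a\<close>, well
    defined by injectivity of \<open>letter\<close>; it pulls the colouring of edge ends back to the
    link of \<open>v\<close>.\<close>
  define lab where "lab = (\<lambda>v a. the_inv letter (inv v \<odot> a))"
  have lab: "link_edge I X Y Z (lab v a) (lab v b)" "a = v \<odot> letter (lab v a)" "b = v \<odot> letter (lab v b)"
    if "link_adjacent cayley v a b" for v a b
    using that by (elim link_adjacent_cayley; simp add: lab_def the_inv_f_f[OF inj_letter])+
  interpret bipartite_links cayley "\<lambda>v a. colour (lab v a)"
  proof
    show "a = c \<or> b = d" if "link_adjacent cayley v a b" "link_adjacent cayley v b c"
      "link_adjacent cayley v c d" "link_adjacent cayley v d a" for v a b c d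
    proof -
      have "lab v a = lab v c \<or> lab v b = lab v d"
        using square lab(1) that by blast
      then show ?thesis using lab(2)[OF that(1)] lab(2)[OF that(3)] lab(2)[OF that(2)] lab(2)[OF that(4)] by metis
    qed
  qed (use complex_cayley locally_finite_cayley colour lab in auto)
  show ?thesis
    unfolding systolic_def k_systolic_def
    using complex_cayley connected_cayley simply_connected_cayley locally_large_6 by blast
qed

end


section \<open>The group of a triangular presentation\<close>

lemma word_eq_append:
  "word_eq I X Y Z u w \<Longrightarrow> word_eq I X Y Z (a @ u @ b) (a @ w @ b)"
proof (induction rule: word_eq.induct)
  case (word_cancel u s c w)
  then show ?case using word_eq.word_cancel[of I X Y Z "a @ u" s c "w @ b"] by simp
next
  case (word_relator i u w)
  then show ?case using word_eq.word_relator[of i I X Y Z "a @ u" "w @ b"] by simp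
qed (auto intro: word_eq.word_refl word_eq.word_sym word_eq.word_trans)

lemma word_eq_append2:
  assumes "word_eq I X Y Z u u'" "word_eq I X Y Z w w'"
  shows "word_eq I X Y Z (u @ w) (u' @ w')"
  using word_eq_append[OF assms(1), of "[]" w] word_eq_append[OF assms(2), of u' "[]"]
  by (auto intro: word_eq.word_trans)

definition word_inverse :: "('s \<times> bool) list \<Rightarrow> ('s \<times> bool) list" where
  "word_inverse w = rev (map (\<lambda>(s, b). (s, \<not> b)) w)"

lemma word_inverse_cancel: "word_eq I X Y Z (word_inverse w @ w) []"
proof (induction w)
  case (Cons l w)
  obtain s b where l: "l = (s, b)" by (cases l)
  have "word_eq I X Y Z (word_inverse (l # w) @ l # w) (word_inverse w @ w)"
    using word_eq.word_cancel[of I X Y Z "word_inverse w" s "\<not> b" w] by (simp add: word_inverse_def l)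
  then show ?case using Cons by (rule word_eq.word_trans)
qed (simp add: word_inverse_def word_eq.word_refl)

text \<open>A way to prove words inequivalent: it suffices that they act differently on one
  point.\<close>

lemma word_eq_action:
  assumes "word_eq I X Y Z u w"
    and "\<And>s b x. act (s, b) (act (s, \<not> b) x) = x"
    and "\<And>i x. i \<in> I \<Longrightarrow> act (X i, True) (act (Y i, True) x) = act (Z i, True) x"
  shows "foldr act u x = foldr act w x"
  using assms(1) by (induction arbitrary: x rule: word_eq.induct) (simp_all add: assms(2,3))

text \<open>The group consists of the words modulo \<open>word_eq\<close>, renumbered by natural
  numbers to serve as vertices in \<open>nat\<close>. \<open>weight\<close> provides the height, and
  the action keeps the generators distinct.\<close>

lemma presented_triangle_group_exists:
  fixes X Y Z :: "nat \<Rightarrow> 's::countable" and weight :: "'s \<Rightarrow> int"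
  assumes fin: "finite I" and weight: "\<And>s. 0 < weight s"
    "\<And>i. i \<in> I \<Longrightarrow> weight (X i) + weight (Y i) = weight (Z i)"
    and act: "\<And>s b x. act (s, b) (act (s, \<not> b) x) = x"
    "\<And>i x. i \<in> I \<Longrightarrow> act (X i, True) (act (Y i, True) x) = act (Z i, True) x"
    and faithful: "inj (\<lambda>s. act (s, True) x0)"
    and distinct: "\<And>i j. \<lbrakk>i \<in> I; j \<in> I; X i = X j; Z i = Z j\<rbrakk> \<Longrightarrow> i = j"
    and used: "\<And>s. \<exists>i\<in>I. s = X i \<or> s = Y i \<or> s = Z i"
    and one_vertex: "\<And>i j a b. \<lbrakk>i \<in> I; j \<in> I; a \<in> triangle_corners; b \<in> triangle_corners\<rbrakk> \<Longrightarrow>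
      ((i, a), (j, b)) \<in> (glue_step (presentation_gluing I X Y Z))\<^sup>*"
  obtains mul :: "nat \<Rightarrow> nat \<Rightarrow> nat" and one inv gen height
  where "presented_triangle_group mul one inv I X Y Z gen height"
proof -
  let ?eq = "word_eq I X Y Z"
  define wt where "wt = (\<lambda>w. \<Sum>l\<leftarrow>w. if snd l then weight (fst l) else - weight (fst l))"
  have wt_eq: "wt u = wt w" if "?eq u w" for u w
    using that by (induction rule: word_eq.induct) (auto simp: wt_def weight(2)[symmetric])
  have wt_append: "wt (u @ w) = wt u + wt w" for u w by (simp add: wt_def)
  define cls where "cls = (\<lambda>u. {w. ?eq u w})"
  have cls_eq: "cls u = cls w \<longleftrightarrow> ?eq u w" for u w
    unfolding cls_def by (auto intro: word_eq.word_refl word_eq.word_sym word_eq.word_trans)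
  \<comment> \<open>A bijection with all of \<open>nat\<close> needs infinitely many classes;
    \<open>wt\<close> separates the powers of one generator.\<close>
  have "infinite (range cls)"
  proof
    obtain s :: 's where True by blast
    assume "finite (range cls)"
    then have "finite (cls ` range (\<lambda>n. replicate n (s, True)))" by (rule rev_finite_subset) auto
    moreover have "inj_on cls (range (\<lambda>n. replicate n (s, True)))"
    proof (rule inj_onI)
      fix u w assume "u \<in> range (\<lambda>n. replicate n (s, True))" "w \<in> range (\<lambda>n. replicate n (s, True))"
        and eq: "cls u = cls w"
      then obtain m n where mn: "u = replicate m (s, True)" "w = replicate n (s, True)" by blast
      have "wt u = wt w" using eq cls_eq wt_eq by blast
      then have "int m * weight s = int n * weight s" by (simp add: mn wt_def sum_list_replicate)
      then show "u = w" using weight(1)[of s] mn by simp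
    qed
    ultimately have "finite (range (\<lambda>n. replicate n (s, True)))" by (rule finite_imageD)
    moreover have "inj (\<lambda>n. replicate n (s, True))" by (rule injI) (metis length_replicate)
    ultimately show False using finite_imageD infinite_UNIV_nat by blast
  qed
  moreover have "countable (range cls)" by simp
  ultimately have "bij_betw (to_nat_on (range cls)) (range cls) UNIV" by (intro to_nat_on_infinite)
  then have tn: "inj_on (to_nat_on (range cls)) (range cls)" "to_nat_on (range cls) ` range cls = UNIV"
    by (auto simp: bij_betw_def)
  define q where "q = (\<lambda>w. to_nat_on (range cls) (cls w))"
  have q_eq: "q u = q w \<longleftrightarrow> ?eq u w" for u w
    unfolding q_def using inj_on_eq_iff[OF tn(1) rangeI rangeI, of u w] cls_eq[of u w] by (rule trans)
  have "surj q" using tn(2) unfolding q_def by (auto simp: image_image)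
  define rep where "rep = (\<lambda>n. SOME w. q w = n)"
  have q_rep: "q (rep n) = n" for n
    unfolding rep_def by (rule someI_ex) (metis \<open>surj q\<close> surjD)
  have rep_q: "?eq (rep (q w)) w" for w using q_rep q_eq by blast
  define mul where "mul = (\<lambda>m n. q (rep m @ rep n))"
  define inv where "inv = (\<lambda>n. q (word_inverse (rep n)))"
  define gen where "gen = (\<lambda>s. q [(s, True)])"
  define height where "height = (\<lambda>n. wt (rep n))"
  have mul_q: "mul (q u) (q w) = q (u @ w)" for u w
    unfolding mul_def q_eq by (intro word_eq_append2 rep_q)
  have mul_q1: "mul (q u) n = q (u @ rep n)" for u n using mul_q[of u "rep n"] q_rep by simp
  have height_q: "height (q w) = wt w" for w unfolding height_def by (rule wt_eq[OF rep_q])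
  interpret group mul "q []" inv
  proof
    fix a b c
    have "mul (mul (q u) (q v)) (q w) = mul (q u) (mul (q v) (q w))" for u v w
      by (simp add: mul_q)
    from this[of "rep a" "rep b" "rep c"] show "mul (mul a b) c = mul a (mul b c)"
      by (simp add: q_rep)
    show "mul (q []) a = a" by (simp add: mul_q1 q_rep)
    show "mul (inv a) a = q []"
      unfolding inv_def mul_q1 q_eq by (rule word_inverse_cancel)
  qed
  interpret triangle_group mul "q []" inv I X Y Z gen height
  proof
    show "mul (gen (X i)) (gen (Y i)) = gen (Z i)" if "i \<in> I" for i
      unfolding gen_def mul_q q_eq using word_eq.word_relator[OF that, of X Y Z "[]" "[]"] by simp
    show "height (mul u v) = height u + height v" for u v
      by (simp add: mul_def height_q wt_append) (simp add: height_def)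
    show "0 < height (gen s)" for s unfolding gen_def height_q by (simp add: wt_def weight)
    show "inj gen"
    proof (rule injI)
      fix s t assume "gen s = gen t"
      then have "?eq [(s, True)] [(t, True)]" by (simp add: gen_def q_eq)
      then have "foldr act [(s, True)] x0 = foldr act [(t, True)] x0"
        by (rule word_eq_action[where act = act]) (fact act)+
      then have "act (s, True) x0 = act (t, True) x0" by simp
      then show "s = t" by (rule injD[OF faithful])
    qed
  qed (use fin distinct used one_vertex in auto)
  have letter: "letter l = q [l]" for l
  proof (cases l)
    case (Pair s b)
    have "mul (q [(s, False)]) (gen s) = q []"
      unfolding gen_def mul_q q_eq using word_eq.word_cancel[of I X Y Z "[]" s False "[]"] by simp
    then have "inv (gen s) = q [(s, False)]"
      by (metis inverse_inverse inverse_unique)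
    moreover have "gen s = q [(s, True)]" by (simp add: gen_def)
    ultimately show ?thesis using Pair by (cases b) simp_all
  qed
  have eval: "eval w = q w" for w
    by (induction w) (simp_all add: letter mul_q)
  have "presented_triangle_group mul (q []) inv I X Y Z gen height"
  proof
    show "?eq w []" if "eval w = q []" for w using that by (simp add: eval q_eq)
    show "\<exists>w. eval w = v" for v
      by (rule exI[of _ "rep v"]) (simp add: eval q_rep)
  qed
  then show ?thesis by (rule that)
qed


section \<open>The presentation of the fundamental group of the complex\<close>

text \<open>The labels \<open>E1, E2, F1, F2, G1, G2\<close> are \<open>e\<^sub>1, e\<^sub>2, f\<^sub>1, f\<^sub>2, g, h\<close>, and \<open>E3, F3, G3\<close> are
  \<open>e\<^sub>3, f\<^sub>3, i\<close> with reversed orientation, so that all triangles become positive relations; \<open>D1, D2, D3\<close>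
  are the diagonals cutting the squares. Triangles \<open>2k\<close> and \<open>2k + 1\<close> are the halves of
  one polygon.\<close>

datatype label = E1 | E2 | E3 | F1 | F2 | F3 | G1 | G2 | G3 | D1 | D2 | D3

lemma UNIV_label: "UNIV = {E1, E2, E3, F1, F2, F3, G1, G2, G3, D1, D2, D3}"
  using label.exhaust by auto

instance label :: finite
  by standard (simp add: UNIV_label)

definition relators :: "(label \<times> label \<times> label) list" where
  "relators = [(E1, E2, E3), (E2, E1, E3), (F1, F2, F3), (F2, F1, F3), (G2, G1, G3), (G1, G2, G3),
     (E1, G1, D1), (G1, F1, D1), (E2, G2, D2), (G2, F2, D2), (G3, E3, D3), (F3, G3, D3)]"

definition sideX :: "nat \<Rightarrow> label" where "sideX i = fst (relators ! i)"
definition sideY :: "nat \<Rightarrow> label" where "sideY i = fst (snd (relators ! i))"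
definition sideZ :: "nat \<Rightarrow> label" where "sideZ i = snd (snd (relators ! i))"

abbreviation glued_triangles :: "nat gluing" where
  "glued_triangles \<equiv> presentation_gluing {..<12} sideX sideY sideZ"

text \<open>Turns quantification over triangle numbers into quantification over an explicit list,
  which the simplifier can evaluate.\<close>

lemma ex_relator:
  "(\<exists>i\<in>{..<12}. P (sideX i) (sideY i) (sideZ i)) \<longleftrightarrow> (\<exists>(x, y, z)\<in>set relators. P x y z)"
proof -
  have "length relators = 12" by (simp add: relators_def)
  then show ?thesis
    unfolding split_beta sideX_def sideY_def sideZ_def by (metis in_set_conv_nth lessThan_iff)
qed

lemma all_relator:
  "(\<forall>i\<in>{..<12}. P (sideX i) (sideY i) (sideZ i)) \<longleftrightarrow> (\<forall>(x, y, z)\<in>set relators. P x y z)"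
  using ex_relator[of "\<lambda>x y z. \<not> P x y z"] by auto

text \<open>Value 1 on \<open>E1, E2, F1, F2, G1, G2\<close>; the relators force the rest.\<close>

fun weight :: "label \<Rightarrow> int" where
  "weight E1 = 1" | "weight E2 = 1" | "weight E3 = 2"
| "weight F1 = 1" | "weight F2 = 1" | "weight F3 = 2"
| "weight G1 = 1" | "weight G2 = 1" | "weight G3 = 2"
| "weight D1 = 2" | "weight D2 = 2" | "weight D3 = 4"

text \<open>The corner graph as adjacency lists, so that its properties become finite
  computations.\<close>

fun link_neighbours :: "label \<times> bool \<Rightarrow> (label \<times> bool) list" where
  "link_neighbours (E1, True) = [(E3, True), (E2, False), (D1, True)]"
| "link_neighbours (E1, False) = [(E2, True), (E3, False), (G1, True)]"
| "link_neighbours (E2, True) = [(E1, False), (E3, True), (D2, True)]"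
| "link_neighbours (E2, False) = [(E3, False), (E1, True), (G2, True)]"
| "link_neighbours (E3, True) = [(E1, True), (E2, True), (G3, False)]"
| "link_neighbours (E3, False) = [(E2, False), (E1, False), (D3, False)]"
| "link_neighbours (F1, True) = [(F3, True), (F2, False), (G1, False)]"
| "link_neighbours (F1, False) = [(F2, True), (F3, False), (D1, False)]"
| "link_neighbours (F2, True) = [(F1, False), (F3, True), (G2, False)]"
| "link_neighbours (F2, False) = [(F3, False), (F1, True), (D2, False)]"
| "link_neighbours (F3, True) = [(F1, True), (F2, True), (D3, True)]"
| "link_neighbours (F3, False) = [(F2, False), (F1, False), (G3, True)]"
| "link_neighbours (G1, True) = [(G2, False), (G3, True), (E1, False), (D1, True)]"
| "link_neighbours (G1, False) = [(G3, False), (G2, True), (D1, False), (F1, True)]"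
| "link_neighbours (G2, True) = [(G3, True), (G1, False), (E2, False), (D2, True)]"
| "link_neighbours (G2, False) = [(G1, True), (G3, False), (D2, False), (F2, True)]"
| "link_neighbours (G3, True) = [(G2, True), (G1, True), (D3, True), (F3, False)]"
| "link_neighbours (G3, False) = [(G1, False), (G2, False), (E3, True), (D3, False)]"
| "link_neighbours (D1, True) = [(E1, True), (G1, True)]"
| "link_neighbours (D1, False) = [(G1, False), (F1, False)]"
| "link_neighbours (D2, True) = [(E2, True), (G2, True)]"
| "link_neighbours (D2, False) = [(G2, False), (F2, False)]"
| "link_neighbours (D3, True) = [(G3, True), (F3, True)]"
| "link_neighbours (D3, False) = [(E3, False), (G3, False)]"

lemma link_edge_neighbours:
  assumes "link_edge {..<12} sideX sideY sideZ a b"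
  shows "b \<in> set (link_neighbours a)"
  using assms
  unfolding link_edge_def
    ex_relator[of "\<lambda>x y z. {a, b} \<in> {{(x, True), (z, True)}, {(x, False), (y, True)}, {(z, False), (y, False)}}"]
  by (auto simp: relators_def doubleton_eq_iff)

text \<open>In every relator \<open>sideX\<close> and \<open>sideY\<close> are both of weight 2 or
  both not, and \<open>sideZ\<close> is of the other kind. That is exactly what makes this colour
  change at each of the three corners of a triangle.\<close>

lemma link_edge_colour:
  assumes "link_edge {..<12} sideX sideY sideZ a b"
  shows "(snd a = (weight (fst a) = 2)) \<noteq> (snd b = (weight (fst b) = 2))"
proof -
  have "\<forall>b\<in>set (link_neighbours a). (snd a = (weight (fst a) = 2)) \<noteq> (snd b = (weight (fst b) = 2))"
    by (cases a rule: link_neighbours.cases) simp_all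
  then show ?thesis using link_edge_neighbours[OF assms] by blast
qed

text \<open>In other words, two distinct edge ends have at most one common neighbour; checked on the
  adjacency lists.\<close>

lemma link_edge_no_square:
  assumes "link_edge {..<12} sideX sideY sideZ a b" "link_edge {..<12} sideX sideY sideZ b c"
    "link_edge {..<12} sideX sideY sideZ c d" "link_edge {..<12} sideX sideY sideZ d a"
  shows "a = c \<or> b = d"
proof -
  have "\<forall>b\<in>set (link_neighbours a). \<forall>c\<in>set (link_neighbours b). a \<noteq> c \<longrightarrow>
      (\<forall>d\<in>set (link_neighbours c). a \<in> set (link_neighbours d) \<longrightarrow> b = d)"
    by (cases a rule: link_neighbours.cases) simp_all
  then show ?thesis using assms[THEN link_edge_neighbours] by blast
qed

text \<open>The action by left multiplication of a class 2 nilpotent quotient. It is needed because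
  the abelianization does not separate \<open>E1\<close> from \<open>F1\<close>.\<close>

fun heisenberg :: "label \<Rightarrow> int \<times> int \<times> int \<times> int \<times> int" where
  "heisenberg E1 = (1, 0, 0, 0, 0)" | "heisenberg E2 = (0, 1, 0, 0, 0)" | "heisenberg E3 = (1, 1, 0, 0, 0)"
| "heisenberg F1 = (1, 0, 0, 0, -1)" | "heisenberg F2 = (0, 1, 0, 0, -1)" | "heisenberg F3 = (1, 1, 0, 0, -2)"
| "heisenberg G1 = (0, 0, 1, 0, 0)" | "heisenberg G2 = (0, 0, 0, 1, 0)" | "heisenberg G3 = (0, 0, 1, 1, 0)"
| "heisenberg D1 = (1, 0, 1, 0, 0)" | "heisenberg D2 = (0, 1, 0, 1, 0)" | "heisenberg D3 = (1, 1, 1, 1, -2)"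

definition nilpotent_act :: "label \<times> bool \<Rightarrow> int \<times> int \<times> int \<times> int \<times> int \<Rightarrow> int \<times> int \<times> int \<times> int \<times> int" where
  "nilpotent_act = (\<lambda>(s, b) (u, u', v, v', c). case heisenberg s of (p, p', q, q', r) \<Rightarrow>
     if b then (p + u, p' + u', q + v, q' + v', r + c + (q * u - 2 * q * u' - 2 * q' * u + q' * u'))
     else (u - p, u' - p', v - q, v' - q', c - r - (q * (u - p) - 2 * q * (u' - p') - 2 * q' * (u - p) + q' * (u' - p'))))"

lemma corners_glued:
  assumes "i < 12" "a \<in> triangle_corners"
  shows "((0, 0), (i, a)) \<in> (glue_step glued_triangles)\<^sup>*"
proof -
  define P where "P = (\<lambda>x. ((0, 0), x) \<in> (glue_step glued_triangles)\<^sup>*)"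
  have step: "P (i, a) \<longleftrightarrow> P (j, c)" "P (i, b) \<longleftrightarrow> P (j, d)"
    if "(i, a, b) \<in> edge_class {..<12} sideX sideY sideZ s" "(j, c, d) \<in> edge_class {..<12} sideX sideY sideZ s"
    for i j a b c d s
  proof -
    have "((i, linepath a b t), (j, linepath c d t)) \<in> glue_step glued_triangles" if "t \<in> {0..1}" for t
      using \<open>(i, a, b) \<in> _\<close> \<open>(j, c, d) \<in> _\<close> that
      unfolding glue_step_def presentation_gluing_def by fastforce
    from this[of 0] this[of 1] have "((i, a), (j, c)) \<in> glue_step glued_triangles"
      "((i, b), (j, d)) \<in> glue_step glued_triangles" by (simp_all add: linepath_def)
    then show "P (i, a) \<longleftrightarrow> P (j, c)" "P (i, b) \<longleftrightarrow> P (j, d)"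
      using sym_glue_step[of glued_triangles] unfolding P_def by (meson rtrancl.rtrancl_into_rtrancl symD)+
  qed
  have X: "(i, 0, 1) \<in> edge_class {..<12} sideX sideY sideZ (sideX i)"
    and Y: "(i, 1, apex) \<in> edge_class {..<12} sideX sideY sideZ (sideY i)"
    and Z: "(i, 0, apex) \<in> edge_class {..<12} sideX sideY sideZ (sideZ i)" if "i < 12" for i
    using that by (auto simp: edge_class_def)
  \<comment> \<open>\<open>S s\<close> and \<open>T s\<close> say that the tail, respectively the
    head, of the edges labelled \<open>s\<close> is glued to the corner 0 of triangle 0; by
    \<open>step\<close> all edges with label \<open>s\<close> agree on this. The relators then
    propagate \<open>S E1\<close> to all labels.\<close>
  define S where "S = (\<lambda>s. \<exists>i a b. (i, a, b) \<in> edge_class {..<12} sideX sideY sideZ s \<and> P (i, a))"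
  define T where "T = (\<lambda>s. \<exists>i a b. (i, a, b) \<in> edge_class {..<12} sideX sideY sideZ s \<and> P (i, b))"
  have ends: "P (i, a) \<longleftrightarrow> S s" "P (i, b) \<longleftrightarrow> T s"
    if "(i, a, b) \<in> edge_class {..<12} sideX sideY sideZ s" for i a b s
    unfolding S_def T_def using step that by blast+
  have "\<forall>i\<in>{..<12}. S (sideX i) = S (sideZ i) \<and> T (sideX i) = S (sideY i) \<and> T (sideY i) = T (sideZ i)"
    using ends[OF X] ends[OF Y] ends[OF Z] by auto
  then have rel: "\<forall>(x, y, z)\<in>set relators. S x = S z \<and> T x = S y \<and> T y = T z"
    unfolding all_relator[of "\<lambda>x y z. S x = S z \<and> T x = S y \<and> T y = T z"] .
  have "P (0, 0)" by (simp add: P_def)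
  then have "S E1" using ends(1)[OF X[of 0]] by (simp add: sideX_def relators_def)
  with rel have "S s \<and> T s" for s by (cases s) (auto simp: relators_def)
  moreover have "a = 0 \<or> a = 1 \<or> a = apex" using assms(2) by (auto simp: triangle_corners_def)
  ultimately have "P (i, a)" using ends[OF X[OF assms(1)]] ends[OF Y[OF assms(1)]] by auto
  then show ?thesis by (simp add: P_def)
qed

lemma fundamental_group_exists:
  obtains mul :: "nat \<Rightarrow> nat \<Rightarrow> nat" and one inv gen height
  where "presented_triangle_group mul one inv {..<12} sideX sideY sideZ gen height"
proof (rule presented_triangle_group_exists[of "{..<12}" weight sideX sideY sideZ nilpotent_act "(0, 0, 0, 0, 0)"])
  show "0 < weight s" for s by (cases s) simp_all
  have "\<forall>i\<in>{..<12}. weight (sideX i) + weight (sideY i) = weight (sideZ i)"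
    unfolding all_relator[of "\<lambda>x y z. weight x + weight y = weight z"] by (simp add: relators_def)
  then show "weight (sideX i) + weight (sideY i) = weight (sideZ i)" if "i \<in> {..<12}" for i using that by blast
  show "nilpotent_act (s, b) (nilpotent_act (s, \<not> b) x) = x" for s b x
    by (cases b; cases s; cases x) (simp_all add: nilpotent_act_def)
  have "\<forall>i\<in>{..<12}. \<forall>v. nilpotent_act (sideX i, True) (nilpotent_act (sideY i, True) v) = nilpotent_act (sideZ i, True) v"
    unfolding all_relator[of "\<lambda>x y z. \<forall>v. nilpotent_act (x, True) (nilpotent_act (y, True) v) = nilpotent_act (z, True) v"]
    by (simp add: relators_def nilpotent_act_def algebra_simps)
  then show "nilpotent_act (sideX i, True) (nilpotent_act (sideY i, True) v) = nilpotent_act (sideZ i, True) v"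
    if "i \<in> {..<12}" for i v using that by blast
  \<comment> \<open>The point 0 is sent to \<open>heisenberg s\<close> itself. Only the pairs
    \<open>E1, F1\<close>, \<open>E2, F2\<close> and \<open>E3, F3\<close> agree in the first four
    entries; the central entry separates them.\<close>
  show "inj (\<lambda>s. nilpotent_act (s, True) (0, 0, 0, 0, 0))"
  proof (rule injI)
    fix s t assume "nilpotent_act (s, True) (0, 0, 0, 0, 0) = nilpotent_act (t, True) (0, 0, 0, 0, 0)"
    then show "s = t" by (cases s; cases t) (simp_all add: nilpotent_act_def)
  qed
  show "i = j" if "i \<in> {..<12}" "j \<in> {..<12}" "sideX i = sideX j" "sideZ i = sideZ j" for i j
  proof -
    have "distinct (map (\<lambda>(x, y, z). (x, z)) relators)" "length relators = 12" by (simp_all add: relators_def)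
    moreover have "map (\<lambda>(x, y, z). (x, z)) relators ! k = (sideX k, sideZ k)" if "k < 12" for k
      using that \<open>length relators = 12\<close> by (simp add: sideX_def sideZ_def split_beta)
    ultimately show ?thesis
      using that nth_eq_iff_index_eq[of "map (\<lambda>(x, y, z). (x, z)) relators" i j] by simp
  qed
  show "\<exists>i\<in>{..<12}. s = sideX i \<or> s = sideY i \<or> s = sideZ i" for s
    unfolding ex_relator[of "\<lambda>x y z. s = x \<or> s = y \<or> s = z"] by (cases s) (simp_all add: relators_def)
  show "((i, a), (j, b)) \<in> (glue_step glued_triangles)\<^sup>*"
    if "i \<in> {..<12}" "j \<in> {..<12}" "a \<in> triangle_corners" "b \<in> triangle_corners" for i j a b
    using corners_glued[of i a] corners_glued[of j b] that sym_rtrancl[OF sym_glue_step[of glued_triangles]]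
    by (auto dest: symD intro: rtrancl_trans)
qed (use that in auto)


section \<open>Cutting the polygons into triangles\<close>

text \<open>Both glued spaces will be seen as quotients of the same twelve triangles, which leaves
  only the fibres to compare.\<close>

lemma homeomorphic_space_quotients:
  assumes f: "quotient_map A B f" and g: "quotient_map A C g"
    and fibres: "\<And>x y. \<lbrakk>x \<in> topspace A; y \<in> topspace A\<rbrakk> \<Longrightarrow> f x = f y \<longleftrightarrow> g x = g y"
  shows "B homeomorphic_space C"
proof -
  obtain h where h: "continuous_map B C h" "\<And>x. x \<in> topspace A \<Longrightarrow> h (f x) = g x"
    using quotient_map_lift_exists[OF f quotient_imp_continuous_map[OF g]] fibres by metis
  obtain k where k: "continuous_map C B k" "\<And>x. x \<in> topspace A \<Longrightarrow> k (g x) = f x"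
    using quotient_map_lift_exists[OF g quotient_imp_continuous_map[OF f]] fibres by metis
  have "f ` topspace A = topspace B" "g ` topspace A = topspace C"
    using f g by (auto simp: quotient_map_def)
  then have "homeomorphic_maps B C h k"
    unfolding homeomorphic_maps_def using h k by (auto simp: image_iff set_eq_iff) metis+
  then show ?thesis by (auto simp: homeomorphic_space_def)
qed

lemma convex_hull_parallelogram:
  fixes s :: complex
  assumes "m + m' = s + e"
  shows "convex hull {s, m, m', e} = convex hull {s, m, e} \<union> convex hull {s, m', e}"
proof
  show "convex hull {s, m, e} \<union> convex hull {s, m', e} \<subseteq> convex hull {s, m, m', e}"
    by (intro Un_least hull_mono) auto
  show "convex hull {s, m, m', e} \<subseteq> convex hull {s, m, e} \<union> convex hull {s, m', e}"
  proof
    fix z assume "z \<in> convex hull {s, m, m', e}"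
    then obtain a v y where av: "0 \<le> a" "0 \<le> v" "a + v = 1" "z = a *\<^sub>R s + v *\<^sub>R y"
      and y: "y \<in> convex hull {m, m', e}"
      by (subst (asm) convex_hull_insert) auto
    obtain p q r where pqr: "0 \<le> p" "0 \<le> q" "0 \<le> r" "p + q + r = 1"
      "y = p *\<^sub>R m + q *\<^sub>R m' + r *\<^sub>R e"
      using y unfolding convex_hull_3 by blast
    define b c d where "b = v * p" and "c = v * q" and "d = v * r"
    have "a + b + c + d = a + v * (p + q + r)" by (simp add: b_def c_def d_def algebra_simps)
    then have co: "0 \<le> a" "0 \<le> b" "0 \<le> c" "0 \<le> d" "a + b + c + d = 1"
      using av pqr by (simp_all add: b_def c_def d_def)
    have z: "z = a *\<^sub>R s + b *\<^sub>R m + c *\<^sub>R m' + d *\<^sub>R e"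
      by (simp add: av pqr b_def c_def d_def algebra_simps)
    have m': "m' = s + e - m" using assms by (simp add: algebra_simps)
    show "z \<in> convex hull {s, m, e} \<union> convex hull {s, m', e}"
    \<comment> \<open>As \<open>m + m' = s + e\<close>, the smaller of the weights \<open>b\<close>
      and \<open>c\<close> can be moved from \<open>m\<close> and \<open>m'\<close> to
      \<open>s\<close> and \<open>e\<close>, which frees one of the two corners.\<close>
    proof (cases "c \<le> b")
      case True
      have "z = (a + c) *\<^sub>R s + (b - c) *\<^sub>R m + (d + c) *\<^sub>R e"
        by (simp add: z m' algebra_simps)
      moreover have "0 \<le> a + c" "0 \<le> b - c" "0 \<le> d + c" "(a + c) + (b - c) + (d + c) = 1"
        using co True by simp_all
      ultimately have "z \<in> convex hull {s, m, e}" unfolding convex_hull_3 by blast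
      then show ?thesis by blast
    next
      case False
      have "z = (a + b) *\<^sub>R s + (c - b) *\<^sub>R m' + (d + b) *\<^sub>R e"
        by (simp add: z m' algebra_simps)
      moreover have "0 \<le> a + b" "0 \<le> c - b" "0 \<le> d + b" "(a + b) + (c - b) + (d + b) = 1"
        using co False by simp_all
      ultimately have "z \<in> convex hull {s, m', e}" unfolding convex_hull_3 by blast
      then show ?thesis by blast
    qed
  qed
qed

text \<open>Aligned with \<open>relators\<close>: the entry gives the images of 0, 1,
  \<open>apex\<close>, and the two halves of a polygon share the side from 0 to \<open>apex\<close>,
  its diagonal. The third square starts at \<open>cR\<close> because its outer labels are
  reversed.\<close>

definition placements :: "(piece \<times> complex \<times> complex \<times> complex) list" where
  "placements = [(Rh1, cN, cK, cL), (Rh1, cN, cM, cL), (Rh2, cL, cK, cN), (Rh2, cL, cM, cN),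
     (RhABCD, cC, cB, cA), (RhABCD, cC, cD, cA), (Sq1, cP, cQ, cR), (Sq1, cP, cS, cR),
     (Sq2, cP, cQ, cR), (Sq2, cP, cS, cR), (Sq3, cR, cQ, cP), (Sq3, cR, cS, cP)]"

definition host :: "nat \<Rightarrow> piece" where "host i = fst (placements ! i)"
definition start :: "nat \<Rightarrow> complex" where "start i = fst (snd (placements ! i))"
definition middle :: "nat \<Rightarrow> complex" where "middle i = fst (snd (snd (placements ! i)))"
definition finish :: "nat \<Rightarrow> complex" where "finish i = snd (snd (snd (placements ! i)))"

text \<open>The affine map of the unit triangle onto its half polygon. For the squares it is not
  isometric; only the homeomorphism type is at stake.\<close>

definition place :: "nat \<Rightarrow> complex \<Rightarrow> complex" where
  "place i z = bary0 z *\<^sub>R start i + bary1 z *\<^sub>R middle i + bary2 z *\<^sub>R finish i"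

definition place_point :: "nat \<times> complex \<Rightarrow> piece \<times> complex" where
  "place_point x = (host (fst x), place (fst x) (snd x))"

lemma place_linepath: "place i (linepath a b t) = linepath (place i a) (place i b) t"
  unfolding place_def bary_linepath by (simp add: linepath_def algebra_simps)

lemma place_corners [simp]: "place i 0 = start i" "place i 1 = middle i" "place i apex = finish i"
  by (simp_all add: place_def bary0_def)

lemma place_image: "place i ` unit_triangle = convex hull {start i, middle i, finish i}"
proof
  show "place i ` unit_triangle \<subseteq> convex hull {start i, middle i, finish i}"
    unfolding convex_hull_3 place_def unit_triangle_iff[THEN eqTrueI] by (force simp: unit_triangle_iff bary0_def)
  show "convex hull {start i, middle i, finish i} \<subseteq> place i ` unit_triangle"
  proof
    fix z assume "z \<in> convex hull {start i, middle i, finish i}"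
    then obtain u v w where uvw: "0 \<le> u" "0 \<le> v" "0 \<le> w" "u + v + w = 1"
      "z = u *\<^sub>R start i + v *\<^sub>R middle i + w *\<^sub>R finish i" unfolding convex_hull_3 by blast
    define y where "y = of_real v + of_real w * apex"
    have "bary1 y = v" "bary2 y = w" "bary0 y = u"
      using uvw(4) by (simp_all add: y_def bary_unique bary0_def)
    then show "z \<in> place i ` unit_triangle"
      using uvw by (intro image_eqI[of _ _ y]) (simp_all add: place_def unit_triangle_iff)
  qed
qed

lemma continuous_on_place: "continuous_on S (place i)"
  unfolding place_def by (intro continuous_on_add continuous_on_scaleR continuous_on_bary continuous_on_const)

text \<open>Geometry and labels of each triangle in one list, so that statements about both can be
  verified row by row.\<close>

definition table :: "((piece \<times> complex \<times> complex \<times> complex) \<times> (label \<times> label \<times> label)) list" where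
  "table = zip placements relators"

lemma table_nth:
  assumes "i < 12"
  shows "table ! i = ((host i, start i, middle i, finish i), (sideX i, sideY i, sideZ i))" "i < length table"
  using assms
  by (simp_all add: table_def placements_def relators_def host_def start_def middle_def finish_def
      sideX_def sideY_def sideZ_def split_beta nth_zip[symmetric])

lemma length_table: "length table = 12"
  by (simp add: table_def placements_def relators_def)

lemma in_set_table: "r \<in> set table \<longleftrightarrow>
    (\<exists>i<12. r = ((host i, start i, middle i, finish i), (sideX i, sideY i, sideZ i)))"
  unfolding in_set_conv_nth length_table using table_nth(1) by metis

text \<open>The two halves of a polygon share the diagonal with its label, and their middle corners
  are opposite corners of a parallelogram.\<close>

lemma host_eqD:
  assumes "i < 12" "j < 12" "host i = host j" "i \<noteq> j"
  shows "start i = start j" "finish i = finish j" "middle i + middle j = start i + finish i" "sideZ i = sideZ j"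
proof -
  have "\<forall>((p, s, m, e), r)\<in>set table. \<forall>((p', s', m', e'), r')\<in>set table. p = p' \<longrightarrow> r = r' \<or>
      s = s' \<and> e = e' \<and> m + m' = s + e \<and> snd (snd r) = snd (snd r')"
    by (simp add: table_def placements_def relators_def cK_def cL_def cM_def cN_def cA_def cB_def cC_def
        cD_def cP_def cQ_def cR_def cS_def)
  moreover have "((host i, start i, middle i, finish i), (sideX i, sideY i, sideZ i)) \<in> set table"
    "((host j, start j, middle j, finish j), (sideX j, sideY j, sideZ j)) \<in> set table"
    using in_set_table assms(1,2) by blast+
  moreover have "(sideX i, sideY i, sideZ i) \<noteq> (sideX j, sideY j, sideZ j)"
  proof -
    have "distinct relators" "length relators = 12" by (simp_all add: relators_def)
    then show ?thesis
      using assms nth_eq_iff_index_eq[of relators i j] by (auto simp: sideX_def sideY_def sideZ_def prod_eq_iff)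
  qed
  ultimately show "start i = start j" "finish i = finish j" "middle i + middle j = start i + finish i" "sideZ i = sideZ j"
    using assms(3) by fastforce+
qed

lemma nondegenerate:
  assumes "i < 12"
  shows "Re (middle i - start i) * Im (finish i - start i) \<noteq> Im (middle i - start i) * Re (finish i - start i)"
proof -
  have "\<forall>((p, s, m, e), r)\<in>set table. Re (m - s) * Im (e - s) \<noteq> Im (m - s) * Re (e - s)"
    by (simp add: table_def placements_def relators_def cK_def cL_def cM_def cN_def cA_def cB_def cC_def
        cD_def cP_def cQ_def cR_def cS_def)
  moreover have "((host i, start i, middle i, finish i), (sideX i, sideY i, sideZ i)) \<in> set table"
    using in_set_table assms by blast
  ultimately show ?thesis by fastforce
qed

lemma independent_combination:
  fixes a b :: complex
  assumes "Re a * Im b \<noteq> Im a * Re b" "u *\<^sub>R a + v *\<^sub>R b = 0"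
  shows "u = 0 \<and> v = 0"
proof -
  have 1: "u * Re a + v * Re b = 0" and 2: "u * Im a + v * Im b = 0"
    using assms(2) by (simp_all add: complex_eq_iff)
  have "u * (Re a * Im b - Im a * Re b) = Im b * (u * Re a + v * Re b) - Re b * (u * Im a + v * Im b)"
    by (simp add: algebra_simps)
  then have "u * (Re a * Im b - Im a * Re b) = 0" unfolding 1 2 by simp
  moreover have "v * (Re a * Im b - Im a * Re b) = Re a * (u * Im a + v * Im b) - Im a * (u * Re a + v * Re b)"
    by (simp add: algebra_simps)
  then have "v * (Re a * Im b - Im a * Re b) = 0" unfolding 1 2 by simp
  ultimately show ?thesis using assms(1) by simp
qed

text \<open>Within one triangle, \<open>place\<close> is injective by \<open>nondegenerate\<close>.
  Across two halves, the coordinate along \<open>middle i - start i\<close> is nonnegative on one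
  and nonpositive on the other, so both \<open>bary1\<close> vanish: the point lies on the diagonal,
  where the halves are glued along \<open>sideZ\<close>.\<close>

lemma place_point_eq_glued:
  assumes "x \<in> Sigma {..<12} (\<lambda>_. unit_triangle)" "y \<in> Sigma {..<12} (\<lambda>_. unit_triangle)" "place_point x = place_point y"
  shows "(x, y) \<in> (glue_step glued_triangles)\<^sup>*"
proof -
  obtain i z j w where x: "x = (i, z)" "i < 12" "z \<in> unit_triangle"
    and y: "y = (j, w)" "j < 12" "w \<in> unit_triangle"
    using assms(1,2) by auto
  have h: "host i = host j" and p: "place i z = place j w" using assms(3) x y by (auto simp: place_point_def)
  have pz: "place i z = start i + bary1 z *\<^sub>R (middle i - start i) + bary2 z *\<^sub>R (finish i - start i)" for z
    by (simp add: place_def bary0_def algebra_simps)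
  show ?thesis
  proof (cases "i = j")
    case True
    have "(bary1 z - bary1 w) *\<^sub>R (middle i - start i) + (bary2 z - bary2 w) *\<^sub>R (finish i - start i)
        = place i z - place i w"
      unfolding pz by (simp add: algebra_simps)
    then have "bary1 z = bary1 w \<and> bary2 z = bary2 w"
      using independent_combination[OF nondegenerate[OF x(2)]] p True by fastforce
    then show ?thesis using bary_inj x y True by blast
  next
    case False
    note eq = host_eqD[OF x(2) y(2) h False]
    have m: "middle j = start i + finish i - middle i" using eq(3) by (simp add: algebra_simps)
    have "place j w = start i + (bary2 w + bary1 w) *\<^sub>R (finish i - start i) - bary1 w *\<^sub>R (middle i - start i)"
      unfolding place_def bary0_def eq(1)[symmetric] eq(2)[symmetric] m by (simp add: algebra_simps)
    then have "(bary1 z + bary1 w) *\<^sub>R (middle i - start i) + (bary2 z - bary2 w - bary1 w) *\<^sub>R (finish i - start i)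
        = place i z - place j w"
      unfolding pz by (simp add: algebra_simps)
    also have "\<dots> = 0" using p by simp
    finally have "bary1 z + bary1 w = 0 \<and> bary2 z - bary2 w - bary1 w = 0"
      by (rule independent_combination[OF nondegenerate[OF x(2)]])
    moreover have "0 \<le> bary1 z" "0 \<le> bary1 w" "0 \<le> bary2 z" "0 \<le> bary0 z"
      using x(3) y(3) by (auto simp: unit_triangle_iff)
    ultimately have b: "bary1 z = 0" "bary1 w = 0" "bary2 w = bary2 z" "bary2 z \<in> {0..1}"
      by (auto simp: bary0_def)
    then have "z = linepath 0 apex (bary2 z)" "w = linepath 0 apex (bary2 z)"
      by (intro bary_inj; unfold bary_linepath; simp)+
    moreover have "(i, 0, apex) \<in> edge_class {..<12} sideX sideY sideZ (sideZ i)"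
      "(j, 0, apex) \<in> edge_class {..<12} sideX sideY sideZ (sideZ i)"
      using x(2) y(2) eq(4) by (auto simp: edge_class_def)
    ultimately have "(x, y) \<in> glue_step glued_triangles"
      unfolding glue_step_def presentation_gluing_def using x(1) y(1) b(4) by blast
    then show ?thesis by blast
  qed
qed

section \<open>Comparison of the triangle gluing with the polygon gluing\<close>

definition segments :: "label \<Rightarrow> (piece \<times> complex \<times> complex) set" where
  "segments s = (\<lambda>(i, a, b). (host i, place i a, place i b)) ` edge_class {..<12} sideX sideY sideZ s"

lemma segments_eq: "segments s = set (concat (map (\<lambda>((p, a, b, c), (x, y, z)).
    (if x = s then [(p, a, b)] else []) @ (if y = s then [(p, b, c)] else [])
      @ (if z = s then [(p, a, c)] else [])) table))"
proof -
  let ?f = "\<lambda>((p, a, b, c), (x, y, z)). (if x = s then [(p, a, b)] else []) @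
      (if y = s then [(p, b, c)] else []) @ (if z = s then [(p, a, c)] else [])"
  have "set table = (\<lambda>i. ((host i, start i, middle i, finish i), (sideX i, sideY i, sideZ i))) ` {..<12}"
    by (auto simp: in_set_table)
  then have "set (concat (map ?f table)) =
      (\<Union>i<12. set (?f ((host i, start i, middle i, finish i), (sideX i, sideY i, sideZ i))))"
    by (auto split: if_splits)
  also have "\<dots> = segments s"
    unfolding segments_def edge_class_def by (auto simp: image_iff split: if_splits) force+
  finally show ?thesis by simp
qed

lemma segments_simps:
  "segments E1 = {(Rh1, cM, cL), (Rh1, cN, cK), (Sq1, cP, cQ)}"
  "segments E2 = {(Rh1, cK, cL), (Rh1, cN, cM), (Sq2, cP, cQ)}"
  "segments E3 = {(Rh1, cN, cL), (Sq3, cQ, cP)}"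
  "segments F1 = {(Rh2, cL, cK), (Rh2, cM, cN), (Sq1, cS, cR)}"
  "segments F2 = {(Rh2, cL, cM), (Rh2, cK, cN), (Sq2, cS, cR)}"
  "segments F3 = {(Rh2, cL, cN), (Sq3, cR, cS)}"
  "segments G1 = {(RhABCD, cB, cA), (RhABCD, cC, cD), (Sq1, cP, cS), (Sq1, cQ, cR)}"
  "segments G2 = {(RhABCD, cC, cB), (RhABCD, cD, cA), (Sq2, cP, cS), (Sq2, cQ, cR)}"
  "segments G3 = {(RhABCD, cC, cA), (Sq3, cS, cP), (Sq3, cR, cQ)}"
  "segments D1 = {(Sq1, cP, cR)}"
  "segments D2 = {(Sq2, cP, cR)}"
  "segments D3 = {(Sq3, cR, cP)}"
  unfolding segments_eq table_def placements_def relators_def by auto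

definition reversed :: "piece \<times> complex \<times> complex \<Rightarrow> piece \<times> complex \<times> complex" where
  "reversed x = (fst x, snd (snd x), fst (snd x))"

lemma X1_gluing_segments:
  "X1_gluing = {segments E1, segments E2, reversed ` segments E3, segments F1, segments F2,
     reversed ` segments F3, segments G1, segments G2, reversed ` segments G3}"
  by (simp add: X1_gluing_def segments_simps reversed_def)

text \<open>Reversing all segments of a class at once only replaces the parameter \<open>t\<close>
  by \<open>1 - t\<close>.\<close>

lemma glue_step_mono_reversed:
  assumes "\<And>c. c \<in> A \<Longrightarrow> c \<in> B \<or> reversed ` c \<in> B"
  shows "glue_step A \<subseteq> glue_step B"
proof
  fix x assume "x \<in> glue_step A"
  then obtain i a b j c d t k where x: "x = ((i, linepath a b t), (j, linepath c d t))" "t \<in> {0..1}"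
    and k: "k \<in> A" "(i, a, b) \<in> k" "(j, c, d) \<in> k"
    by (auto simp: glue_step_def)
  from assms[OF k(1)] show "x \<in> glue_step B"
  proof
    assume "k \<in> B"
    then show ?thesis unfolding x(1) using k x(2) by (intro glue_stepI)
  next
    assume "reversed ` k \<in> B"
    moreover have r: "(i, b, a) \<in> reversed ` k" "(j, d, c) \<in> reversed ` k"
      using imageI[OF k(2), of reversed] imageI[OF k(3), of reversed] by (simp_all add: reversed_def)
    moreover have "x = ((i, linepath b a (1 - t)), (j, linepath d c (1 - t)))" "1 - t \<in> {0..1}"
      using x by (auto simp: linepath_def)
    ultimately show ?thesis using glue_stepI[of "reversed ` k" B i b a j d c "1 - t"] by simp
  qed
qed

lemma reversed_reversed [simp]: "reversed ` reversed ` k = k"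
  by (simp add: reversed_def image_image)

lemma X1_step_segments: "glue_step X1_gluing \<subseteq> glue_step (range segments)"
  by (rule glue_step_mono_reversed) (auto simp: X1_gluing_segments)

text \<open>The labels \<open>D1, D2, D3\<close> have a single segment in the polygons, so their
  steps relate points only to themselves; this is why the closure appears on the right.\<close>

lemma segments_step_X1: "glue_step (range segments) \<subseteq> (glue_step X1_gluing)\<^sup>*"
proof
  fix x assume "x \<in> glue_step (range segments)"
  then obtain i a b j c d t s where "x = ((i, linepath a b t), (j, linepath c d t))" "t \<in> {0..1}"
    "(i, a, b) \<in> segments s" "(j, c, d) \<in> segments s"
    by (auto simp: glue_step_def)
  then have s: "x \<in> glue_step {segments s}" using glue_stepI[of "segments s" "{segments s}"] by simp
  show "x \<in> (glue_step X1_gluing)\<^sup>*"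
  proof (cases "s \<in> {D1, D2, D3}")
    case True
    then have "fst x = snd x" using s by (auto simp: glue_step_def segments_simps)
    then show ?thesis by (cases x) simp
  next
    case False
    then have "glue_step {segments s} \<subseteq> glue_step X1_gluing"
      by (intro glue_step_mono_reversed) (cases s; simp add: X1_gluing_segments)
    then show ?thesis using s by blast
  qed
qed

lemma place_point_step:
  assumes "(x, y) \<in> glue_step glued_triangles"
  shows "(place_point x, place_point y) \<in> glue_step (range segments)"
proof -
  obtain i a b j c d t s where xy: "x = (i, linepath a b t)" "y = (j, linepath c d t)" "t \<in> {0..1}"
    and e: "(i, a, b) \<in> edge_class {..<12} sideX sideY sideZ s" "(j, c, d) \<in> edge_class {..<12} sideX sideY sideZ s"
    using assms by (auto simp: glue_step_def presentation_gluing_def)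
  have "(host i, place i a, place i b) \<in> segments s" "(host j, place j c, place j d) \<in> segments s"
    using e by (auto simp: segments_def image_iff intro: bexI[rotated])
  moreover have "place_point x = (host i, linepath (place i a) (place i b) t)"
    "place_point y = (host j, linepath (place j c) (place j d) t)"
    by (simp_all add: xy place_point_def place_linepath)
  ultimately show ?thesis using xy(3) glue_stepI[OF rangeI] by metis
qed

lemma step_lift:
  assumes "(u, v) \<in> glue_step (range segments)"
  obtains x y where "place_point x = u" "place_point y = v" "(x, y) \<in> glue_step glued_triangles"
    "x \<in> Sigma {..<12} (\<lambda>_. unit_triangle)" "y \<in> Sigma {..<12} (\<lambda>_. unit_triangle)"
proof -
  obtain p a b q c d t s where uv: "u = (p, linepath a b t)" "v = (q, linepath c d t)" "t \<in> {0..1}"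
    and "(p, a, b) \<in> segments s" "(q, c, d) \<in> segments s"
    using assms by (auto simp: glue_step_def)
  then obtain i a' b' j c' d' where e: "(i, a', b') \<in> edge_class {..<12} sideX sideY sideZ s"
      "(j, c', d') \<in> edge_class {..<12} sideX sideY sideZ s"
    and "p = host i" "a = place i a'" "b = place i b'" "q = host j" "c = place j c'" "d = place j d'"
    by (auto simp: segments_def)
  then have "place_point (i, linepath a' b' t) = u" "place_point (j, linepath c' d' t) = v"
    by (simp_all add: place_point_def place_linepath uv)
  moreover have "((i, linepath a' b' t), (j, linepath c' d' t)) \<in> glue_step glued_triangles"
    unfolding presentation_gluing_def by (rule glue_stepI[OF _ e uv(3)]) simp
  moreover have "i < 12" "j < 12" using e by (auto elim: edge_class_cases)
  ultimately show ?thesis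
    using that linepath_in_unit_triangle[OF e(1) uv(3)] linepath_in_unit_triangle[OF e(2) uv(3)] by simp
qed

text \<open>A chain of polygon steps is lifted step by step. Where one lift ends and the next
  begins, there may be two points over the same polygon point; \<open>place_point_eq_glued\<close>
  joins them.\<close>

lemma place_point_equiv_iff:
  assumes x: "x \<in> Sigma {..<12} (\<lambda>_. unit_triangle)" and y: "y \<in> Sigma {..<12} (\<lambda>_. unit_triangle)"
  shows "(place_point x, place_point y) \<in> (glue_step X1_gluing)\<^sup>* \<longleftrightarrow> (x, y) \<in> (glue_step glued_triangles)\<^sup>*"
proof
  assume "(x, y) \<in> (glue_step glued_triangles)\<^sup>*"
  then show "(place_point x, place_point y) \<in> (glue_step X1_gluing)\<^sup>*"
  proof (induction rule: rtrancl_induct)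
    case (step y z)
    then show ?case using place_point_step segments_step_X1 by (meson rtrancl_trans subsetD)
  qed simp
next
  assume "(place_point x, place_point y) \<in> (glue_step X1_gluing)\<^sup>*"
  then have "\<exists>y'. y' \<in> Sigma {..<12} (\<lambda>_. unit_triangle) \<and> place_point y' = place_point y
      \<and> (x, y') \<in> (glue_step glued_triangles)\<^sup>*"
  proof (induction rule: rtrancl_induct)
    case base
    then show ?case using x by blast
  next
    case (step v w)
    then obtain y' where y': "y' \<in> Sigma {..<12} (\<lambda>_. unit_triangle)" "place_point y' = v"
      "(x, y') \<in> (glue_step glued_triangles)\<^sup>*" by blast
    have "(v, w) \<in> glue_step (range segments)" using step(2) X1_step_segments by blast
    then obtain z z' where z: "place_point z = v" "place_point z' = w" "(z, z') \<in> glue_step glued_triangles"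
      "z \<in> Sigma {..<12} (\<lambda>_. unit_triangle)" "z' \<in> Sigma {..<12} (\<lambda>_. unit_triangle)"
      by (rule step_lift)
    have "(y', z) \<in> (glue_step glued_triangles)\<^sup>*" using place_point_eq_glued[OF y'(1) z(4)] y' z by simp
    then have "(x, z') \<in> (glue_step glued_triangles)\<^sup>*" using y'(3) z(3) by (meson rtrancl.rtrancl_into_rtrancl rtrancl_trans)
    then show ?case using z by blast
  qed
  then show "(x, y) \<in> (glue_step glued_triangles)\<^sup>*"
    using place_point_eq_glued y by (meson rtrancl_trans)
qed

lemma X1_polygon_eq: "X1_polygon p = (\<Union>i\<in>{i. i < 12 \<and> host i = p}. place i ` unit_triangle)"
proof -
  have "(\<Union>i\<in>{i. i < 12 \<and> host i = p}. place i ` unit_triangle)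
      = (\<Union>r\<in>{r\<in>set table. fst (fst r) = p}. convex hull (case r of ((p, s, m, e), _) \<Rightarrow> {s, m, e}))"
    unfolding place_image by (auto simp: in_set_table)
  also have "{r\<in>set table. fst (fst r) = p} = set (filter (\<lambda>r. fst (fst r) = p) table)" by simp
  also have "(\<Union>r\<in>set (filter (\<lambda>r. fst (fst r) = p) table). convex hull (case r of ((p, s, m, e), _) \<Rightarrow> {s, m, e}))
      = X1_polygon p"
  proof -
    have rh: "cK + cM = cN + cL" "cK + cM = cL + cN" "cB + cD = cC + cA" "cQ + cS = cP + cR" "cQ + cS = cR + cP"
      by (simp_all add: cK_def cL_def cM_def cN_def cA_def cB_def cC_def cD_def cP_def cQ_def cR_def cS_def)
    show ?thesis
      using rh[THEN convex_hull_parallelogram]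
      by (cases p) (simp_all add: table_def placements_def relators_def insert_commute)
  qed
  finally show ?thesis by simp
qed

lemma place_point_surj: "place_point ` Sigma {..<12} (\<lambda>_. unit_triangle) = Sigma UNIV X1_polygon"
proof
  show "place_point ` Sigma {..<12} (\<lambda>_. unit_triangle) \<subseteq> Sigma UNIV X1_polygon"
    unfolding place_point_def X1_polygon_eq by auto
  show "Sigma UNIV X1_polygon \<subseteq> place_point ` Sigma {..<12} (\<lambda>_. unit_triangle)"
    by (force simp: place_point_def X1_polygon_eq image_iff)
qed

text \<open>Pasting the halves loses no topology: each polygon is covered by finitely many compact
  halves, so openness can be tested on the halves.\<close>

lemma quotient_map_place_point:
  "quotient_map (sum_topology (\<lambda>i. top_of_set unit_triangle) {..<12}) X1
     (\<lambda>x. glue_class UNIV X1_polygon X1_gluing (place_point x))"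
  unfolding quotient_map_def
proof (intro conjI allI impI)
  let ?cls = "glue_class UNIV X1_polygon X1_gluing"
  have top: "topspace X1 = ?cls ` Sigma UNIV X1_polygon"
    by (simp add: X1_def glued_space_def comp_def)
  have topT: "topspace (sum_topology (\<lambda>i. top_of_set unit_triangle) {..<12}) = Sigma {..<12} (\<lambda>_. unit_triangle)"
    by (simp add: comp_def)
  show "(\<lambda>x. ?cls (place_point x)) ` topspace (sum_topology (\<lambda>i. top_of_set unit_triangle) {..<12}) = topspace X1"
    unfolding top topT place_point_surj[symmetric] by (simp add: image_image)
  fix U assume U: "U \<subseteq> topspace X1"
  define W where "W = (\<lambda>p. {z \<in> X1_polygon p. ?cls (p, z) \<in> U})"
  define V where "V = (\<lambda>i. {z \<in> unit_triangle. ?cls (place_point (i, z)) \<in> U})"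
  have "openin X1 U \<longleftrightarrow> (\<forall>p. openin (top_of_set (X1_polygon p)) (W p))"
  proof -
    have "{z. (p, z) \<in> {x \<in> Sigma UNIV X1_polygon. ?cls x \<in> U}} = W p" for p by (auto simp: W_def)
    then show ?thesis
      using U unfolding top by (simp add: X1_def glued_space_def openin_quotient_topology openin_sum_topology comp_def)
  qed
  also have "\<dots> \<longleftrightarrow> (\<forall>i<12. openin (top_of_set unit_triangle) (V i))"
  proof
    assume R: "\<forall>p. openin (top_of_set (X1_polygon p)) (W p)"
    show "\<forall>i<12. openin (top_of_set unit_triangle) (V i)"
    proof (intro allI impI)
      fix i :: nat assume i: "i < 12"
      have sub: "place i ` unit_triangle \<subseteq> X1_polygon (host i)" using i by (auto simp: X1_polygon_eq)
      obtain O' where O': "open O'" "W (host i) = X1_polygon (host i) \<inter> O'" using R by (auto simp: openin_open)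
      have "V i = unit_triangle \<inter> place i -` O'"
      proof -
        have "z \<in> V i \<longleftrightarrow> place i z \<in> W (host i)" if "z \<in> unit_triangle" for z
          using sub that by (auto simp: V_def W_def place_point_def)
        moreover have "place i z \<in> W (host i) \<longleftrightarrow> place i z \<in> O'" if "z \<in> unit_triangle" for z
          using sub that O'(2) by blast
        ultimately show ?thesis by (auto simp: V_def)
      qed
      then show "openin (top_of_set unit_triangle) (V i)"
        using continuous_openin_preimage_gen[OF continuous_on_place O'(1)] by simp
    qed
  next
    assume R: "\<forall>i<12. openin (top_of_set unit_triangle) (V i)"
    show "\<forall>p. openin (top_of_set (X1_polygon p)) (W p)"
    proof
      fix p
      \<comment> \<open>Complements are used: images of closed subsets of the triangle are compact,
        hence closed, and finite unions of them stay closed.\<close>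
      have "compact (place i ` (unit_triangle - V i))" if "i < 12" for i
      proof (rule compact_continuous_image[OF continuous_on_place])
        have "compact unit_triangle"
          unfolding unit_triangle_def triangle_corners_def by (intro finite_imp_compact_convex_hull) simp
        moreover have "closedin (top_of_set unit_triangle) (unit_triangle - V i)"
          using R that by (simp add: closedin_diff)
        ultimately show "compact (unit_triangle - V i)" using closedin_compact by blast
      qed
      then have "compact (\<Union>i\<in>{i. i < 12 \<and> host i = p}. place i ` (unit_triangle - V i))"
        by (intro compact_UN) auto
      moreover have "X1_polygon p - W p = (\<Union>i\<in>{i. i < 12 \<and> host i = p}. place i ` (unit_triangle - V i))"
        by (auto simp: X1_polygon_eq W_def V_def place_point_def)
      ultimately have "closed (X1_polygon p - W p)" using compact_imp_closed by simp
      moreover have "W p = X1_polygon p \<inter> - (X1_polygon p - W p)" by (auto simp: W_def)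
      ultimately show "openin (top_of_set (X1_polygon p)) (W p)"
        by (metis open_Compl openin_open_Int)
    qed
  qed
  also have "\<dots> \<longleftrightarrow> openin (sum_topology (\<lambda>i. top_of_set unit_triangle) {..<12})
      {x \<in> topspace (sum_topology (\<lambda>i. top_of_set unit_triangle) {..<12}). ?cls (place_point x) \<in> U}"
  proof -
    have "{z. (i, z) \<in> {x \<in> Sigma {..<12} (\<lambda>_. unit_triangle). ?cls (place_point x) \<in> U}} = V i" if "i < 12" for i
      using that by (auto simp: V_def)
    then show ?thesis unfolding topT openin_sum_topology by (auto simp: comp_def)
  qed
  finally show "openin (sum_topology (\<lambda>i. top_of_set unit_triangle) {..<12})
      {x \<in> topspace (sum_topology (\<lambda>i. top_of_set unit_triangle) {..<12}). ?cls (place_point x) \<in> U} = openin X1 U" ..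
qed

lemma triangle_space_homeomorphic_X1: "triangle_space {..<12} glued_triangles homeomorphic_space X1"
  unfolding triangle_space_def glued_space_def
proof (rule homeomorphic_space_quotients[OF quotient_map_quotient_topology quotient_map_place_point])
  fix x y :: "nat \<times> complex"
  assume "x \<in> topspace (sum_topology (\<lambda>i. top_of_set unit_triangle) {..<12})"
    "y \<in> topspace (sum_topology (\<lambda>i. top_of_set unit_triangle) {..<12})"
  then have xy: "x \<in> Sigma {..<12} (\<lambda>_. unit_triangle)" "y \<in> Sigma {..<12} (\<lambda>_. unit_triangle)"
    by (simp_all add: comp_def)
  then have "place_point x \<in> Sigma UNIV X1_polygon" "place_point y \<in> Sigma UNIV X1_polygon"
    using place_point_surj by blast+
  then show "glue_class {..<12} (\<lambda>_. unit_triangle) glued_triangles x = glue_class {..<12} (\<lambda>_. unit_triangle) glued_triangles y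
      \<longleftrightarrow> glue_class UNIV X1_polygon X1_gluing (place_point x) = glue_class UNIV X1_polygon X1_gluing (place_point y)"
    using glue_class_eq_iff place_point_equiv_iff xy by metis
qed

theorem lemma4p4:
  shows "\<exists>(I :: nat set) (G :: nat gluing).
           triangle_complex I G \<and>
           triangle_space I G homeomorphic_space X1 \<and>
           (\<exists>(K :: nat set set) p. universal_cover_complex I G K p \<and> systolic K)"
proof -
  obtain mul one inv gen height
    where "presented_triangle_group (mul :: nat \<Rightarrow> nat \<Rightarrow> nat) one inv {..<12} sideX sideY sideZ gen height"
    by (rule fundamental_group_exists)
  then interpret presented_triangle_group mul one inv "{..<12}" sideX sideY sideZ gen height .
  have "systolic cayley"
    by (rule systolic_cayley[where colour = "\<lambda>a. snd a = (weight (fst a) = 2)"])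
      (use link_edge_colour link_edge_no_square in blast)+
  then show ?thesis
    using triangle_complex_presentation triangle_space_homeomorphic_X1 universal_cover_cayley by blast
qed

end
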